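(* Let $\mathcal{C}$ be a finitely complete $(\infty,1)$-category such that the final object $1$ has only two subobjects, let $I$ be a set and let $\Phi$ be a product closed filter of the power set $P(I)$. Let $(f_i)_{i\in I},(g_i)_{i\in I}:(X_i)_{i\in I}\to(Y_i)_{i\in I}$ be two maps. Then $(f_i)_{i\in I}\simeq(g_i)_{i\in I}$ in $\prod_\Phi\mathcal{C}$ if and only if $$\{i\in I: f_i\simeq g_i \text{ in }\mathcal{C}\}\in\Phi.$$
   Context: An $(\infty,1)$-category means a quasi-category, Kan enriched category or complete Segal space (CSS). A product closed filter of $P(I)$ is a subset $\Phi\subseteq P(I)$ that contains $I$, is closed under finite intersections and is upward closed. By assumption $\mathrm{Sub}_{\mathcal{C}}(1)\cong\{0,1\}$, so $\mathrm{Sub}_{\mathcal{C}^I}(1)=\{0,1\}^I=P(I)$ and $\Phi$ is a filter of subobjects of the final object of the finitely complete $(\infty,1)$-category $\mathcal{C}^I$. The filter product is the filter quotient $\prod_\Phi\mathcal{C}:=(\mathcal{C}^I)_\Phi$. Filter quotient of a finitely complete $(\infty,1)$-category $\mathcal{D}$ by a filter $\Phi\subseteq \mathrm{Sub}_{\mathcal D}(1)$: for a CSS (or quasi-category), $\mathcal{D}_\Phi=\mathrm{colim}_{V\in\Phi^{op}}\mathcal{D}_{/V}$, the level-wise colimit with transition maps $-\times U:\mathcal{D}_{/V}\to\mathcal{D}_{/U}$ for $U\leq V$; for a Kan enriched category, $\mathcal{D}_\Phi$ has the objects of $\mathcal{D}$ and $\mathrm{Map}_{\mathcal{D}_\Phi}(X,Y)=\mathrm{colim}_{V\in\Phi^{op}}\mathrm{Map}_{\mathcal{D}}(X\times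 V,Y)$. Objects $(X_i)_{i\in I}$ and maps $(f_i)_{i\in I}$ of $\mathcal{C}^I$ are regarded in $\prod_\Phi\mathcal{C}$ via the canonical functor $P_\Phi:\mathcal{C}^I\to(\mathcal{C}^I)_\Phi$. The symbol $\simeq$ between parallel maps means that they lie in the same path component of the mapping space.
   Formalization: The subobject 0 of the final object is additionally assumed to be strictly initial (every object with a map to 0 is initial); without this the claim fails, e.g. for the category of maps from a set to a pointed set. *)

theory Defs
  imports "HOL-Library.FuncSet"
begin

section \<open>Filters\<close>

definition product_closed_filter :: "'i set \<Rightarrow> 'i set set \<Rightarrow> bool" where
  "product_closed_filter I \<Phi> \<longleftrightarrow>
     \<Phi> \<subseteq> Pow I \<and> I \<in> \<Phi> \<and>
     (\<forall>A\<in>\<Phi>. \<forall>B\<in>\<Phi>. A \<inter> B \<in> \<Phi>) \<and>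
     (\<forall>A\<in>\<Phi>. \<forall>B. A \<subseteq> B \<and> B \<subseteq> I \<longrightarrow> B \<in> \<Phi>)"

text \<open>The subobject of the final object of \<open>C\<^sup>I\<close> that corresponds to \<open>A \<subseteq> I\<close> under
  \<open>Sub(1) = {0,1}\<^sup>I = P(I)\<close>, and the filter of subobjects corresponding to \<open>\<Phi>\<close>.\<close>

definition subset_object :: "'i set \<Rightarrow> 'o \<Rightarrow> 'o \<Rightarrow> 'i set \<Rightarrow> 'i \<Rightarrow> 'o" where
  "subset_object I zero one A = (\<lambda>i\<in>I. if i \<in> A then one else zero)"

definition subset_filter :: "'i set \<Rightarrow> 'o \<Rightarrow> 'o \<Rightarrow> 'i set set \<Rightarrow> ('i \<Rightarrow> 'o) set" where
  "subset_filter I zero one \<Phi> = subset_object I zero one ` \<Phi>"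

text \<open>\<open>S\<close> is the collection of objects underlying a subobject of the final object, preordered by
  existence of a map.  (A subobject of the final object is determined by its underlying object, as
  the space of maps to the final object is contractible.)\<close>

definition sub_equiv :: "'o set \<Rightarrow> ('o \<Rightarrow> 'o \<Rightarrow> bool) \<Rightarrow> ('o \<times> 'o) set" where
  "sub_equiv S le = {(u, v). u \<in> S \<and> v \<in> S \<and> le u v \<and> le v u}"

definition only_two_subobjects :: "'o set \<Rightarrow> ('o \<Rightarrow> 'o \<Rightarrow> bool) \<Rightarrow> 'o \<Rightarrow> 'o \<Rightarrow> bool" where
  "only_two_subobjects S le zero one \<longleftrightarrow>
     zero \<in> S \<and> one \<in> S \<and>
     S // sub_equiv S le = {sub_equiv S le `` {zero}, sub_equiv S le `` {one}} \<and>
     sub_equiv S le `` {zero} \<noteq> sub_equiv S le `` {one}"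

text \<open>Colimit of sets \<open>S V\<close> over the opposite of a downward directed preorder \<open>(J, le)\<close>; for
  \<open>le W V\<close> the transition map is \<open>t V W : S V \<rightarrow> S W\<close>.  Two elements are identified iff
  they become equal at a common later stage.\<close>

definition colim_rel ::
  "'v set \<Rightarrow> ('v \<Rightarrow> 'v \<Rightarrow> bool) \<Rightarrow> ('v \<Rightarrow> 'a set) \<Rightarrow> ('v \<Rightarrow> 'v \<Rightarrow> 'a \<Rightarrow> 'a) \<Rightarrow> (('v \<times> 'a) \<times> ('v \<times> 'a)) set"
  where
  "colim_rel J le S t =
     {((U, x), (V, y)). U \<in> J \<and> x \<in> S U \<and> V \<in> J \<and> y \<in> S V \<and>
        (\<exists>W\<in>J. le W U \<and> le W V \<and> t U W x = t V W y)}"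


section \<open>Simplicial sets\<close>

text \<open>A morphism \<open>\<alpha> : [m] \<rightarrow> [n]\<close> of the simplex category is represented by any function on the
  naturals with the right restriction to \<open>{..m}\<close>.\<close>

definition ord_maps :: "nat \<Rightarrow> nat \<Rightarrow> (nat \<Rightarrow> nat) set" where
  "ord_maps m n = {\<alpha>. (\<forall>i\<le>m. \<alpha> i \<le> n) \<and> (\<forall>i j. i \<le> j \<and> j \<le> m \<longrightarrow> \<alpha> i \<le> \<alpha> j)}"

definition coface :: "nat \<Rightarrow> nat \<Rightarrow> nat" where
  "coface i k = (if k < i then k else Suc k)"

text \<open>The join of \<open>\<alpha> : [m] \<rightarrow> [n]\<close> with an identity on further vertices to the right.\<close>

definition join_id :: "nat \<Rightarrow> nat \<Rightarrow> (nat \<Rightarrow> nat) \<Rightarrow> nat \<Rightarrow> nat" where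
  "join_id m n \<alpha> k = (if k \<le> m then \<alpha> k else n + (k - m))"

text \<open>\<open>act X m n \<alpha> : X\<^sub>n \<rightarrow> X\<^sub>m\<close> is the action of \<open>\<alpha> : [m] \<rightarrow> [n]\<close>.\<close>

record 'a sset =
  simp :: "nat \<Rightarrow> 'a set"
  act :: "nat \<Rightarrow> nat \<Rightarrow> (nat \<Rightarrow> nat) \<Rightarrow> 'a \<Rightarrow> 'a"

definition simplicial_set :: "'a sset \<Rightarrow> bool" where
  "simplicial_set X \<longleftrightarrow>
     (\<forall>m n. \<forall>\<alpha>\<in>ord_maps m n. \<forall>x\<in>simp X n. act X m n \<alpha> x \<in> simp X m) \<and>
     (\<forall>m n. \<forall>\<alpha>\<in>ord_maps m n. \<forall>\<beta>\<in>ord_maps m n. \<forall>x\<in>simp X n.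
        (\<forall>i\<le>m. \<alpha> i = \<beta> i) \<longrightarrow> act X m n \<alpha> x = act X m n \<beta> x) \<and>
     (\<forall>n. \<forall>x\<in>simp X n. act X n n id x = x) \<and>
     (\<forall>l m n. \<forall>\<beta>\<in>ord_maps l m. \<forall>\<alpha>\<in>ord_maps m n. \<forall>x\<in>simp X n.
        act X l m \<beta> (act X m n \<alpha> x) = act X l n (\<alpha> \<circ> \<beta>) x)"

definition face :: "'a sset \<Rightarrow> nat \<Rightarrow> nat \<Rightarrow> 'a \<Rightarrow> 'a" where
  "face X n i = act X (n - 1) n (coface i)"

definition vertex :: "'a sset \<Rightarrow> nat \<Rightarrow> nat \<Rightarrow> 'a \<Rightarrow> 'a" where
  "vertex X n i = act X 0 n (\<lambda>_. i)"

definition const_simp :: "'a sset \<Rightarrow> nat \<Rightarrow> 'a \<Rightarrow> 'a" where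
  "const_simp X n = act X n 0 (\<lambda>_. 0)"

definition sset_map :: "'a sset \<Rightarrow> 'b sset \<Rightarrow> (nat \<Rightarrow> 'a \<Rightarrow> 'b) \<Rightarrow> bool" where
  "sset_map X Y f \<longleftrightarrow>
     (\<forall>n. \<forall>x\<in>simp X n. f n x \<in> simp Y n) \<and>
     (\<forall>m n. \<forall>\<alpha>\<in>ord_maps m n. \<forall>x\<in>simp X n. f m (act X m n \<alpha> x) = act Y m n \<alpha> (f n x))"

definition std_simplex :: "nat \<Rightarrow> (nat \<Rightarrow> nat) sset" where
  "std_simplex n =
     \<lparr>simp = \<lambda>m. ord_maps m n \<inter> extensional {..m},
      act = \<lambda>l m \<alpha> x. restrict (x \<circ> \<alpha>) {..l}\<rparr>"

definition std_const :: "nat \<Rightarrow> nat \<Rightarrow> nat \<Rightarrow> nat" where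
  "std_const r n = (\<lambda>_\<in>{..n}. r)"

definition sset_prod :: "'a sset \<Rightarrow> 'b sset \<Rightarrow> ('a \<times> 'b) sset" where
  "sset_prod X Y =
     \<lparr>simp = \<lambda>n. simp X n \<times> simp Y n,
      act = \<lambda>m n \<alpha> p. (act X m n \<alpha> (fst p), act Y m n \<alpha> (snd p))\<rparr>"

definition sset_Pi :: "'i set \<Rightarrow> ('i \<Rightarrow> 'a sset) \<Rightarrow> ('i \<Rightarrow> 'a) sset" where
  "sset_Pi I E =
     \<lparr>simp = \<lambda>n. PiE I (\<lambda>i. simp (E i) n),
      act = \<lambda>m n \<alpha> x. \<lambda>i\<in>I. act (E i) m n \<alpha> (x i)\<rparr>"

definition sset_colim ::
  "'v set \<Rightarrow> ('v \<Rightarrow> 'v \<Rightarrow> bool) \<Rightarrow> ('v \<Rightarrow> 'a sset) \<Rightarrow> ('v \<Rightarrow> 'v \<Rightarrow> nat \<Rightarrow> 'a \<Rightarrow> 'a) \<Rightarrow> ('v \<times> 'a) set sset"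
  where
  "sset_colim J le E t =
     \<lparr>simp = \<lambda>n. Sigma J (\<lambda>V. simp (E V) n) //
               colim_rel J le (\<lambda>V. simp (E V) n) (\<lambda>V W. t V W n),
      act = \<lambda>m n \<alpha> c. colim_rel J le (\<lambda>V. simp (E V) m) (\<lambda>V W. t V W m) ``
               ((\<lambda>(V, x). (V, act (E V) m n \<alpha> x)) ` c)\<rparr>"

definition colim_class ::
  "'v set \<Rightarrow> ('v \<Rightarrow> 'v \<Rightarrow> bool) \<Rightarrow> ('v \<Rightarrow> 'a sset) \<Rightarrow> ('v \<Rightarrow> 'v \<Rightarrow> nat \<Rightarrow> 'a \<Rightarrow> 'a) \<Rightarrow>
     'v \<Rightarrow> nat \<Rightarrow> 'a \<Rightarrow> ('v \<times> 'a) set" where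
  "colim_class J le E t V n x =
     colim_rel J le (\<lambda>V. simp (E V) n) (\<lambda>V W. t V W n) `` {(V, x)}"

text \<open>Compatible families of faces, indexed by \<open>{..n} - {k}\<close>.  Zero-simplices have no faces, so
  there is no compatibility condition for \<open>n = 1\<close>.\<close>

definition horn :: "'a sset \<Rightarrow> nat \<Rightarrow> nat \<Rightarrow> (nat \<Rightarrow> 'a) \<Rightarrow> bool" where
  "horn X n k y \<longleftrightarrow>
     (\<forall>i\<le>n. i \<noteq> k \<longrightarrow> y i \<in> simp X (n - 1)) \<and>
     (2 \<le> n \<longrightarrow> (\<forall>i j. i < j \<and> j \<le> n \<and> i \<noteq> k \<and> j \<noteq> k \<longrightarrow>
        face X (n - 1) i (y j) = face X (n - 1) (j - 1) (y i)))"

definition kan_complex :: "'a sset \<Rightarrow> bool" where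
  "kan_complex X \<longleftrightarrow> simplicial_set X \<and>
     (\<forall>n k y. 1 \<le> n \<and> k \<le> n \<and> horn X n k y \<longrightarrow>
        (\<exists>x\<in>simp X n. \<forall>i\<le>n. i \<noteq> k \<longrightarrow> face X n i x = y i))"

definition kan_fibration :: "'a sset \<Rightarrow> 'b sset \<Rightarrow> (nat \<Rightarrow> 'a \<Rightarrow> 'b) \<Rightarrow> bool" where
  "kan_fibration E B p \<longleftrightarrow> sset_map E B p \<and>
     (\<forall>n k y. \<forall>b\<in>simp B n.
        1 \<le> n \<and> k \<le> n \<and> horn E n k y \<and> (\<forall>i\<le>n. i \<noteq> k \<longrightarrow> face B n i b = p (n - 1) (y i)) \<longrightarrow>
        (\<exists>x\<in>simp E n. p n x = b \<and> (\<forall>i\<le>n. i \<noteq> k \<longrightarrow> face E n i x = y i)))"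

definition same_path_component :: "'a sset \<Rightarrow> 'a \<Rightarrow> 'a \<Rightarrow> bool" where
  "same_path_component X x y \<longleftrightarrow> x \<in> simp X 0 \<and> y \<in> simp X 0 \<and>
     (x, y) \<in> ({(vertex X 1 0 e, vertex X 1 1 e) | e. e \<in> simp X 1} \<union>
               {(vertex X 1 1 e, vertex X 1 0 e) | e. e \<in> simp X 1})\<^sup>*"

definition path_components :: "'a sset \<Rightarrow> 'a set \<Rightarrow> 'a sset" where
  "path_components X A =
     \<lparr>simp = \<lambda>n. {x \<in> simp X n. \<exists>a\<in>A. same_path_component X a (vertex X n 0 x)}, act = act X\<rparr>"

definition homotopic :: "'a sset \<Rightarrow> 'b sset \<Rightarrow> (nat \<Rightarrow> 'a \<Rightarrow> 'b) \<Rightarrow> (nat \<Rightarrow> 'a \<Rightarrow> 'b) \<Rightarrow> bool" where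
  "homotopic X Y f g \<longleftrightarrow>
     (\<exists>H. sset_map (sset_prod X (std_simplex 1)) Y H \<and>
        (\<forall>n. \<forall>x\<in>simp X n. H n (x, std_const 0 n) = f n x \<and> H n (x, std_const 1 n) = g n x))"

text \<open>Used for Kan complexes only, where homotopy equivalences are the weak equivalences.\<close>

definition homotopy_equivalence :: "'a sset \<Rightarrow> 'b sset \<Rightarrow> (nat \<Rightarrow> 'a \<Rightarrow> 'b) \<Rightarrow> bool" where
  "homotopy_equivalence X Y f \<longleftrightarrow> sset_map X Y f \<and>
     (\<exists>g. sset_map Y X g \<and>
        homotopic X X (\<lambda>n x. g n (f n x)) (\<lambda>n x. x) \<and>
        homotopic Y Y (\<lambda>n y. f n (g n y)) (\<lambda>n y. y))"

definition contractible :: "'a sset \<Rightarrow> bool" where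
  "contractible X \<longleftrightarrow> homotopy_equivalence X (std_simplex 0) (\<lambda>n x. std_const 0 n)"

text \<open>A \<open>(-1)\<close>-truncated map: an equivalence onto a union of path components.\<close>

definition neg1_truncated :: "'a sset \<Rightarrow> 'b sset \<Rightarrow> (nat \<Rightarrow> 'a \<Rightarrow> 'b) \<Rightarrow> bool" where
  "neg1_truncated X Y f \<longleftrightarrow> sset_map X Y f \<and>
     homotopy_equivalence X (path_components Y (f 0 ` simp X 0)) f"

definition empty_or_contractible :: "'a sset \<Rightarrow> bool" where
  "empty_or_contractible X \<longleftrightarrow> simp X 0 = {} \<or> contractible X"

text \<open>The simplicial set of maps \<open>\<Delta>\<^sup>1 \<rightarrow> S\<close>, and the homotopy pullback of
  \<open>\<phi> : A \<rightarrow> S\<close> and \<open>\<psi> : B \<rightarrow> S\<close>.\<close>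

definition path_space :: "'a sset \<Rightarrow> (nat \<Rightarrow> (nat \<Rightarrow> nat) \<times> (nat \<Rightarrow> nat) \<Rightarrow> 'a) sset" where
  "path_space S =
     \<lparr>simp = \<lambda>n. {h. sset_map (sset_prod (std_simplex n) (std_simplex 1)) S h \<and>
        (\<forall>l. h l \<in> extensional (simp (sset_prod (std_simplex n) (std_simplex 1)) l))},
      act = \<lambda>m n \<alpha> h l. \<lambda>p\<in>simp (sset_prod (std_simplex m) (std_simplex 1)) l.
        h l (restrict (\<alpha> \<circ> fst p) {..l}, snd p)\<rparr>"

definition homotopy_pullback ::
  "'a sset \<Rightarrow> 'b sset \<Rightarrow> 'c sset \<Rightarrow> (nat \<Rightarrow> 'a \<Rightarrow> 'c) \<Rightarrow> (nat \<Rightarrow> 'b \<Rightarrow> 'c) \<Rightarrow>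
     ('a \<times> 'b \<times> (nat \<Rightarrow> (nat \<Rightarrow> nat) \<times> (nat \<Rightarrow> nat) \<Rightarrow> 'c)) sset" where
  "homotopy_pullback A B S \<phi> \<psi> =
     \<lparr>simp = \<lambda>n. {(a, b, h). a \<in> simp A n \<and> b \<in> simp B n \<and> h \<in> simp (path_space S) n \<and>
        (\<forall>l. \<forall>x\<in>simp (std_simplex n) l.
           h l (x, std_const 0 l) = act S l n x (\<phi> n a) \<and>
           h l (x, std_const 1 l) = act S l n x (\<psi> n b))},
      act = \<lambda>m n \<alpha> (a, b, h).
        (act A m n \<alpha> a, act B m n \<alpha> b, act (path_space S) m n \<alpha> h)\<rparr>"


section \<open>Kan enriched categories\<close>

text \<open>\<open>comp C X Y Z n : Map(Y,Z)\<^sub>n \<times> Map(X,Y)\<^sub>n \<rightarrow> Map(X,Z)\<^sub>n\<close>.\<close>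

record ('o, 'm) enriched =
  obj :: "'o set"
  Map :: "'o \<Rightarrow> 'o \<Rightarrow> 'm sset"
  comp :: "'o \<Rightarrow> 'o \<Rightarrow> 'o \<Rightarrow> nat \<Rightarrow> 'm \<Rightarrow> 'm \<Rightarrow> 'm"
  ident :: "'o \<Rightarrow> 'm"

definition kan_enriched_category :: "('o, 'm) enriched \<Rightarrow> bool" where
  "kan_enriched_category C \<longleftrightarrow>
     (\<forall>X\<in>obj C. \<forall>Y\<in>obj C. kan_complex (Map C X Y)) \<and>
     (\<forall>X\<in>obj C. ident C X \<in> simp (Map C X X) 0) \<and>
     (\<forall>X\<in>obj C. \<forall>Y\<in>obj C. \<forall>Z\<in>obj C.
        sset_map (sset_prod (Map C Y Z) (Map C X Y)) (Map C X Z)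
          (\<lambda>n (g, f). comp C X Y Z n g f)) \<and>
     (\<forall>X\<in>obj C. \<forall>Y\<in>obj C. \<forall>n. \<forall>f\<in>simp (Map C X Y) n.
        comp C X X Y n f (const_simp (Map C X X) n (ident C X)) = f \<and>
        comp C X Y Y n (const_simp (Map C Y Y) n (ident C Y)) f = f) \<and>
     (\<forall>X\<in>obj C. \<forall>Y\<in>obj C. \<forall>Z\<in>obj C. \<forall>W\<in>obj C. \<forall>n.
        \<forall>f\<in>simp (Map C X Y) n. \<forall>g\<in>simp (Map C Y Z) n. \<forall>h\<in>simp (Map C Z W) n.
        comp C X Z W n h (comp C X Y Z n g f) = comp C X Y W n (comp C Y Z W n h g) f)"

definition kan_postcomp ::
  "('o, 'm) enriched \<Rightarrow> 'o \<Rightarrow> 'o \<Rightarrow> 'o \<Rightarrow> 'm \<Rightarrow> nat \<Rightarrow> 'm \<Rightarrow> 'm" where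
  "kan_postcomp C X Y Z g n f = comp C X Y Z n (const_simp (Map C Y Z) n g) f"

definition kan_precomp ::
  "('o, 'm) enriched \<Rightarrow> 'o \<Rightarrow> 'o \<Rightarrow> 'o \<Rightarrow> 'm \<Rightarrow> nat \<Rightarrow> 'm \<Rightarrow> 'm" where
  "kan_precomp C X Y Z f n g = comp C X Y Z n g (const_simp (Map C X Y) n f)"

definition kan_final :: "('o, 'm) enriched \<Rightarrow> 'o \<Rightarrow> bool" where
  "kan_final C t \<longleftrightarrow> t \<in> obj C \<and> (\<forall>X\<in>obj C. contractible (Map C X t))"

definition kan_initial :: "('o, 'm) enriched \<Rightarrow> 'o \<Rightarrow> bool" where
  "kan_initial C z \<longleftrightarrow> z \<in> obj C \<and> (\<forall>Y\<in>obj C. contractible (Map C z Y))"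

definition kan_le :: "('o, 'm) enriched \<Rightarrow> 'o \<Rightarrow> 'o \<Rightarrow> bool" where
  "kan_le C U V \<longleftrightarrow> simp (Map C U V) 0 \<noteq> {}"

text \<open>Every object mapping to \<open>z\<close> is initial (in particular \<open>z\<close> itself).  A subobject \<open>0\<close> of the
  final object, even if initial, need not be strict: in the category of functions \<open>A \<rightarrow> B\<close> from a
  set to a pointed set the final object has exactly two subobjects, and the objects over
  \<open>0 = (\<emptyset> \<rightarrow> 1)\<close> form a copy of the category of pointed sets.\<close>

definition kan_strict_initial :: "('o, 'm) enriched \<Rightarrow> 'o \<Rightarrow> bool" where
  "kan_strict_initial C z \<longleftrightarrow> z \<in> obj C \<and> (\<forall>X\<in>obj C. kan_le C X z \<longrightarrow> kan_initial C X)"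

definition kan_product :: "('o, 'm) enriched \<Rightarrow> 'o \<Rightarrow> 'o \<Rightarrow> 'o \<Rightarrow> 'm \<Rightarrow> 'm \<Rightarrow> bool" where
  "kan_product C X Y P p q \<longleftrightarrow>
     P \<in> obj C \<and> p \<in> simp (Map C P X) 0 \<and> q \<in> simp (Map C P Y) 0 \<and>
     (\<forall>Z\<in>obj C. homotopy_equivalence (Map C Z P) (sset_prod (Map C Z X) (Map C Z Y))
        (\<lambda>n u. (kan_postcomp C Z P X p n u, kan_postcomp C Z P Y q n u)))"

text \<open>A square \<open>P \<rightarrow> X \<rightarrow> S \<leftarrow> Y \<leftarrow> P\<close> commuting up to the homotopy \<open>e\<close>
  is a pullback if every \<open>Map(Z,P)\<close> is the homotopy pullback.\<close>

definition kan_pullback ::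
  "('o, 'm) enriched \<Rightarrow> 'o \<Rightarrow> 'o \<Rightarrow> 'o \<Rightarrow> 'm \<Rightarrow> 'm \<Rightarrow> 'o \<Rightarrow> 'm \<Rightarrow> 'm \<Rightarrow> 'm \<Rightarrow> bool" where
  "kan_pullback C X Y S f g P p q e \<longleftrightarrow>
     P \<in> obj C \<and> p \<in> simp (Map C P X) 0 \<and> q \<in> simp (Map C P Y) 0 \<and> e \<in> simp (Map C P S) 1 \<and>
     vertex (Map C P S) 1 0 e = comp C P X S 0 f p \<and>
     vertex (Map C P S) 1 1 e = comp C P Y S 0 g q \<and>
     (\<forall>Z\<in>obj C. homotopy_equivalence (Map C Z P)
        (homotopy_pullback (Map C Z X) (Map C Z Y) (Map C Z S)
           (kan_postcomp C Z X S f) (kan_postcomp C Z Y S g))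
        (\<lambda>n u. (kan_postcomp C Z P X p n u, kan_postcomp C Z P Y q n u,
           \<lambda>l. \<lambda>(x, y)\<in>simp (sset_prod (std_simplex n) (std_simplex 1)) l.
             comp C Z P S l (act (Map C P S) l 1 y e) (act (Map C Z P) l n x u))))"

definition kan_finitely_complete :: "('o, 'm) enriched \<Rightarrow> bool" where
  "kan_finitely_complete C \<longleftrightarrow> (\<exists>t. kan_final C t) \<and>
     (\<forall>X\<in>obj C. \<forall>Y\<in>obj C. \<forall>S\<in>obj C. \<forall>f\<in>simp (Map C X S) 0. \<forall>g\<in>simp (Map C Y S) 0.
        \<exists>P p q e. kan_pullback C X Y S f g P p q e)"

definition kan_mono :: "('o, 'm) enriched \<Rightarrow> 'o \<Rightarrow> 'o \<Rightarrow> 'm \<Rightarrow> bool" where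
  "kan_mono C U V u \<longleftrightarrow> u \<in> simp (Map C U V) 0 \<and>
     (\<forall>Z\<in>obj C. neg1_truncated (Map C Z U) (Map C Z V) (kan_postcomp C Z U V u))"

definition kan_sub :: "('o, 'm) enriched \<Rightarrow> 'o \<Rightarrow> 'o set" where
  "kan_sub C t = {U \<in> obj C. \<exists>u. kan_mono C U t u}"

definition kan_power :: "'i set \<Rightarrow> ('o, 'm) enriched \<Rightarrow> ('i \<Rightarrow> 'o, 'i \<Rightarrow> 'm) enriched" where
  "kan_power I C =
     \<lparr>obj = PiE I (\<lambda>_. obj C),
      Map = \<lambda>X Y. sset_Pi I (\<lambda>i. Map C (X i) (Y i)),
      comp = \<lambda>X Y Z n g f. \<lambda>i\<in>I. comp C (X i) (Y i) (Z i) n (g i) (f i),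
      ident = \<lambda>X. \<lambda>i\<in>I. ident C (X i)\<rparr>"

text \<open>A choice of products \<open>X \<times> V = pr X V\<close>, \<open>V \<in> F\<close>, with projections \<open>p X V\<close> to \<open>X\<close>, and of
  transition maps \<open>tr X V U : X \<times> U \<rightarrow> X \<times> V\<close> over \<open>X\<close> for \<open>U \<le> V\<close>, functorial in \<open>U\<close>.
  On \<open>C\<^sup>I\<close> and \<open>subset_filter\<close> one obtains such a choice from products \<open>X \<times> 0\<close> in \<open>C\<close> by
  taking \<open>X \<times> 1 = X\<close>, since the only nonidentity transition map is then the projection
  \<open>X \<times> 0 \<rightarrow> X\<close>.\<close>

definition kan_product_system ::
  "('o, 'm) enriched \<Rightarrow> 'o set \<Rightarrow> ('o \<Rightarrow> 'o \<Rightarrow> 'o) \<Rightarrow> ('o \<Rightarrow> 'o \<Rightarrow> 'm) \<Rightarrow>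
     ('o \<Rightarrow> 'o \<Rightarrow> 'o \<Rightarrow> 'm) \<Rightarrow> bool" where
  "kan_product_system D F pr p tr \<longleftrightarrow>
     (\<forall>X\<in>obj D. \<forall>V\<in>F.
        (\<exists>q. kan_product D X V (pr X V) (p X V) q) \<and>
        tr X V V = ident D (pr X V) \<and>
        (\<forall>U\<in>F. kan_le D U V \<longrightarrow>
           tr X V U \<in> simp (Map D (pr X U) (pr X V)) 0 \<and>
           comp D (pr X U) (pr X V) X 0 (p X V) (tr X V U) = p X U \<and>
           (\<forall>W\<in>F. kan_le D W U \<longrightarrow>
              comp D (pr X W) (pr X U) (pr X V) 0 (tr X V U) (tr X U W) = tr X V W)))"

text \<open>The mapping space \<open>Map(X,Y)\<close> of the filter quotient \<open>D\<^sub>F\<close>: the colimit of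
  \<open>Map\<^sub>D(X \<times> V, Y)\<close> over \<open>V \<in> F\<^sup>o\<^sup>p\<close>.\<close>

definition kan_quotient_Map ::
  "('o, 'm) enriched \<Rightarrow> 'o set \<Rightarrow> ('o \<Rightarrow> 'o \<Rightarrow> 'o) \<Rightarrow> ('o \<Rightarrow> 'o \<Rightarrow> 'o \<Rightarrow> 'm) \<Rightarrow>
     'o \<Rightarrow> 'o \<Rightarrow> ('o \<times> 'm) set sset" where
  "kan_quotient_Map D F pr tr X Y =
     sset_colim F (kan_le D) (\<lambda>V. Map D (pr X V) Y)
       (\<lambda>V U. kan_precomp D (pr X U) (pr X V) Y (tr X V U))"

text \<open>The canonical functor on maps \<open>X \<rightarrow> Y\<close>: the class of \<open>X \<times> 1 \<rightarrow> X \<rightarrow> Y\<close>.\<close>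

definition kan_quotient_functor ::
  "('o, 'm) enriched \<Rightarrow> 'o set \<Rightarrow> ('o \<Rightarrow> 'o \<Rightarrow> 'o) \<Rightarrow> ('o \<Rightarrow> 'o \<Rightarrow> 'm) \<Rightarrow>
     ('o \<Rightarrow> 'o \<Rightarrow> 'o \<Rightarrow> 'm) \<Rightarrow> 'o \<Rightarrow> 'o \<Rightarrow> 'o \<Rightarrow> nat \<Rightarrow> 'm \<Rightarrow> ('o \<times> 'm) set" where
  "kan_quotient_functor D F pr p tr one X Y n f =
     colim_class F (kan_le D) (\<lambda>V. Map D (pr X V) Y)
       (\<lambda>V U. kan_precomp D (pr X U) (pr X V) Y (tr X V U))
       one n (kan_precomp D (pr X one) X Y (p X one) n f)"


section \<open>Quasi-categories\<close>

definition quasi_category :: "'a sset \<Rightarrow> bool" where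
  "quasi_category X \<longleftrightarrow> simplicial_set X \<and>
     (\<forall>n k y. 0 < k \<and> k < n \<and> horn X n k y \<longrightarrow>
        (\<exists>x\<in>simp X n. \<forall>i\<le>n. i \<noteq> k \<longrightarrow> face X n i x = y i))"

definition qc_power :: "'i set \<Rightarrow> 'a sset \<Rightarrow> ('i \<Rightarrow> 'a) sset" where
  "qc_power I X = sset_Pi I (\<lambda>_. X)"

text \<open>The slice \<open>X\<^bsub>/v\<^esub>\<close> (\<open>n\<close>-simplices are the \<open>(n+1)\<close>-simplices of \<open>X\<close> with last vertex \<open>v\<close>)
  and its projection to \<open>X\<close>.\<close>

definition qc_slice :: "'a sset \<Rightarrow> 'a \<Rightarrow> 'a sset" where
  "qc_slice X v =
     \<lparr>simp = \<lambda>n. {s \<in> simp X (n + 1). vertex X (n + 1) (n + 1) s = v},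
      act = \<lambda>m n \<alpha>. act X (m + 1) (n + 1) (join_id m n \<alpha>)\<rparr>"

definition qc_forget :: "'a sset \<Rightarrow> nat \<Rightarrow> 'a \<Rightarrow> 'a" where
  "qc_forget X n = face X (n + 1) (n + 1)"

text \<open>The mapping space \<open>Hom\<^sup>R(x,y)\<close>: the fibre over \<open>x\<close> of \<open>X\<^bsub>/y\<^esub> \<rightarrow> X\<close>.  Its vertices are the
  edges from \<open>x\<close> to \<open>y\<close>.\<close>

definition qc_Map :: "'a sset \<Rightarrow> 'a \<Rightarrow> 'a \<Rightarrow> 'a sset" where
  "qc_Map X x y =
     \<lparr>simp = \<lambda>n. {s \<in> simp (qc_slice X y) n. qc_forget X n s = const_simp X n x},
      act = act (qc_slice X y)\<rparr>"

definition qc_final :: "'a sset \<Rightarrow> 'a \<Rightarrow> bool" where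
  "qc_final X t \<longleftrightarrow> t \<in> simp X 0 \<and> (\<forall>x\<in>simp X 0. contractible (qc_Map X x t))"

definition qc_initial :: "'a sset \<Rightarrow> 'a \<Rightarrow> bool" where
  "qc_initial X z \<longleftrightarrow> z \<in> simp X 0 \<and> (\<forall>y\<in>simp X 0. contractible (qc_Map X z y))"

definition qc_le :: "'a sset \<Rightarrow> 'a \<Rightarrow> 'a \<Rightarrow> bool" where
  "qc_le X u v \<longleftrightarrow> simp (qc_Map X u v) 0 \<noteq> {}"

definition qc_strict_initial :: "'a sset \<Rightarrow> 'a \<Rightarrow> bool" where
  "qc_strict_initial X z \<longleftrightarrow> z \<in> simp X 0 \<and> (\<forall>x\<in>simp X 0. qc_le X x z \<longrightarrow> qc_initial X x)"

text \<open>The slice over a pair of objects \<open>(u,v)\<close>, and over a cospan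
  \<open>f : x \<rightarrow> s \<leftarrow> y : g\<close>.  A map from the join of \<open>\<Delta>\<^sup>n\<close> with the cospan is a pair of
  \<open>(n+2)\<close>-simplices with last edges \<open>f\<close> and \<open>g\<close> that agree on the vertices \<open>0,\<dots>,n,n+2\<close>.\<close>

definition qc_slice_pair :: "'a sset \<Rightarrow> 'a \<Rightarrow> 'a \<Rightarrow> ('a \<times> 'a) sset" where
  "qc_slice_pair X u v =
     \<lparr>simp = \<lambda>n. {(s, t). s \<in> simp (qc_slice X u) n \<and> t \<in> simp (qc_slice X v) n \<and>
        qc_forget X n s = qc_forget X n t},
      act = \<lambda>m n \<alpha> (s, t). (act (qc_slice X u) m n \<alpha> s, act (qc_slice X v) m n \<alpha> t)\<rparr>"

definition qc_slice_cospan :: "'a sset \<Rightarrow> 'a \<Rightarrow> 'a \<Rightarrow> ('a \<times> 'a) sset" where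
  "qc_slice_cospan X f g =
     \<lparr>simp = \<lambda>n. {(s, t). s \<in> simp X (n + 2) \<and> t \<in> simp X (n + 2) \<and>
        act X 1 (n + 2) (\<lambda>r. n + 1 + r) s = f \<and> act X 1 (n + 2) (\<lambda>r. n + 1 + r) t = g \<and>
        face X (n + 2) (n + 1) s = face X (n + 2) (n + 1) t},
      act = \<lambda>m n \<alpha> (s, t). (act X (m + 2) (n + 2) (join_id m n \<alpha>) s,
                             act X (m + 2) (n + 2) (join_id m n \<alpha>) t)\<rparr>"

definition qc_finitely_complete :: "'a sset \<Rightarrow> bool" where
  "qc_finitely_complete X \<longleftrightarrow> (\<exists>t. qc_final X t) \<and>
     (\<forall>f\<in>simp X 1. \<forall>g\<in>simp X 1. vertex X 1 1 f = vertex X 1 1 g \<longrightarrow>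
        (\<exists>c. qc_final (qc_slice_cospan X f g) c))"

text \<open>\<open>u : U \<rightarrow> V\<close> is a monomorphism iff it is a \<open>(-1)\<close>-truncated object of the slice over \<open>V\<close>.\<close>

definition qc_mono :: "'a sset \<Rightarrow> 'a \<Rightarrow> 'a \<Rightarrow> 'a \<Rightarrow> bool" where
  "qc_mono X U V u \<longleftrightarrow> u \<in> simp (qc_Map X U V) 0 \<and>
     (\<forall>a\<in>simp (qc_slice X V) 0. empty_or_contractible (qc_Map (qc_slice X V) a u))"

definition qc_sub :: "'a sset \<Rightarrow> 'a \<Rightarrow> 'a set" where
  "qc_sub X t = {U \<in> simp X 0. \<exists>u. qc_mono X U t u}"

text \<open>\<open>T : D\<^bsub>/V\<^esub> \<rightarrow> D\<^bsub>/U\<^esub>\<close> is a functor \<open>- \<times> U\<close>: there is a natural transformation \<open>\<eta>\<close> from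
  \<open>X \<times> U\<close> to \<open>X\<close> whose component at every \<open>a = (X \<rightarrow> V)\<close>, together with the structure map
  \<open>T a : X \<times> U \<rightarrow> U\<close>, is a product cone.\<close>

definition qc_times_functor :: "'a sset \<Rightarrow> 'a \<Rightarrow> 'a \<Rightarrow> (nat \<Rightarrow> 'a \<Rightarrow> 'a) \<Rightarrow> bool" where
  "qc_times_functor D V U T \<longleftrightarrow> sset_map (qc_slice D V) (qc_slice D U) T \<and>
     (\<exists>\<eta>. sset_map (sset_prod (qc_slice D V) (std_simplex 1)) D \<eta> \<and>
        (\<forall>n. \<forall>s\<in>simp (qc_slice D V) n.
           \<eta> n (s, std_const 0 n) = qc_forget D n (T n s) \<and>
           \<eta> n (s, std_const 1 n) = qc_forget D n s) \<and>
        (\<forall>a\<in>simp (qc_slice D V) 0.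
           qc_final (qc_slice_pair D (qc_forget D 0 a) U)
             (\<eta> 1 (const_simp (qc_slice D V) 1 a, restrict id {..1}), T 0 a)))"

text \<open>A strictly functorial choice of the functors \<open>- \<times> U\<close>.  On \<open>C\<^sup>I\<close> and \<open>subset_filter\<close> it
  arises from a single functor \<open>- \<times> 0 : C\<^bsub>/1\<^esub> \<rightarrow> C\<^bsub>/0\<^esub>\<close> and identities.\<close>

definition qc_product_system ::
  "'a sset \<Rightarrow> 'a set \<Rightarrow> ('a \<Rightarrow> 'a \<Rightarrow> nat \<Rightarrow> 'a \<Rightarrow> 'a) \<Rightarrow> bool" where
  "qc_product_system D F T \<longleftrightarrow>
     (\<forall>V\<in>F. \<forall>n. \<forall>s\<in>simp (qc_slice D V) n. T V V n s = s) \<and>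
     (\<forall>V\<in>F. \<forall>U\<in>F. qc_le D U V \<longrightarrow> qc_times_functor D V U (T V U)) \<and>
     (\<forall>V\<in>F. \<forall>U\<in>F. \<forall>W\<in>F. qc_le D U V \<and> qc_le D W U \<longrightarrow>
        (\<forall>n. \<forall>s\<in>simp (qc_slice D V) n. T U W n (T V U n s) = T V W n s))"

definition qc_filter_quotient ::
  "'a sset \<Rightarrow> 'a set \<Rightarrow> ('a \<Rightarrow> 'a \<Rightarrow> nat \<Rightarrow> 'a \<Rightarrow> 'a) \<Rightarrow> ('a \<times> 'a) set sset" where
  "qc_filter_quotient D F T = sset_colim F (qc_le D) (qc_slice D) T"

text \<open>The canonical functor is \<open>D \<simeq> D\<^bsub>/1\<^esub> \<rightarrow> D\<^sub>F\<close>, where the inverse of the trivial fibration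
  \<open>D\<^bsub>/1\<^esub> \<rightarrow> D\<close> is represented by a section.\<close>

definition qc_section :: "'a sset \<Rightarrow> 'a \<Rightarrow> (nat \<Rightarrow> 'a \<Rightarrow> 'a) \<Rightarrow> bool" where
  "qc_section D one \<sigma> \<longleftrightarrow> sset_map D (qc_slice D one) \<sigma> \<and>
     (\<forall>n. \<forall>x\<in>simp D n. qc_forget D n (\<sigma> n x) = x)"

definition qc_quotient_functor ::
  "'a sset \<Rightarrow> 'a set \<Rightarrow> ('a \<Rightarrow> 'a \<Rightarrow> nat \<Rightarrow> 'a \<Rightarrow> 'a) \<Rightarrow> 'a \<Rightarrow> (nat \<Rightarrow> 'a \<Rightarrow> 'a) \<Rightarrow>
     nat \<Rightarrow> 'a \<Rightarrow> ('a \<times> 'a) set" where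
  "qc_quotient_functor D F T one \<sigma> n x =
     colim_class F (qc_le D) (qc_slice D) T one n (\<sigma> n x)"


section \<open>Complete Segal spaces\<close>

text \<open>\<open>bsimp W n k\<close> is the set of \<open>k\<close>-simplices of the space \<open>W\<^sub>n\<close>;
  \<open>bact W m n \<alpha> j k \<beta> : bsimp W n k \<rightarrow> bsimp W m j\<close> for \<open>\<alpha> : [m] \<rightarrow> [n]\<close>, \<open>\<beta> : [j] \<rightarrow> [k]\<close>.\<close>

record 'a bsset =
  bsimp :: "nat \<Rightarrow> nat \<Rightarrow> 'a set"
  bact :: "nat \<Rightarrow> nat \<Rightarrow> (nat \<Rightarrow> nat) \<Rightarrow> nat \<Rightarrow> nat \<Rightarrow> (nat \<Rightarrow> nat) \<Rightarrow> 'a \<Rightarrow> 'a"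

definition simplicial_space :: "'a bsset \<Rightarrow> bool" where
  "simplicial_space W \<longleftrightarrow>
     (\<forall>m n j k. \<forall>\<alpha>\<in>ord_maps m n. \<forall>\<beta>\<in>ord_maps j k. \<forall>x\<in>bsimp W n k.
        bact W m n \<alpha> j k \<beta> x \<in> bsimp W m j) \<and>
     (\<forall>m n j k. \<forall>\<alpha>\<in>ord_maps m n. \<forall>\<alpha>'\<in>ord_maps m n. \<forall>\<beta>\<in>ord_maps j k. \<forall>\<beta>'\<in>ord_maps j k.
        \<forall>x\<in>bsimp W n k. (\<forall>i\<le>m. \<alpha> i = \<alpha>' i) \<and> (\<forall>i\<le>j. \<beta> i = \<beta>' i) \<longrightarrow>
          bact W m n \<alpha> j k \<beta> x = bact W m n \<alpha>' j k \<beta>' x) \<and>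
     (\<forall>n k. \<forall>x\<in>bsimp W n k. bact W n n id k k id x = x) \<and>
     (\<forall>l m n i j k. \<forall>\<alpha>'\<in>ord_maps l m. \<forall>\<alpha>\<in>ord_maps m n. \<forall>\<beta>'\<in>ord_maps i j. \<forall>\<beta>\<in>ord_maps j k.
        \<forall>x\<in>bsimp W n k.
          bact W l m \<alpha>' i j \<beta>' (bact W m n \<alpha> j k \<beta> x) =
          bact W l n (\<alpha> \<circ> \<alpha>') i k (\<beta> \<circ> \<beta>') x)"

definition bsset_map :: "'a bsset \<Rightarrow> 'b bsset \<Rightarrow> (nat \<Rightarrow> nat \<Rightarrow> 'a \<Rightarrow> 'b) \<Rightarrow> bool" where
  "bsset_map X Y f \<longleftrightarrow>
     (\<forall>n k. \<forall>x\<in>bsimp X n k. f n k x \<in> bsimp Y n k) \<and>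
     (\<forall>m n j k. \<forall>\<alpha>\<in>ord_maps m n. \<forall>\<beta>\<in>ord_maps j k. \<forall>x\<in>bsimp X n k.
        f m j (bact X m n \<alpha> j k \<beta> x) = bact Y m n \<alpha> j k \<beta> (f n k x))"

definition space_at :: "'a bsset \<Rightarrow> nat \<Rightarrow> 'a sset" where
  "space_at W n = \<lparr>simp = bsimp W n, act = \<lambda>j k \<beta>. bact W n n id j k \<beta>\<rparr>"

definition hact :: "'a bsset \<Rightarrow> nat \<Rightarrow> nat \<Rightarrow> (nat \<Rightarrow> nat) \<Rightarrow> nat \<Rightarrow> 'a \<Rightarrow> 'a" where
  "hact W m n \<alpha> k = bact W m n \<alpha> k k id"

definition hface :: "'a bsset \<Rightarrow> nat \<Rightarrow> nat \<Rightarrow> nat \<Rightarrow> 'a \<Rightarrow> 'a" where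
  "hface W n i k = hact W (n - 1) n (coface i) k"

definition hvertex :: "'a bsset \<Rightarrow> nat \<Rightarrow> nat \<Rightarrow> nat \<Rightarrow> 'a \<Rightarrow> 'a" where
  "hvertex W n i k = hact W 0 n (\<lambda>_. i) k"

definition hdeg :: "'a bsset \<Rightarrow> nat \<Rightarrow> 'a \<Rightarrow> 'a" where
  "hdeg W k = hact W 1 0 (\<lambda>_. 0) k"

definition vconst :: "'a bsset \<Rightarrow> nat \<Rightarrow> nat \<Rightarrow> 'a \<Rightarrow> 'a" where
  "vconst W n k = const_simp (space_at W n) k"

text \<open>The matching object \<open>M\<^sub>n W\<close> of compatible families of faces.  It is a point for \<open>n = 0\<close>, and
  \<open>W\<^sub>0 \<times> W\<^sub>0\<close> for \<open>n = 1\<close>.\<close>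

definition matching_index :: "nat \<Rightarrow> nat set" where
  "matching_index n = (if n = 0 then {} else {..n})"

definition matching :: "'a bsset \<Rightarrow> nat \<Rightarrow> (nat \<Rightarrow> 'a) sset" where
  "matching W n =
     \<lparr>simp = \<lambda>k. {y \<in> PiE (matching_index n) (\<lambda>_. bsimp W (n - 1) k).
        2 \<le> n \<longrightarrow> (\<forall>i j. i < j \<and> j \<le> n \<longrightarrow>
          hface W (n - 1) i k (y j) = hface W (n - 1) (j - 1) k (y i))},
      act = \<lambda>j k \<beta> y. \<lambda>i\<in>matching_index n. act (space_at W (n - 1)) j k \<beta> (y i)\<rparr>"

definition reedy_fibrant :: "'a bsset \<Rightarrow> bool" where
  "reedy_fibrant W \<longleftrightarrow>
     (\<forall>n. kan_fibration (space_at W n) (matching W n)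
        (\<lambda>k w. \<lambda>i\<in>matching_index n. hface W n i k w))"

text \<open>The fibre product \<open>W\<^sub>1 \<times>\<^bsub>W\<^sub>0\<^esub> \<dots> \<times>\<^bsub>W\<^sub>0\<^esub> W\<^sub>1\<close> with \<open>n\<close> factors.\<close>

definition spine :: "'a bsset \<Rightarrow> nat \<Rightarrow> (nat \<Rightarrow> 'a) sset" where
  "spine W n =
     \<lparr>simp = \<lambda>k. {y \<in> PiE {..<n} (\<lambda>_. bsimp W 1 k).
        \<forall>i. i + 1 < n \<longrightarrow> hvertex W 1 1 k (y i) = hvertex W 1 0 k (y (i + 1))},
      act = \<lambda>j k \<beta> y. \<lambda>i\<in>{..<n}. act (space_at W 1) j k \<beta> (y i)\<rparr>"

definition segal :: "'a bsset \<Rightarrow> bool" where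
  "segal W \<longleftrightarrow>
     (\<forall>n\<ge>2. homotopy_equivalence (space_at W n) (spine W n)
        (\<lambda>k w. \<lambda>i\<in>{..<n}. hact W 1 n (\<lambda>r. i + r) k w))"

definition css_Map :: "'a bsset \<Rightarrow> 'a \<Rightarrow> 'a \<Rightarrow> 'a sset" where
  "css_Map W x y =
     \<lparr>simp = \<lambda>k. {w \<in> bsimp W 1 k.
        hvertex W 1 0 k w = vconst W 0 k x \<and> hvertex W 1 1 k w = vconst W 0 k y},
      act = act (space_at W 1)\<rparr>"

text \<open>\<open>f : x \<rightarrow> y\<close> has a left inverse and a right inverse up to homotopy.\<close>

definition css_equivalence :: "'a bsset \<Rightarrow> 'a \<Rightarrow> bool" where
  "css_equivalence W f \<longleftrightarrow> f \<in> bsimp W 1 0 \<and>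
     (\<exists>s\<in>bsimp W 2 0. hface W 2 2 0 s = f \<and>
        same_path_component (css_Map W (hvertex W 1 0 0 f) (hvertex W 1 0 0 f))
          (hface W 2 1 0 s) (hdeg W 0 (hvertex W 1 0 0 f))) \<and>
     (\<exists>s\<in>bsimp W 2 0. hface W 2 0 0 s = f \<and>
        same_path_component (css_Map W (hvertex W 1 1 0 f) (hvertex W 1 1 0 f))
          (hface W 2 1 0 s) (hdeg W 0 (hvertex W 1 1 0 f)))"

definition css_equivalences :: "'a bsset \<Rightarrow> 'a sset" where
  "css_equivalences W =
     \<lparr>simp = \<lambda>k. {w \<in> bsimp W 1 k. \<forall>i\<le>k. css_equivalence W (vertex (space_at W 1) k i w)},
      act = act (space_at W 1)\<rparr>"

definition complete_segal_space :: "'a bsset \<Rightarrow> bool" where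
  "complete_segal_space W \<longleftrightarrow> simplicial_space W \<and> reedy_fibrant W \<and> segal W \<and>
     homotopy_equivalence (space_at W 0) (css_equivalences W) (hdeg W)"

definition css_power :: "'i set \<Rightarrow> 'a bsset \<Rightarrow> ('i \<Rightarrow> 'a) bsset" where
  "css_power I W =
     \<lparr>bsimp = \<lambda>n k. PiE I (\<lambda>_. bsimp W n k),
      bact = \<lambda>m n \<alpha> j k \<beta> x. \<lambda>i\<in>I. bact W m n \<alpha> j k \<beta> (x i)\<rparr>"

text \<open>The slice \<open>W\<^bsub>/v\<^esub>\<close>, whose space of \<open>n\<close>-simplices is the fibre over \<open>v\<close> of the last vertex map
  \<open>W\<^bsub>n+1\<^esub> \<rightarrow> W\<^sub>0\<close>.\<close>

definition css_slice :: "'a bsset \<Rightarrow> 'a \<Rightarrow> 'a bsset" where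
  "css_slice W v =
     \<lparr>bsimp = \<lambda>n k. {w \<in> bsimp W (n + 1) k. hvertex W (n + 1) (n + 1) k w = vconst W 0 k v},
      bact = \<lambda>m n \<alpha>. bact W (m + 1) (n + 1) (join_id m n \<alpha>)\<rparr>"

definition css_forget :: "'a bsset \<Rightarrow> nat \<Rightarrow> nat \<Rightarrow> 'a \<Rightarrow> 'a" where
  "css_forget W n k = hface W (n + 1) (n + 1) k"

definition css_final :: "'a bsset \<Rightarrow> 'a \<Rightarrow> bool" where
  "css_final W t \<longleftrightarrow> t \<in> bsimp W 0 0 \<and> (\<forall>x\<in>bsimp W 0 0. contractible (css_Map W x t))"

definition css_initial :: "'a bsset \<Rightarrow> 'a \<Rightarrow> bool" where
  "css_initial W z \<longleftrightarrow> z \<in> bsimp W 0 0 \<and> (\<forall>y\<in>bsimp W 0 0. contractible (css_Map W z y))"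

definition css_le :: "'a bsset \<Rightarrow> 'a \<Rightarrow> 'a \<Rightarrow> bool" where
  "css_le W u v \<longleftrightarrow> simp (css_Map W u v) 0 \<noteq> {}"

definition css_strict_initial :: "'a bsset \<Rightarrow> 'a \<Rightarrow> bool" where
  "css_strict_initial W z \<longleftrightarrow> z \<in> bsimp W 0 0 \<and>
     (\<forall>x\<in>bsimp W 0 0. css_le W x z \<longrightarrow> css_initial W x)"

definition css_slice_pair :: "'a bsset \<Rightarrow> 'a \<Rightarrow> 'a \<Rightarrow> ('a \<times> 'a) bsset" where
  "css_slice_pair W u v =
     \<lparr>bsimp = \<lambda>n k. {(s, t). s \<in> bsimp (css_slice W u) n k \<and> t \<in> bsimp (css_slice W v) n k \<and>
        css_forget W n k s = css_forget W n k t},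
      bact = \<lambda>m n \<alpha> j k \<beta> (s, t).
        (bact (css_slice W u) m n \<alpha> j k \<beta> s, bact (css_slice W v) m n \<alpha> j k \<beta> t)\<rparr>"

definition css_slice_cospan :: "'a bsset \<Rightarrow> 'a \<Rightarrow> 'a \<Rightarrow> ('a \<times> 'a) bsset" where
  "css_slice_cospan W f g =
     \<lparr>bsimp = \<lambda>n k. {(s, t). s \<in> bsimp W (n + 2) k \<and> t \<in> bsimp W (n + 2) k \<and>
        hact W 1 (n + 2) (\<lambda>r. n + 1 + r) k s = vconst W 1 k f \<and>
        hact W 1 (n + 2) (\<lambda>r. n + 1 + r) k t = vconst W 1 k g \<and>
        hface W (n + 2) (n + 1) k s = hface W (n + 2) (n + 1) k t},
      bact = \<lambda>m n \<alpha> j k \<beta> (s, t).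
        (bact W (m + 2) (n + 2) (join_id m n \<alpha>) j k \<beta> s,
         bact W (m + 2) (n + 2) (join_id m n \<alpha>) j k \<beta> t)\<rparr>"

definition css_finitely_complete :: "'a bsset \<Rightarrow> bool" where
  "css_finitely_complete W \<longleftrightarrow> (\<exists>t. css_final W t) \<and>
     (\<forall>f\<in>bsimp W 1 0. \<forall>g\<in>bsimp W 1 0. hvertex W 1 1 0 f = hvertex W 1 1 0 g \<longrightarrow>
        (\<exists>c. css_final (css_slice_cospan W f g) c))"

definition css_mono :: "'a bsset \<Rightarrow> 'a \<Rightarrow> 'a \<Rightarrow> 'a \<Rightarrow> bool" where
  "css_mono W U V u \<longleftrightarrow> u \<in> simp (css_Map W U V) 0 \<and>
     (\<forall>a\<in>bsimp (css_slice W V) 0 0. empty_or_contractible (css_Map (css_slice W V) a u))"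

definition css_sub :: "'a bsset \<Rightarrow> 'a \<Rightarrow> 'a set" where
  "css_sub W t = {U \<in> bsimp W 0 0. \<exists>u. css_mono W U t u}"

definition css_prod_interval :: "'a bsset \<Rightarrow> ('a \<times> (nat \<Rightarrow> nat)) bsset" where
  "css_prod_interval W =
     \<lparr>bsimp = \<lambda>n k. bsimp W n k \<times> simp (std_simplex 1) n,
      bact = \<lambda>m n \<alpha> j k \<beta> p. (bact W m n \<alpha> j k \<beta> (fst p), act (std_simplex 1) m n \<alpha> (snd p))\<rparr>"

definition css_times_functor :: "'a bsset \<Rightarrow> 'a \<Rightarrow> 'a \<Rightarrow> (nat \<Rightarrow> nat \<Rightarrow> 'a \<Rightarrow> 'a) \<Rightarrow> bool" where
  "css_times_functor D V U T \<longleftrightarrow> bsset_map (css_slice D V) (css_slice D U) T \<and>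
     (\<exists>\<eta>. bsset_map (css_prod_interval (css_slice D V)) D \<eta> \<and>
        (\<forall>n k. \<forall>s\<in>bsimp (css_slice D V) n k.
           \<eta> n k (s, std_const 0 n) = css_forget D n k (T n k s) \<and>
           \<eta> n k (s, std_const 1 n) = css_forget D n k s) \<and>
        (\<forall>a\<in>bsimp (css_slice D V) 0 0.
           css_final (css_slice_pair D (css_forget D 0 0 a) U)
             (\<eta> 1 0 (hdeg (css_slice D V) 0 a, restrict id {..1}), T 0 0 a)))"

definition css_product_system ::
  "'a bsset \<Rightarrow> 'a set \<Rightarrow> ('a \<Rightarrow> 'a \<Rightarrow> nat \<Rightarrow> nat \<Rightarrow> 'a \<Rightarrow> 'a) \<Rightarrow> bool" where
  "css_product_system D F T \<longleftrightarrow>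
     (\<forall>V\<in>F. \<forall>n k. \<forall>s\<in>bsimp (css_slice D V) n k. T V V n k s = s) \<and>
     (\<forall>V\<in>F. \<forall>U\<in>F. css_le D U V \<longrightarrow> css_times_functor D V U (T V U)) \<and>
     (\<forall>V\<in>F. \<forall>U\<in>F. \<forall>W\<in>F. css_le D U V \<and> css_le D W U \<longrightarrow>
        (\<forall>n k. \<forall>s\<in>bsimp (css_slice D V) n k. T U W n k (T V U n k s) = T V W n k s))"

definition css_filter_quotient ::
  "'a bsset \<Rightarrow> 'a set \<Rightarrow> ('a \<Rightarrow> 'a \<Rightarrow> nat \<Rightarrow> nat \<Rightarrow> 'a \<Rightarrow> 'a) \<Rightarrow> ('a \<times> 'a) set bsset" where
  "css_filter_quotient D F T =
     \<lparr>bsimp = \<lambda>n k. Sigma F (\<lambda>V. bsimp (css_slice D V) n k) //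
         colim_rel F (css_le D) (\<lambda>V. bsimp (css_slice D V) n k) (\<lambda>V W. T V W n k),
      bact = \<lambda>m n \<alpha> j k \<beta> c.
         colim_rel F (css_le D) (\<lambda>V. bsimp (css_slice D V) m j) (\<lambda>V W. T V W m j) ``
           ((\<lambda>(V, x). (V, bact (css_slice D V) m n \<alpha> j k \<beta> x)) ` c)\<rparr>"

definition css_section :: "'a bsset \<Rightarrow> 'a \<Rightarrow> (nat \<Rightarrow> nat \<Rightarrow> 'a \<Rightarrow> 'a) \<Rightarrow> bool" where
  "css_section D one \<sigma> \<longleftrightarrow> bsset_map D (css_slice D one) \<sigma> \<and>
     (\<forall>n k. \<forall>x\<in>bsimp D n k. css_forget D n k (\<sigma> n k x) = x)"

definition css_quotient_functor ::
  "'a bsset \<Rightarrow> 'a set \<Rightarrow> ('a \<Rightarrow> 'a \<Rightarrow> nat \<Rightarrow> nat \<Rightarrow> 'a \<Rightarrow> 'a) \<Rightarrow> 'a \<Rightarrow>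
     (nat \<Rightarrow> nat \<Rightarrow> 'a \<Rightarrow> 'a) \<Rightarrow> nat \<Rightarrow> nat \<Rightarrow> 'a \<Rightarrow> ('a \<times> 'a) set" where
  "css_quotient_functor D F T one \<sigma> n k x =
     colim_rel F (css_le D) (\<lambda>V. bsimp (css_slice D V) n k) (\<lambda>V W. T V W n k) ``
       {(one, \<sigma> n k x)}"

end

theory Submission
  imports Defs
begin

text \<open>A zigzag of paths in a filtered colimit lives at one stage \<open>V = subset_object I zero one B\<close>
  with \<open>B \<in> \<Phi>\<close>, so the claim is that \<open>f \<times> V\<close> and \<open>g \<times> V\<close> are homotopic for some such \<open>V\<close>
  iff \<open>f i\<close> and \<open>g i\<close> are homotopic for all \<open>i\<close> in some \<open>B \<in> \<Phi>\<close>.  Over \<open>i \<in> B\<close> the projection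
  \<open>X i \<times> 1 \<rightarrow> X i\<close> has a section up to homotopy, by the universal property of the product; over
  \<open>i \<notin> B\<close> the object \<open>X i \<times> 0\<close> is initial, so that all maps out of it are homotopic.  For
  quasi-categories and complete Segal spaces the homotopy of maps over \<open>V\<close> comes for free: once the
  composites with the projection to \<open>Y\<close> are identified, \<open>f \<times> V\<close> and \<open>g \<times> V\<close> represent two maps
  from one cone to the product cone, which is final.  Both models only enter through the 2-simplices
  (of the zeroth row), which satisfy the same composition calculus.\<close>

section \<open>Triangles in simplicial sets\<close>

text \<open>\<open>I\<close> may be infinite, and this shapes the proof twice. Path components are
  defined by finite zigzags, and zigzags found separately at each index may have unbounded length,
  so they need not assemble to one zigzag in a product. Homotopies are therefore first reduced to a
  single witness: an edge of a Kan complex, or a triangle with degenerate first edge. Moreover, the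
  universal property of the product with \<open>V\<close> is available only in the power of
  \<open>C\<close>, so a test cone has to be given at every index, also outside the filter set;
  there the product cone itself completes it. For complete Segal spaces the difficulty is
  strictness: Segal maps are equivalences, while a triangle asks for equality of its faces. Reedy
  fibrancy turns the Segal map in degree 2 into a trivial fibration, so that composites exist
  strictly and are unique up to paths, and it lets triangles be moved along homotopies of their
  edges. This replaces the filling of inner horns.\<close>

lemma ord_maps_comp: "\<beta> \<in> ord_maps l m \<Longrightarrow> \<alpha> \<in> ord_maps m n \<Longrightarrow> \<alpha> \<circ> \<beta> \<in> ord_maps l n"
  by (simp add: ord_maps_def)

lemma coface_ord_maps: "coface i \<in> ord_maps n (Suc n)"
  by (auto simp: ord_maps_def coface_def)

lemma const_ord_maps: "i \<le> n \<Longrightarrow> (\<lambda>_. i) \<in> ord_maps m n"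
  by (auto simp: ord_maps_def)

lemma id_ord_maps: "id \<in> ord_maps n n"
  by (auto simp: ord_maps_def)

lemma join_id_ord_maps: "\<alpha> \<in> ord_maps m n \<Longrightarrow> join_id m n \<alpha> \<in> ord_maps (Suc m) (Suc n)"
  by (auto simp: ord_maps_def join_id_def intro: trans_le_add1)

lemma le_2_cases: "(i::nat) \<le> 2 \<longleftrightarrow> i = 0 \<or> i = 1 \<or> i = 2"
  by auto

lemma le_3_cases: "(i::nat) \<le> 3 \<longleftrightarrow> i = 0 \<or> i = 1 \<or> i = 2 \<or> i = 3"
  by auto

section \<open>The action of the simplex category and its identities\<close>

locale sset =
  fixes X :: "'a sset"
  assumes simplicial: "simplicial_set X"
begin

lemma act_in: "\<alpha> \<in> ord_maps m n \<Longrightarrow> x \<in> simp X n \<Longrightarrow> act X m n \<alpha> x \<in> simp X m"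
  using simplicial unfolding simplicial_set_def by blast

text \<open>Monotonicity and the bound only concern the values on \<open>{..m}\<close>, so
  \<open>\<beta>\<close> inherits them from \<open>\<alpha>\<close>.\<close>

lemma act_cong:
  assumes "\<alpha> \<in> ord_maps m n" "x \<in> simp X n" "\<And>i. i \<le> m \<Longrightarrow> \<alpha> i = \<beta> i"
  shows "act X m n \<alpha> x = act X m n \<beta> x"
proof -
  have "\<beta> \<in> ord_maps m n"
    using assms(1) assms(3)[symmetric] unfolding ord_maps_def by simp
  with assms simplicial show ?thesis
    unfolding simplicial_set_def by blast
qed

lemma act_id: "x \<in> simp X n \<Longrightarrow> act X n n id x = x"
  using simplicial unfolding simplicial_set_def by blast

lemma act_id_on:
  assumes "x \<in> simp X n" "\<And>i. i \<le> n \<Longrightarrow> \<alpha> i = i"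
  shows "act X n n \<alpha> x = x"
  using act_cong[OF id_ord_maps assms(1), of \<alpha>] assms act_id by simp

lemma act_act:
  "\<beta> \<in> ord_maps l m \<Longrightarrow> \<alpha> \<in> ord_maps m n \<Longrightarrow> x \<in> simp X n \<Longrightarrow>
    act X l m \<beta> (act X m n \<alpha> x) = act X l n (\<alpha> \<circ> \<beta>) x"
  using simplicial unfolding simplicial_set_def by blast

lemma act_act_cong:
  assumes "\<beta> \<in> ord_maps l m" "\<alpha> \<in> ord_maps m n" "x \<in> simp X n" "\<And>i. i \<le> l \<Longrightarrow> \<alpha> (\<beta> i) = \<gamma> i"
  shows "act X l m \<beta> (act X m n \<alpha> x) = act X l n \<gamma> x"
  using assms by (simp add: act_act) (rule act_cong[OF ord_maps_comp], auto)

lemma act_act_eq: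
  assumes "\<beta> \<in> ord_maps l m" "\<alpha> \<in> ord_maps m n" "\<beta>' \<in> ord_maps l m'" "\<alpha>' \<in> ord_maps m' n"
    "x \<in> simp X n" "\<And>i. i \<le> l \<Longrightarrow> \<alpha> (\<beta> i) = \<alpha>' (\<beta>' i)"
  shows "act X l m \<beta> (act X m n \<alpha> x) = act X l m' \<beta>' (act X m' n \<alpha>' x)"
  using assms act_act_cong[of \<beta> l m \<alpha> n x "\<alpha>' \<circ> \<beta>'"] by (simp add: act_act)

lemma face_in: "x \<in> simp X (Suc n) \<Longrightarrow> face X (Suc n) i x \<in> simp X n"
  by (simp add: face_def act_in coface_ord_maps)

lemma vertex_in: "x \<in> simp X n \<Longrightarrow> i \<le> n \<Longrightarrow> vertex X n i x \<in> simp X 0"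
  by (simp add: vertex_def act_in const_ord_maps)

lemma const_simp_in: "x \<in> simp X 0 \<Longrightarrow> const_simp X n x \<in> simp X n"
  by (simp add: const_simp_def act_in const_ord_maps)

lemma const_simp_0: "x \<in> simp X 0 \<Longrightarrow> const_simp X 0 x = x"
  by (simp add: const_simp_def act_id_on)

lemma act_const_simp:
  "\<alpha> \<in> ord_maps m n \<Longrightarrow> x \<in> simp X 0 \<Longrightarrow> act X m n \<alpha> (const_simp X n x) = const_simp X m x"
  unfolding const_simp_def by (rule act_act_cong) (auto simp: const_ord_maps)

lemma face_face:
  assumes "x \<in> simp X (Suc (Suc n))" "i < j"
  shows "face X (Suc n) i (face X (Suc (Suc n)) j x) = face X (Suc n) (j - 1) (face X (Suc (Suc n)) i x)"
  unfolding face_def diff_Suc_1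
  by (rule act_act_eq) (use assms in \<open>auto simp: coface_ord_maps coface_def\<close>)

lemma face_1: "x \<in> simp X 1 \<Longrightarrow> face X 1 0 x = vertex X 1 1 x" "x \<in> simp X 1 \<Longrightarrow> face X 1 1 x = vertex X 1 0 x"
  using coface_ord_maps[of _ 0]
  by (auto simp: face_def vertex_def coface_def intro!: act_cong)

lemma vertex_const: "x \<in> simp X 0 \<Longrightarrow> i \<le> n \<Longrightarrow> vertex X n i (const_simp X n x) = x"
  unfolding vertex_def by (simp add: act_const_simp const_ord_maps const_simp_0)

end

text \<open>The edges are listed in the order first factor, second factor, composite, that is, 01,
  12, 02. Composition is a relation because a filler, and with it the composite, is not
  unique.\<close>

definition tri :: "'a sset \<Rightarrow> 'a \<Rightarrow> 'a \<Rightarrow> 'a \<Rightarrow> bool" where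
  "tri X a b c \<longleftrightarrow> (\<exists>w\<in>simp X 2. face X 2 2 w = a \<and> face X 2 0 w = b \<and> face X 2 1 w = c)"

definition edges :: "'a sset \<Rightarrow> 'a \<Rightarrow> 'a \<Rightarrow> 'a set" where
  "edges X x y = {e \<in> simp X 1. vertex X 1 0 e = x \<and> vertex X 1 1 e = y}"

context sset
begin

lemma face_2_in: "w \<in> simp X 2 \<Longrightarrow> face X 2 i w \<in> simp X 1"
  using face_in[of w 1] by (simp add: numeral_2_eq_2)

lemma face_3_in: "w \<in> simp X 3 \<Longrightarrow> face X 3 i w \<in> simp X 2"
  using face_in[of w 2] by (simp add: numeral_2_eq_2 numeral_3_eq_3)

lemma vertex_face_2:
  assumes "w \<in> simp X 2" "i \<le> 1"
  shows "vertex X 1 i (face X 2 j w) = vertex X 2 (coface j i) w"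
  unfolding vertex_def face_def
  by (simp, rule act_act_cong) (use assms coface_ord_maps[of j 1] in \<open>auto simp: const_ord_maps numeral_2_eq_2\<close>)

lemma triE:
  assumes "tri X a b c"
  obtains w x y z where "w \<in> simp X 2" "face X 2 2 w = a" "face X 2 0 w = b" "face X 2 1 w = c"
    "x = vertex X 2 0 w" "y = vertex X 2 1 w" "z = vertex X 2 2 w"
    "a \<in> edges X x y" "b \<in> edges X y z" "c \<in> edges X x z"
proof -
  obtain w where w: "w \<in> simp X 2" "face X 2 2 w = a" "face X 2 0 w = b" "face X 2 1 w = c"
    using assms by (auto simp: tri_def)
  have "a \<in> edges X (vertex X 2 0 w) (vertex X 2 1 w)" "b \<in> edges X (vertex X 2 1 w) (vertex X 2 2 w)"
    "c \<in> edges X (vertex X 2 0 w) (vertex X 2 2 w)"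
    using w vertex_face_2[OF w(1)] face_2_in[OF w(1)] by (auto simp: edges_def coface_def numeral_2_eq_2)
  with w that show thesis by blast
qed

lemma tri_deg_left:
  assumes "f \<in> edges X x y" shows "tri X (const_simp X 1 x) f f"
proof -
  \<comment> \<open>The degeneracy repeating vertex 0: truncated subtraction sends 0, 1, 2 to 0, 0,
    1.\<close>
  let ?d = "\<lambda>k::nat. k - 1"
  have d: "?d \<in> ord_maps 2 1" by (auto simp: ord_maps_def)
  have f: "f \<in> simp X 1" "vertex X 1 0 f = x" using assms by (auto simp: edges_def)
  have c: "coface i \<in> ord_maps 1 2" for i using coface_ord_maps[of i 1] by (simp add: numeral_2_eq_2)
  have "face X 2 2 (act X 2 1 ?d f) = const_simp X 1 x"
    unfolding f(2)[symmetric] face_def vertex_def const_simp_def diff_Suc_1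
    by (simp, rule act_act_eq) (use c d f in \<open>auto simp: const_ord_maps coface_def\<close>)
  moreover have "face X 2 i (act X 2 1 ?d f) = f" if "i = 0 \<or> i = 1" for i
  proof -
    have "act X 1 2 (coface i) (act X 2 1 ?d f) = act X 1 1 id f"
      by (rule act_act_cong[OF c d f(1)]) (use that in \<open>auto simp: le_Suc_eq coface_def\<close>)
    then show ?thesis by (simp add: face_def act_id[OF f(1), simplified])
  qed
  ultimately show ?thesis using act_in[OF d f(1)] by (auto simp: tri_def)
qed

lemma tri_deg_right:
  assumes "f \<in> edges X x y" shows "tri X f (const_simp X 1 y) f"
proof -
  \<comment> \<open>The degeneracy repeating vertex 1: it sends 0, 1, 2 to 0, 1, 1.\<close>
  let ?d = "\<lambda>k::nat. min k 1"
  have d: "?d \<in> ord_maps 2 1" by (auto simp: ord_maps_def)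
  have f: "f \<in> simp X 1" "vertex X 1 1 f = y" using assms by (auto simp: edges_def)
  have c: "coface i \<in> ord_maps 1 2" for i using coface_ord_maps[of i 1] by (simp add: numeral_2_eq_2)
  have "face X 2 0 (act X 2 1 ?d f) = const_simp X 1 y"
    unfolding f(2)[symmetric] face_def vertex_def const_simp_def diff_Suc_1
    by (simp, rule act_act_eq) (use c d f in \<open>auto simp: const_ord_maps coface_def\<close>)
  moreover have "face X 2 i (act X 2 1 ?d f) = f" if "i = 2 \<or> i = 1" for i
  proof -
    have "act X 1 2 (coface i) (act X 2 1 ?d f) = act X 1 1 id f"
      by (rule act_act_cong[OF c d f(1)]) (use that in \<open>auto simp: le_Suc_eq coface_def\<close>)
    then show ?thesis by (simp add: face_def act_id[OF f(1), simplified])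
  qed
  ultimately show ?thesis using act_in[OF d f(1)] by (auto simp: tri_def)
qed

lemma const_simp_edge: "x \<in> simp X 0 \<Longrightarrow> const_simp X 1 x \<in> edges X x x"
  by (simp add: edges_def const_simp_in vertex_const)

lemma edges_vertices: "f \<in> edges X x y \<Longrightarrow> x \<in> simp X 0 \<and> y \<in> simp X 0"
  using vertex_in[of f 1] by (auto simp: edges_def)

end

text \<open>The part of composition in a quasi-category that is visible in its simplices of dimension at
  most three.  It also holds for the zeroth row of a complete Segal space.  The edges of a 3-simplex
  are \<open>a = 01\<close>, \<open>b = 12\<close>, \<open>c = 23\<close>, \<open>e = 02\<close>, \<open>f = 13\<close>, \<open>g = 03\<close>.\<close>

locale tri_calculus = sset +
  assumes tri_ex: "a \<in> edges X x y \<Longrightarrow> b \<in> edges X y z \<Longrightarrow> \<exists>c. tri X a b c"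
    and tri_inner1: "tri X a b e \<Longrightarrow> tri X b c f \<Longrightarrow> tri X a f g \<Longrightarrow> tri X e c g"
    and tri_inner2: "tri X a b e \<Longrightarrow> tri X b c f \<Longrightarrow> tri X e c g \<Longrightarrow> tri X a f g"
begin

text \<open>Homotopy of parallel edges by a triangle whose first edge is degenerate. The degenerate
  edge stands on the left, and \<open>g\<close> before \<open>f\<close>, because such triangles are
  the edges from \<open>f\<close> to \<open>g\<close> of the right mapping space
  \<open>qc_Map\<close>.\<close>

definition eqv :: "'a \<Rightarrow> 'a \<Rightarrow> bool" where
  "eqv f g \<longleftrightarrow> tri X (const_simp X 1 (vertex X 1 0 f)) g f"

lemma eqv_edges:
  assumes "eqv f g" obtains x y where "f \<in> edges X x y" "g \<in> edges X x y" "tri X (const_simp X 1 x) g f"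
proof -
  have t: "tri X (const_simp X 1 (vertex X 1 0 f)) g f"
    using assms by (simp add: eqv_def)
  from t show thesis
  proof (rule triE)
    fix w x y z
    assume *: "const_simp X 1 (vertex X 1 0 f) \<in> edges X x y" "g \<in> edges X y z" "f \<in> edges X x z"
    then have "vertex X 1 0 f = x" by (auto simp: edges_def)
    then have "x = y"
      using *(1) vertex_const[of x 1 1] edges_vertices[OF *(1)] by (auto simp: edges_def)
    then show thesis using that * t \<open>vertex X 1 0 f = x\<close> by blast
  qed
qed

lemma eqvI: "f \<in> edges X x y \<Longrightarrow> tri X (const_simp X 1 x) g f \<Longrightarrow> eqv f g"
  by (simp add: eqv_def edges_def)

lemma eqv_refl: "f \<in> edges X x y \<Longrightarrow> eqv f f"
  using eqvI[OF _ tri_deg_left] .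

text \<open>In a 3-simplex on the vertices x, x, x, y all edges among the first three are
  degenerate; the missing inner face is the reversed homotopy.\<close>

lemma eqv_sym:
  assumes "eqv f g" shows "eqv g f"
  using assms
proof (rule eqv_edges)
  fix x y assume f: "f \<in> edges X x y" "g \<in> edges X x y" "tri X (const_simp X 1 x) g f"
  have "tri X (const_simp X 1 x) (const_simp X 1 x) (const_simp X 1 x)"
    by (rule tri_deg_left[OF const_simp_edge[OF conjunct1[OF edges_vertices[OF f(1)]]]])
  from tri_inner2[OF this f(3) tri_deg_left[OF f(2)]] show ?thesis
    by (rule eqvI[OF f(2)])
qed

text \<open>Prepending a degenerate edge to \<open>a\<close> gives an inner horn whose missing face
  compares the two composites.\<close>

lemma tri_unique:
  assumes "tri X a b c" "tri X a b c'" shows "eqv c c'"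
  using assms(1)
proof (rule triE)
  fix x y z assume "a \<in> edges X x y" "c \<in> edges X x z"
  then show ?thesis
    by (intro eqvI tri_inner2[OF tri_deg_left assms(2,1)])
qed

lemma tri_cong_right:
  assumes "tri X a b c" "eqv c c'" shows "tri X a b c'"
  using assms(1)
proof (rule triE)
  fix x y z assume a: "a \<in> edges X x y" "c \<in> edges X x z"
  from eqv_sym[OF assms(2)] show ?thesis
  proof (rule eqv_edges)
    fix x' y' assume "c \<in> edges X x' y'" and t: "tri X (const_simp X 1 x') c c'"
    then have "x' = x" using a by (simp add: edges_def)
    with t show ?thesis using tri_inner1[OF tri_deg_left[OF a(1)] assms(1)] by simp
  qed
qed

lemma tri_cong_middle:
  assumes "tri X a b c" "eqv b b'" shows "tri X a b' c"
  using assms(1)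
proof (rule triE)
  fix x y z assume a: "a \<in> edges X x y" "b \<in> edges X y z"
  from assms(2) show ?thesis
  proof (rule eqv_edges)
    fix x' y' assume "b \<in> edges X x' y'" and t: "tri X (const_simp X 1 x') b' b"
    then have "x' = y" using a by (simp add: edges_def)
    with t show ?thesis using tri_inner1[OF tri_deg_right[OF a(1)] _ assms(1)] by simp
  qed
qed

lemma eqv_trans:
  assumes "eqv f g" "eqv g h" shows "eqv f h"
  using assms(1)
proof (rule eqv_edges)
  fix x y assume "f \<in> edges X x y" "tri X (const_simp X 1 x) g f"
  then show ?thesis using tri_cong_middle[OF _ assms(2)] eqvI by blast
qed

text \<open>In the 3-simplex that prepends the homotopy to \<open>b\<close>, the triangle wanted
  would be an outer face. Hence an auxiliary composite \<open>c'\<close> of \<open>a'\<close> and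
  \<open>b\<close> is formed first, and an inner face compares it with \<open>c\<close>.\<close>

lemma tri_cong_left:
  assumes "tri X a b c" "eqv a a'" shows "tri X a' b c"
  using assms(1)
proof (rule triE)
  fix x y z assume a: "a \<in> edges X x y" "b \<in> edges X y z" "c \<in> edges X x z"
  from assms(2) show ?thesis
  proof (rule eqv_edges)
    fix x' y' assume *: "a \<in> edges X x' y'" "a' \<in> edges X x' y'" "tri X (const_simp X 1 x') a' a"
    then have x: "x' = x" "y' = y" using a by (simp_all add: edges_def)
    then obtain c' where c': "tri X a' b c'" using tri_ex *(2) a(2) by blast
    have "eqv c c'"
      using tri_inner2[OF *(3) c' assms(1)] x a(3) eqvI by simp
    then show ?thesis by (rule tri_cong_right[OF c' eqv_sym])
  qed
qed

text \<open>The morphism \<open>p\<close> is a projection \<open>X \<times> V \<rightarrow> X\<close> with section \<open>s\<close>, and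
  \<open>m\<close>, \<open>n\<close> are composites \<open>X \<times> V \<rightarrow> Y\<close>.\<close>

lemma eqv_descend:
  assumes "tri X f' q m" "tri X g' q n" "eqv f' g'" "tri X p f m" "tri X p g n"
    and "tri X s p (const_simp X 1 x)" "f \<in> edges X x y" "g \<in> edges X x y"
  shows "eqv f g"
proof -
  have e: "eqv m n" by (rule tri_unique[OF tri_cong_left[OF assms(1,3)] assms(2)])
  \<comment> \<open>Associativity for \<open>s\<close>, \<open>p\<close> and \<open>f\<close>, where
    \<open>s\<close> followed by \<open>p\<close> is degenerate: the section recovers
    \<open>f\<close> from \<open>m\<close>, and likewise \<open>g\<close> from
    \<open>n\<close>.\<close>
  have "tri X s m f" "tri X s n g"
    using tri_inner2[OF assms(6,4) tri_deg_left[OF assms(7)]] tri_inner2[OF assms(6,5) tri_deg_left[OF assms(8)]] .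
  then show ?thesis using tri_unique[OF tri_cong_middle[OF _ e]] by simp
qed

end

section \<open>Three-dimensional horns as statements about triangles\<close>

lemma horn3:
  assumes "sset X" and fill: "\<And>y. horn X 3 k y \<Longrightarrow> \<exists>x\<in>simp X 3. \<forall>i\<le>3. i \<noteq> k \<longrightarrow> face X 3 i x = y i"
    and y: "\<And>i. i \<le> 3 \<Longrightarrow> i \<noteq> k \<Longrightarrow> y i \<in> simp X 2"
    and c: "\<And>i j. i < j \<Longrightarrow> j \<le> 3 \<Longrightarrow> i \<noteq> k \<Longrightarrow> j \<noteq> k \<Longrightarrow> face X 2 i (y j) = face X 2 (j - 1) (y i)"
  obtains w where "w \<in> simp X 2" "\<And>j. j \<le> 3 \<Longrightarrow> k < j \<Longrightarrow> face X 2 k (y j) = face X 2 (j - 1) w"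
    "\<And>i. i < k \<Longrightarrow> k \<le> 3 \<Longrightarrow> face X 2 i w = face X 2 (k - 1) (y i)"
proof -
  interpret sset X by fact
  have "horn X 3 k y" using y c by (auto simp: horn_def numeral_2_eq_2 numeral_3_eq_3)
  then obtain x where x: "x \<in> simp X 3" "\<And>i. i \<le> 3 \<Longrightarrow> i \<noteq> k \<Longrightarrow> face X 3 i x = y i"
    using fill by blast
  have ff: "face X 2 i (face X 3 j x) = face X 2 (j - 1) (face X 3 i x)" if "i < j" for i j
    using face_face[of x 1 i j] x that by (simp add: numeral_2_eq_2 numeral_3_eq_3)
  show thesis
  proof (rule that)
    show "face X 3 k x \<in> simp X 2" by (rule face_3_in[OF x(1)])
  qed (use x(2) ff in \<open>metis less_irrefl\<close>, use x(2) ff less_le_trans less_imp_le in \<open>metis less_irrefl\<close>)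
qed

text \<open>The four triangles are the faces 3, 0, 2, 1 of a 3-simplex, each assumed unless it is
  the face \<open>k\<close> missing from the horn, so that inner and outer horns are treated at
  once.\<close>

lemma tri_horn:
  assumes "sset X" and fill: "\<And>y. horn X 3 k y \<Longrightarrow> \<exists>x\<in>simp X 3. \<forall>i\<le>3. i \<noteq> k \<longrightarrow> face X 3 i x = y i"
    and k: "k \<le> 3"
    and t: "k \<noteq> 3 \<Longrightarrow> tri X a b e" "k \<noteq> 0 \<Longrightarrow> tri X b c f" "k \<noteq> 2 \<Longrightarrow> tri X a f g" "k \<noteq> 1 \<Longrightarrow> tri X e c g"
  shows "tri X a b e \<and> tri X b c f \<and> tri X a f g \<and> tri X e c g"
proof -
  \<comment> \<open>The edges 01, 12 and 02 of the face \<open>j\<close> are \<open>?a j\<close>,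
    \<open>?b j\<close> and \<open>?c j\<close>.\<close>
  let ?a = "\<lambda>j::nat. if j = 0 then b else if j = 1 then e else a"
  let ?b = "\<lambda>j::nat. if j = 3 then b else if j = 2 then f else c"
  let ?c = "\<lambda>j::nat. if j = 0 then f else if j = 3 then e else g"
  have "\<forall>j. \<exists>w. j \<le> 3 \<and> j \<noteq> k \<longrightarrow>
      w \<in> simp X 2 \<and> face X 2 2 w = ?a j \<and> face X 2 0 w = ?b j \<and> face X 2 1 w = ?c j"
    using t unfolding tri_def le_3_cases by auto
  from choice[OF this] obtain y where y: "\<And>j. j \<le> 3 \<Longrightarrow> j \<noteq> k \<Longrightarrow>
      y j \<in> simp X 2 \<and> face X 2 2 (y j) = ?a j \<and> face X 2 0 (y j) = ?b j \<and> face X 2 1 (y j) = ?c j"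
    by blast
  obtain z where z: "z \<in> simp X 2" "\<And>j. j \<le> 3 \<Longrightarrow> k < j \<Longrightarrow> face X 2 k (y j) = face X 2 (j - 1) z"
    "\<And>i. i < k \<Longrightarrow> k \<le> 3 \<Longrightarrow> face X 2 i z = face X 2 (k - 1) (y i)"
  proof (rule horn3[OF assms(1) fill, of y])
    fix i j assume *: "i < j" "j \<le> 3" "i \<noteq> k" "j \<noteq> k"
    then have "(i, j) \<in> {(0, 1), (0, 2), (0, 3), (1, 2), (1, 3), (2, 3)}" by auto
    then show "face X 2 i (y j) = face X 2 (j - 1) (y i)"
      using y[of i] y[of j] * by auto
  qed (use y in auto)
  have "face X 2 2 z = ?a k" "face X 2 0 z = ?b k" "face X 2 1 z = ?c k"
    using k z(2)[of 1] z(2)[of 2] z(2)[of 3] z(3)[of 0] z(3)[of 1] z(3)[of 2] y[of 0] y[of 1] y[of 2] y[of 3]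
    unfolding le_3_cases by auto
  then have "tri X (?a k) (?b k) (?c k)" using z(1) by (auto simp: tri_def)
  then show ?thesis using k t unfolding le_3_cases by auto
qed

lemma quasi_category_tri_calculus:
  assumes "quasi_category X" shows "tri_calculus X"
proof -
  interpret sset X by unfold_locales (use assms in \<open>simp add: quasi_category_def\<close>)
  have fill: "\<exists>x\<in>simp X n. \<forall>i\<le>n. i \<noteq> k \<longrightarrow> face X n i x = y i" if "0 < k" "k < n" "horn X n k y" for n k y
    using assms that by (auto simp: quasi_category_def)
  show ?thesis
  proof
    fix a b x y z assume ab: "a \<in> edges X x y" "b \<in> edges X y z"
    let ?y = "\<lambda>i::nat. if i = 0 then b else a"
    have "horn X 2 1 ?y"
      using ab face_1 by (auto simp: horn_def edges_def le_2_cases)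
    then obtain w where "w \<in> simp X 2" "\<And>i. i \<le> 2 \<Longrightarrow> i \<noteq> 1 \<Longrightarrow> face X 2 i w = ?y i"
      using fill[of 1 2 ?y] by auto
    then show "\<exists>c. tri X a b c" by (fastforce simp: tri_def)
  next
    show "tri X e c g" if "tri X a b e" "tri X b c f" "tri X a f g" for a b c e f g
      using tri_horn[OF sset_axioms fill, of 1 a b e c f g] that by simp
    show "tri X a f g" if "tri X a b e" "tri X b c f" "tri X e c g" for a b c e f g
      using tri_horn[OF sset_axioms fill, of 2 a b e c f g] that by simp
  qed
qed

text \<open>Mapping spaces, slices over a pair and spines are cut out of known simplicial sets by
  equations; only the stability of these equations under the action remains to be checked.\<close>

lemma sub_sset:
  assumes "sset Y" and simp: "\<And>n. simp X n \<subseteq> simp Y n" and act: "act X = act Y"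
    and closed: "\<And>m n \<alpha> x. \<alpha> \<in> ord_maps m n \<Longrightarrow> x \<in> simp X n \<Longrightarrow> act Y m n \<alpha> x \<in> simp X m"
  shows "sset X"
proof
  interpret Y: sset Y by fact
  show "simplicial_set X"
    unfolding simplicial_set_def act using simp
    by (intro conjI allI ballI impI closed Y.act_cong Y.act_id Y.act_act) blast+
qed

lemma kan_complex_sset: "kan_complex X \<Longrightarrow> sset X"
  by (simp add: kan_complex_def sset_def)

lemma kan_fill:
  "kan_complex X \<Longrightarrow> 1 \<le> n \<Longrightarrow> k \<le> n \<Longrightarrow> horn X n k y \<Longrightarrow>
    \<exists>x\<in>simp X n. \<forall>i\<le>n. i \<noteq> k \<longrightarrow> face X n i x = y i"
  unfolding kan_complex_def by blast

lemma kan_complex_quasi_category: "kan_complex X \<Longrightarrow> quasi_category X"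
  unfolding kan_complex_def quasi_category_def by simp

text \<open>Outer horns allow first and last factors to be cancelled, as in a groupoid.\<close>

lemma kan_tri_outer:
  assumes "kan_complex X"
  shows "tri X a b e \<Longrightarrow> tri X a f g \<Longrightarrow> tri X e c g \<Longrightarrow> tri X b c f"
    and "tri X b c f \<Longrightarrow> tri X a f g \<Longrightarrow> tri X e c g \<Longrightarrow> tri X a b e"
  using tri_horn[OF kan_complex_sset[OF assms] kan_fill[OF assms], of 0 a b e c f g]
    tri_horn[OF kan_complex_sset[OF assms] kan_fill[OF assms], of 3 a b e c f g] by simp_all

lemma kan_tri_divide:
  assumes "kan_complex X" "a \<in> edges X x y" "c \<in> edges X x z"
  shows "\<exists>b. tri X a b c"
proof -
  interpret sset X using assms(1) by (rule kan_complex_sset)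
  let ?y = "\<lambda>i::nat. if i = 1 then c else a"
  have "horn X 2 0 ?y"
    using assms face_1 by (auto simp: horn_def edges_def le_2_cases)
  then have "\<exists>w\<in>simp X 2. \<forall>i\<le>2. i \<noteq> 0 \<longrightarrow> face X 2 i w = ?y i"
    by (intro kan_fill assms) simp_all
  then show ?thesis by (fastforce simp: tri_def)
qed

section \<open>Path components\<close>

definition path_edges :: "'a sset \<Rightarrow> ('a \<times> 'a) set" where
  "path_edges X = (\<lambda>e. (vertex X 1 0 e, vertex X 1 1 e)) ` simp X 1"

lemma same_path_component_iff:
  "same_path_component X x y \<longleftrightarrow>
     x \<in> simp X 0 \<and> y \<in> simp X 0 \<and> (x, y) \<in> (path_edges X \<union> (path_edges X)\<inverse>)\<^sup>*"
proof -
  have "path_edges X \<union> (path_edges X)\<inverse> =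
    {(vertex X 1 0 e, vertex X 1 1 e) | e. e \<in> simp X 1} \<union>
    {(vertex X 1 1 e, vertex X 1 0 e) | e. e \<in> simp X 1}"
    by (auto simp: path_edges_def)
  then show ?thesis by (simp add: same_path_component_def)
qed

lemma same_path_component_refl: "x \<in> simp X 0 \<Longrightarrow> same_path_component X x x"
  by (simp add: same_path_component_def)

lemma same_path_component_trans:
  "same_path_component X x y \<Longrightarrow> same_path_component X y z \<Longrightarrow> same_path_component X x z"
  unfolding same_path_component_iff by (meson rtrancl_trans)

lemma same_path_component_sym: "same_path_component X x y \<Longrightarrow> same_path_component X y x"
proof -
  have "sym ((path_edges X \<union> (path_edges X)\<inverse>)\<^sup>*)"
    by (rule sym_rtrancl) (auto simp: sym_def)
  then show "same_path_component X x y \<Longrightarrow> same_path_component X y x"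
    unfolding same_path_component_iff by (meson symD)
qed

lemma same_path_component_edge:
  assumes "sset X" "e \<in> edges X x y" shows "same_path_component X x y"
proof -
  have "(x, y) \<in> path_edges X" using assms(2) by (force simp: path_edges_def edges_def)
  then show ?thesis
    using sset.edges_vertices[OF assms] by (auto simp: same_path_component_iff)
qed

lemma zigzag_image:
  assumes "(x, y) \<in> (R \<union> R\<inverse>)\<^sup>*" "\<And>a b. (a, b) \<in> R \<Longrightarrow> (h a, h b) \<in> R'"
  shows "(h x, h y) \<in> (R' \<union> R'\<inverse>)\<^sup>*"
  using assms(1)
proof induction
  case (step y z)
  then have "(h y, h z) \<in> R' \<union> R'\<inverse>" using assms(2) by auto
  with step.IH show ?case by (rule rtrancl_into_rtrancl)
qed simp

lemma same_path_component_induct: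
  assumes "same_path_component X x y"
    and "\<And>x y e. e \<in> edges X x y \<Longrightarrow> R x y"
    and refl: "\<And>x. x \<in> simp X 0 \<Longrightarrow> R x x"
    and sym: "\<And>x y. R x y \<Longrightarrow> R y x"
    and trans: "\<And>x y z. R x y \<Longrightarrow> R y z \<Longrightarrow> R x z"
  shows "R x y"
proof -
  have R: "R a b" if "(a, b) \<in> path_edges X \<union> (path_edges X)\<inverse>" for a b
    using that assms(2) sym by (fastforce simp: path_edges_def edges_def)
  have "(x, y) \<in> (path_edges X \<union> (path_edges X)\<inverse>)\<^sup>*" "x \<in> simp X 0"
    using assms(1) by (auto simp: same_path_component_iff)
  then show ?thesis
    by induction (blast intro: refl, blast intro: trans R)
qed

lemma sset_map_in: "sset_map X Y f \<Longrightarrow> x \<in> simp X n \<Longrightarrow> f n x \<in> simp Y n"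
  by (simp add: sset_map_def)

lemma sset_map_act:
  "sset_map X Y f \<Longrightarrow> \<alpha> \<in> ord_maps m n \<Longrightarrow> x \<in> simp X n \<Longrightarrow> f m (act X m n \<alpha> x) = act Y m n \<alpha> (f n x)"
  unfolding sset_map_def by blast

lemma sset_map_face: "sset_map X Y f \<Longrightarrow> x \<in> simp X (Suc n) \<Longrightarrow> f n (face X (Suc n) i x) = face Y (Suc n) i (f (Suc n) x)"
  by (simp add: face_def sset_map_act coface_ord_maps)

lemma sset_map_vertex: "sset_map X Y f \<Longrightarrow> x \<in> simp X n \<Longrightarrow> i \<le> n \<Longrightarrow> f 0 (vertex X n i x) = vertex Y n i (f n x)"
  by (simp add: vertex_def sset_map_act const_ord_maps)

lemma sset_map_const: "sset_map X Y f \<Longrightarrow> x \<in> simp X 0 \<Longrightarrow> f n (const_simp X n x) = const_simp Y n (f 0 x)"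
  by (simp add: const_simp_def sset_map_act const_ord_maps)

lemma sset_map_edges: "sset_map X Y f \<Longrightarrow> e \<in> edges X x y \<Longrightarrow> f 1 e \<in> edges Y (f 0 x) (f 0 y)"
  using sset_map_vertex[of X Y f e 1] sset_map_in[of X Y f e 1] by (auto simp: edges_def)

lemma sset_map_tri:
  assumes "sset_map X Y f" "tri X a b c"
  shows "tri Y (f 1 a) (f 1 b) (f 1 c)"
proof -
  obtain w where w: "w \<in> simp X 2" "face X 2 2 w = a" "face X 2 0 w = b" "face X 2 1 w = c"
    using assms(2) by (auto simp: tri_def)
  then show ?thesis
    using sset_map_in[OF assms(1) w(1)] sset_map_face[OF assms(1), of w 1] unfolding tri_def
    by (force simp: numeral_2_eq_2)
qed

lemma same_path_component_map:
  assumes "sset_map X Y f" "same_path_component X x y"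
  shows "same_path_component Y (f 0 x) (f 0 y)"
proof -
  have "(f 0 a, f 0 b) \<in> path_edges Y" if "(a, b) \<in> path_edges X" for a b
    using that sset_map_vertex[OF assms(1), of _ 1] sset_map_in[OF assms(1), of _ 1]
    by (force simp: path_edges_def)
  from zigzag_image[of x y "path_edges X" "f 0", OF _ this] show ?thesis
    using assms sset_map_in[OF assms(1), of _ 0] by (simp add: same_path_component_iff)
qed

text \<open>Being joined by an edge is already an equivalence relation in a Kan complex: outer
  2-horns invert edges and inner ones compose them. A zigzag is thereby replaced by one
  edge.\<close>

lemma kan_path_edge:
  assumes "kan_complex X" "same_path_component X x y"
  shows "\<exists>e. e \<in> edges X x y"
proof -
  interpret tri_calculus X
    by (rule quasi_category_tri_calculus[OF kan_complex_quasi_category[OF assms(1)]])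
  have "\<exists>e. e \<in> edges X x x" if "x \<in> simp X 0" for x
    using const_simp_edge[OF that] by blast
  moreover have "\<exists>e. e \<in> edges X y x" if "\<exists>e. e \<in> edges X x y" for x y
  proof -
    from that obtain e where e: "e \<in> edges X x y" by blast
    have c: "const_simp X 1 x \<in> edges X x x"
      by (rule const_simp_edge) (use edges_vertices[OF e] in simp)
    then obtain b where "tri X e b (const_simp X 1 x)"
      using kan_tri_divide[OF assms(1) e] by blast
    then show ?thesis
      by (rule triE) (use e c in \<open>auto simp: edges_def\<close>)
  qed
  moreover have "\<exists>e. e \<in> edges X x z" if "\<exists>e. e \<in> edges X x y" "\<exists>e. e \<in> edges X y z" for x y z
  proof -
    from that obtain a b where ab: "a \<in> edges X x y" "b \<in> edges X y z" by blast
    then obtain c where "tri X a b c" using tri_ex by blast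
    then show ?thesis
      by (rule triE) (use ab in \<open>auto simp: edges_def\<close>)
  qed
  ultimately show ?thesis
    using same_path_component_induct[OF assms(2), of "\<lambda>x y. \<exists>e. e \<in> edges X x y"] by blast
qed

section \<open>Homotopies\<close>

text \<open>The nondegenerate edge of the interval. Paired with an edge it is the diagonal of the
  square spanned by that edge and the interval, paired with a degenerate edge it is a side.\<close>

definition iota :: "nat \<Rightarrow> nat" where "iota = restrict id {..1}"

lemma iota_in: "iota \<in> simp (std_simplex 1) 1"
  by (auto simp: iota_def std_simplex_def ord_maps_def)

lemma std_const_in: "r \<le> n \<Longrightarrow> std_const r m \<in> simp (std_simplex n) m"
  by (auto simp: std_const_def std_simplex_def ord_maps_def)

text \<open>The square spanned by \<open>e\<close> and the interval consists of two triangles with a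
  common diagonal. Their images under \<open>H\<close> say that both ways around the naturality
  square have the composite \<open>H 1 (e, iota)\<close>.\<close>

lemma prism:
  assumes "sset X" and H: "sset_map (sset_prod X (std_simplex 1)) Y H" and e: "e \<in> edges X x y"
  shows "tri Y (H 1 (const_simp X 1 x, iota)) (H 1 (e, std_const 1 1)) (H 1 (e, iota))"
    and "tri Y (H 1 (e, std_const 0 1)) (H 1 (const_simp X 1 y, iota)) (H 1 (e, iota))"
proof -
  interpret sset X by fact
  have c: "coface i \<in> ord_maps 1 2" for i using coface_ord_maps[of i 1] by (simp add: numeral_2_eq_2)
  have f: "e \<in> simp X 1" "x = vertex X 1 0 e" "y = vertex X 1 1 e" using e by (auto simp: edges_def)
  have key: "tri Y (H 1 (act X 1 1 (\<alpha> \<circ> coface 2) e, restrict (\<beta> \<circ> coface 2) {..1}))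
      (H 1 (act X 1 1 (\<alpha> \<circ> coface 0) e, restrict (\<beta> \<circ> coface 0) {..1}))
      (H 1 (act X 1 1 (\<alpha> \<circ> coface 1) e, restrict (\<beta> \<circ> coface 1) {..1}))"
    if ab: "\<alpha> \<in> ord_maps 2 1" "\<beta> \<in> ord_maps 2 1" for \<alpha> \<beta>
  proof -
    let ?p = "(act X 2 1 \<alpha> e, restrict \<beta> {..2})"
    have p: "?p \<in> simp (sset_prod X (std_simplex 1)) 2"
      using act_in[OF ab(1) f(1)] ab(2) by (auto simp: sset_prod_def std_simplex_def ord_maps_def)
    have "act (sset_prod X (std_simplex 1)) 1 2 (coface i) ?p =
        (act X 1 1 (\<alpha> \<circ> coface i) e, restrict (\<beta> \<circ> coface i) {..1})" for i
      using act_act[OF c ab(1) f(1), of i]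
      by (auto simp: sset_prod_def std_simplex_def fun_eq_iff coface_def restrict_def)
    then have "face Y 2 i (H 2 ?p) = H 1 (act X 1 1 (\<alpha> \<circ> coface i) e, restrict (\<beta> \<circ> coface i) {..1})" for i
      using sset_map_act[OF H c p, of i] by (simp add: face_def)
    then show ?thesis using sset_map_in[OF H p] by (auto simp: tri_def)
  qed
  \<comment> \<open>The two degeneracies from dimension 1 to 2. Pairing them in either order gives
    the two shuffles, that is, the two triangles of the square.\<close>
  let ?s = "\<lambda>k::nat. k - 1" and ?t = "\<lambda>k::nat. min k 1"
  have st: "?s \<in> ord_maps 2 1" "?t \<in> ord_maps 2 1" by (auto simp: ord_maps_def)
  have deg: "act X 1 1 \<alpha> e = const_simp X 1 (vertex X 1 i e)" if "\<And>k. k \<le> 1 \<Longrightarrow> \<alpha> k = i" "i \<le> 1" for \<alpha> i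
  proof -
    have "\<alpha> \<in> ord_maps 1 1" using that by (auto simp: ord_maps_def)
    then have "act X 1 1 \<alpha> e = act X 1 1 (\<lambda>_. i) e" by (rule act_cong) (use f that in auto)
    also have "\<dots> = const_simp X 1 (vertex X 1 i e)"
      unfolding const_simp_def vertex_def
      by (rule act_act_cong[symmetric]) (use f that in \<open>auto simp: const_ord_maps\<close>)
    finally show ?thesis .
  qed
  have ide: "act X 1 1 \<alpha> e = e" if "\<And>k. k \<le> 1 \<Longrightarrow> \<alpha> k = k" for \<alpha>
    using act_id_on[OF f(1) that] .
  have r: "restrict \<beta> {..1} = iota" if "\<And>k. k \<le> 1 \<Longrightarrow> \<beta> k = k" for \<beta>
    using that by (auto simp: iota_def fun_eq_iff restrict_def)
  have k: "restrict \<beta> {..1} = std_const i 1" if "\<And>k. k \<le> 1 \<Longrightarrow> \<beta> k = i" for \<beta> i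
    using that by (auto simp: std_const_def fun_eq_iff restrict_def)
  have s: "act X 1 1 (?s \<circ> coface 2) e = const_simp X 1 x" "act X 1 1 (?s \<circ> coface 0) e = e"
    "act X 1 1 (?s \<circ> coface 1) e = e" "act X 1 1 (?t \<circ> coface 2) e = e"
    "act X 1 1 (?t \<circ> coface 0) e = const_simp X 1 y" "act X 1 1 (?t \<circ> coface 1) e = e"
    unfolding f(2,3) by (rule deg ide; auto simp: coface_def)+
  have t: "restrict (?s \<circ> coface 2) {..1} = std_const 0 1" "restrict (?s \<circ> coface 0) {..1} = iota"
    "restrict (?s \<circ> coface 1) {..1} = iota" "restrict (?t \<circ> coface 2) {..1} = iota"
    "restrict (?t \<circ> coface 0) {..1} = std_const 1 1" "restrict (?t \<circ> coface 1) {..1} = iota"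
    by (rule k r; auto simp: coface_def)+
  show "tri Y (H 1 (const_simp X 1 x, iota)) (H 1 (e, std_const 1 1)) (H 1 (e, iota))"
    using key[OF st] by (simp only: s t)
  show "tri Y (H 1 (e, std_const 0 1)) (H 1 (const_simp X 1 y, iota)) (H 1 (e, iota))"
    using key[OF st(2,1)] by (simp only: s t)
qed

lemma homotopy_edge:
  assumes X: "sset X" and H: "sset_map (sset_prod X (std_simplex 1)) Y H" and x: "x \<in> simp X 0"
  shows "H 1 (const_simp X 1 x, iota) \<in> edges Y (H 0 (x, std_const 0 0)) (H 0 (x, std_const 1 0))"
proof -
  interpret sset X by fact
  have p: "(const_simp X 1 x, iota) \<in> simp (sset_prod X (std_simplex 1)) 1"
    using const_simp_in[OF x] iota_in by (simp add: sset_prod_def)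
  have "vertex (sset_prod X (std_simplex 1)) 1 i (const_simp X 1 x, iota) = (x, std_const i 0)"
    if "i \<le> 1" for i
    using vertex_const[OF x that] that
    by (auto simp: vertex_def sset_prod_def std_simplex_def std_const_def iota_def fun_eq_iff restrict_def)
  then show ?thesis
    using sset_map_vertex[OF H p] sset_map_in[OF H p] by (auto simp: edges_def)
qed

lemma homotopic_edge:
  assumes "sset X" "homotopic X Y f g" "x \<in> simp X 0"
  shows "\<exists>e. e \<in> edges Y (f 0 x) (g 0 x)"
proof -
  obtain H where H: "sset_map (sset_prod X (std_simplex 1)) Y H"
    "\<And>n x. x \<in> simp X n \<Longrightarrow> H n (x, std_const 0 n) = f n x \<and> H n (x, std_const 1 n) = g n x"
    using assms(2) by (auto simp: homotopic_def)
  then show ?thesis using homotopy_edge[OF assms(1) H(1) assms(3)] assms(3) by auto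
qed

lemma homotopy_equivalence_surj:
  assumes "sset Y" "homotopy_equivalence X Y f" "y \<in> simp Y 0"
  obtains x e where "x \<in> simp X 0" "e \<in> edges Y (f 0 x) y"
proof -
  obtain g where g: "sset_map Y X g" "homotopic Y Y (\<lambda>n y. f n (g n y)) (\<lambda>n y. y)"
    using assms(2) by (auto simp: homotopy_equivalence_def)
  show thesis
    using that sset_map_in[OF g(1) assms(3)] homotopic_edge[OF assms(1) g(2) assms(3)] by blast
qed

text \<open>A map that factors through the point has the same value at all vertices, so the homotopy
  from it to the identity joins every vertex to that value.\<close>

lemma contractible_path:
  assumes "sset X" "contractible X"
  shows "simp X 0 \<noteq> {}"
    and "x \<in> simp X 0 \<Longrightarrow> y \<in> simp X 0 \<Longrightarrow> same_path_component X x y"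
proof -
  obtain g where g: "sset_map (std_simplex 0) X g"
    "homotopic X X (\<lambda>n x. g n (std_const 0 n)) (\<lambda>n x. x)"
    using assms(2) by (auto simp: contractible_def homotopy_equivalence_def)
  show "simp X 0 \<noteq> {}" using sset_map_in[OF g(1) std_const_in[of 0 0 0]] by auto
  have p: "same_path_component X (g 0 (std_const 0 0)) x" if "x \<in> simp X 0" for x
    using homotopic_edge[OF assms(1) g(2) that] same_path_component_edge[OF assms(1)] by blast
  show "same_path_component X x y" if "x \<in> simp X 0" "y \<in> simp X 0"
    by (rule same_path_component_trans[OF same_path_component_sym[OF p[OF that(1)]] p[OF that(2)]])
qed

section \<open>Filtered colimits of sets\<close>

locale directed_index =
  fixes J :: "'v set" and le :: "'v \<Rightarrow> 'v \<Rightarrow> bool"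
  assumes le_refl: "V \<in> J \<Longrightarrow> le V V"
    and le_trans: "U \<in> J \<Longrightarrow> V \<in> J \<Longrightarrow> W \<in> J \<Longrightarrow> le U V \<Longrightarrow> le V W \<Longrightarrow> le U W"
    and directed: "U \<in> J \<Longrightarrow> V \<in> J \<Longrightarrow> \<exists>W\<in>J. le W U \<and> le W V"

locale directed_system = directed_index +
  fixes S :: "'v \<Rightarrow> 'a set" and t :: "'v \<Rightarrow> 'v \<Rightarrow> 'a \<Rightarrow> 'a"
  assumes t_in: "V \<in> J \<Longrightarrow> W \<in> J \<Longrightarrow> le W V \<Longrightarrow> x \<in> S V \<Longrightarrow> t V W x \<in> S W"
    and t_refl: "V \<in> J \<Longrightarrow> x \<in> S V \<Longrightarrow> t V V x = x"
    and t_trans: "U \<in> J \<Longrightarrow> V \<in> J \<Longrightarrow> W \<in> J \<Longrightarrow> le V U \<Longrightarrow> le W V \<Longrightarrow> x \<in> S U \<Longrightarrow>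
      t V W (t U V x) = t U W x"
begin

definition cls :: "'v \<Rightarrow> 'a \<Rightarrow> ('v \<times> 'a) set" where
  "cls V x = colim_rel J le S t `` {(V, x)}"

lemma equiv_colim_rel: "equiv (Sigma J S) (colim_rel J le S t)"
proof (rule equivI)
  show "colim_rel J le S t \<subseteq> Sigma J S \<times> Sigma J S" by (auto simp: colim_rel_def)
  show "refl_on (Sigma J S) (colim_rel J le S t)"
    using le_refl by (fastforce simp: refl_on_def colim_rel_def)
  show "sym (colim_rel J le S t)"
    unfolding sym_def colim_rel_def by fastforce
  show "trans (colim_rel J le S t)"
  proof (rule transI, clarify)
    fix U x V y W z
    assume "((U, x), V, y) \<in> colim_rel J le S t" "((V, y), W, z) \<in> colim_rel J le S t"
    then obtain A B where A: "A \<in> J" "le A U" "le A V" "t U A x = t V A y"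
      and B: "B \<in> J" "le B V" "le B W" "t V B y = t W B z"
      and e: "U \<in> J" "x \<in> S U" "V \<in> J" "y \<in> S V" "W \<in> J" "z \<in> S W"
      by (auto simp: colim_rel_def)
    obtain C where C: "C \<in> J" "le C A" "le C B" using directed A(1) B(1) by blast
    have "t U C x = t V C y" "t V C y = t W C z"
      using t_trans[of _ A C] t_trans[of _ B C] A B C e by metis+
    moreover have "le C U" "le C W" using le_trans A B C e by blast+
    ultimately show "((U, x), W, z) \<in> colim_rel J le S t"
      using C e by (auto simp: colim_rel_def)
  qed
qed

lemma cls_eq_iff:
  assumes "U \<in> J" "x \<in> S U" "V \<in> J" "y \<in> S V"
  shows "cls U x = cls V y \<longleftrightarrow> (\<exists>W\<in>J. le W U \<and> le W V \<and> t U W x = t V W y)"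
  using eq_equiv_class_iff[OF equiv_colim_rel, of "(U, x)" "(V, y)"] assms
  by (auto simp: cls_def colim_rel_def)

lemma cls_t:
  assumes "V \<in> J" "W \<in> J" "le W V" "x \<in> S V"
  shows "cls W (t V W x) = cls V x"
  using assms le_refl by (subst cls_eq_iff) (auto intro!: bexI[of _ W] simp: t_in t_refl)

lemma quotient_cls: "Sigma J S // colim_rel J le S t = {cls V x | V x. V \<in> J \<and> x \<in> S V}"
  by (auto simp: quotient_def cls_def)

lemma cls_in: "V \<in> J \<Longrightarrow> x \<in> S V \<Longrightarrow> cls V x \<in> Sigma J S // colim_rel J le S t"
  by (auto simp: quotient_cls)

text \<open>An equation valid at one stage stays valid at all later ones; in this form several
  equations can be achieved simultaneously.\<close>

lemma common_stage:
  assumes "U \<in> J" "x \<in> S U" "V \<in> J" "y \<in> S V" "cls U x = cls V y"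
  shows "\<exists>W\<in>J. le W U \<and> le W V \<and> (\<forall>Z\<in>J. le Z W \<longrightarrow> t U Z x = t V Z y)"
  using assms cls_eq_iff[OF assms(1-4)] t_trans by metis

text \<open>The action on the colimit is defined by moving all representatives of a class and
  saturating. By naturality the moved representatives lie in one class, so a single one computes the
  result.\<close>

lemma cls_image:
  assumes "directed_system J le S' t'"
    and h: "\<And>V x. V \<in> J \<Longrightarrow> x \<in> S V \<Longrightarrow> h V x \<in> S' V"
    and nat: "\<And>V W x. V \<in> J \<Longrightarrow> W \<in> J \<Longrightarrow> le W V \<Longrightarrow> x \<in> S V \<Longrightarrow> t' V W (h V x) = h W (t V W x)"
    and V: "V \<in> J" "x \<in> S V"
  shows "colim_rel J le S' t' `` ((\<lambda>(V, x). (V, h V x)) ` cls V x) =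
    directed_system.cls J le S' t' V (h V x)"
proof -
  interpret S': directed_system J le S' t' by fact
  have "S'.cls W (h W y) = S'.cls V (h V x)" if "(W, y) \<in> cls V x" for W y
  proof -
    from that V obtain Z where Z: "W \<in> J" "y \<in> S W" "Z \<in> J" "le Z V" "le Z W" "t V Z x = t W Z y"
      by (auto simp: cls_def colim_rel_def)
    then show ?thesis
      using V h nat by (subst S'.cls_eq_iff) (auto intro!: bexI[of _ Z])
  qed
  then have "\<forall>p\<in>cls V x. S'.cls (fst p) (h (fst p) (snd p)) = S'.cls V (h V x)" by simp
  moreover have "(V, x) \<in> cls V x"
    using equiv_class_self[OF equiv_colim_rel, of "(V, x)"] V by (simp add: cls_def)
  ultimately have "(\<Union>p\<in>cls V x. S'.cls (fst p) (h (fst p) (snd p))) = S'.cls V (h V x)"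
    by (intro UN_constant_eq)
  then show ?thesis
    by (subst Image_eq_UN) (simp add: S'.cls_def split_beta)
qed

text \<open>A zigzag of edges in a filtered colimit has finitely many edges, hence is defined at one
  stage.\<close>

lemma zigzag_stage:
  assumes lift: "\<And>c d. (c, d) \<in> E \<Longrightarrow> \<exists>V\<in>J. \<exists>x\<in>S V. \<exists>y\<in>S V. c = cls V x \<and> d = cls V y \<and> (x, y) \<in> G V"
    and nat: "\<And>V W x y. V \<in> J \<Longrightarrow> W \<in> J \<Longrightarrow> le W V \<Longrightarrow> (x, y) \<in> G V \<Longrightarrow> (t V W x, t V W y) \<in> G W"
    and V: "V \<in> J" "x \<in> S V" "y \<in> S V" and zz: "(cls V x, cls V y) \<in> (E \<union> E\<inverse>)\<^sup>*"
  shows "\<exists>W\<in>J. le W V \<and> (t V W x, t V W y) \<in> (G W \<union> (G W)\<inverse>)\<^sup>*"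
proof -
  have mono: "(t U W x, t U W y) \<in> (G W \<union> (G W)\<inverse>)\<^sup>*"
    if "U \<in> J" "W \<in> J" "le W U" "(x, y) \<in> (G U \<union> (G U)\<inverse>)\<^sup>*" for U W x y
    using zigzag_image[OF that(4) nat[OF that(1-3)]] .
  \<comment> \<open>Induction along the zigzag: only its start has a given representative at
    \<open>V\<close>, so the current end is carried along as some \<open>z\<close> at the stage
    reached so far.\<close>
  have "\<exists>W\<in>J. \<exists>z\<in>S W. le W V \<and> c = cls W z \<and> (t V W x, z) \<in> (G W \<union> (G W)\<inverse>)\<^sup>*"
    if "(cls V x, c) \<in> (E \<union> E\<inverse>)\<^sup>*" for c
    using that
  proof induction
    case base
    then show ?case using V le_refl t_refl by fastforce
  next
    case (step c d)
    then obtain W z where W: "W \<in> J" "z \<in> S W" "le W V" "c = cls W z"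
      "(t V W x, z) \<in> (G W \<union> (G W)\<inverse>)\<^sup>*" by blast
    obtain U a b where U: "U \<in> J" "a \<in> S U" "b \<in> S U" "c = cls U a" "d = cls U b"
      "(a, b) \<in> G U \<union> (G U)\<inverse>"
      using step.hyps(2) lift by blast
    obtain Z where Z: "Z \<in> J" "le Z W" "le Z U" "t W Z z = t U Z a"
      using cls_eq_iff[OF W(1,2) U(1,2)] W(4) U(4) by auto
    have "(t U Z a, t U Z b) \<in> G Z \<union> (G Z)\<inverse>"
      using U(6) nat[OF U(1) Z(1,3)] by blast
    moreover have "(t W Z (t V W x), t W Z z) \<in> (G Z \<union> (G Z)\<inverse>)\<^sup>*"
      by (rule mono) (use W Z in auto)
    ultimately have "(t V Z x, t U Z b) \<in> (G Z \<union> (G Z)\<inverse>)\<^sup>*"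
      using t_trans[OF V(1) W(1) Z(1) W(3) Z(2) V(2)] Z(4) by (metis rtrancl.rtrancl_into_rtrancl)
    moreover have "le Z V" using le_trans Z(1,2) W(1,3) V(1) by blast
    moreover have "d = cls Z (t U Z b)" using U Z cls_t by simp
    ultimately show ?case using Z U t_in by blast
  qed
  from this[OF zz] obtain W z where W: "W \<in> J" "z \<in> S W" "le W V" "cls V y = cls W z"
    "(t V W x, z) \<in> (G W \<union> (G W)\<inverse>)\<^sup>*" by blast
  \<comment> \<open>The end reached represents the class of \<open>y\<close>; one more stage makes
    the two representatives equal.\<close>
  obtain Z where Z: "Z \<in> J" "le Z V" "le Z W" "t V Z y = t W Z z"
    using cls_eq_iff[OF V(1,3) W(1,2)] W(4) by auto
  have "(t W Z (t V W x), t W Z z) \<in> (G Z \<union> (G Z)\<inverse>)\<^sup>*"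
    by (rule mono) (use W Z in auto)
  then show ?thesis
    using Z t_trans[OF V(1) W(1) Z(1) W(3) Z(3) V(2)] by auto
qed

end

section \<open>The filter of subobjects\<close>

text \<open>Intersections in the filter provide the lower bounds. The relation \<open>le0\<close> is
  abstract and only three inequalities between \<open>zero\<close> and \<open>one\<close> are asked
  of it, so that the lemma serves all three models.\<close>

lemma subset_filter_directed:
  assumes filter: "product_closed_filter I \<Phi>"
    and le0: "le0 zero zero" "le0 zero one" "le0 one one"
    and le: "\<And>U V. U \<in> subset_filter I zero one \<Phi> \<Longrightarrow> V \<in> subset_filter I zero one \<Phi> \<Longrightarrow>
      le U V \<longleftrightarrow> (\<forall>i\<in>I. le0 (U i) (V i))"
  shows "directed_index (subset_filter I zero one \<Phi>) le"
    and "subset_object I zero one I \<in> subset_filter I zero one \<Phi>"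
    and "V \<in> subset_filter I zero one \<Phi> \<Longrightarrow> le V (subset_object I zero one I)"
proof -
  show top: "subset_object I zero one I \<in> subset_filter I zero one \<Phi>"
    using filter by (auto simp: subset_filter_def product_closed_filter_def)
  show "V \<in> subset_filter I zero one \<Phi> \<Longrightarrow> le V (subset_object I zero one I)"
    using le top le0 by (auto simp: subset_object_def subset_filter_def)
  show "directed_index (subset_filter I zero one \<Phi>) le"
  proof
    fix V assume "V \<in> subset_filter I zero one \<Phi>"
    then show "le V V" using le le0 by (auto simp: subset_object_def subset_filter_def)
  next
    fix U V W
    assume UVW: "U \<in> subset_filter I zero one \<Phi>" "V \<in> subset_filter I zero one \<Phi>"
      "W \<in> subset_filter I zero one \<Phi>" "le U V" "le V W"
    \<comment> \<open>\<open>le0\<close> is not assumed transitive: among the two values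
      \<open>zero\<close> and \<open>one\<close> transitivity follows from the three inequalities by
      cases.\<close>
    have "U i \<in> {zero, one}" "V i \<in> {zero, one}" "W i \<in> {zero, one}" if "i \<in> I" for i
      using UVW(1-3) that by (auto simp: subset_object_def subset_filter_def)
    then show "le U W" using UVW le le0 by (metis insertE singletonD)
  next
    fix U V assume "U \<in> subset_filter I zero one \<Phi>" "V \<in> subset_filter I zero one \<Phi>"
    then obtain A B where AB: "A \<in> \<Phi>" "B \<in> \<Phi>" "U = subset_object I zero one A" "V = subset_object I zero one B"
      by (auto simp: subset_filter_def)
    then have "A \<inter> B \<in> \<Phi>" using filter by (simp add: product_closed_filter_def)
    moreover have "le (subset_object I zero one (A \<inter> B)) (subset_object I zero one C)"
      if "C \<in> {A, B}" for C
    proof (subst le)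
      show "subset_object I zero one (A \<inter> B) \<in> subset_filter I zero one \<Phi>"
        "subset_object I zero one C \<in> subset_filter I zero one \<Phi>"
        using that AB \<open>A \<inter> B \<in> \<Phi>\<close> by (auto simp: subset_filter_def)
      show "\<forall>i\<in>I. le0 (subset_object I zero one (A \<inter> B) i) (subset_object I zero one C i)"
        using that le0 by (auto simp: subset_object_def)
    qed
    ultimately show "\<exists>W\<in>subset_filter I zero one \<Phi>. le W U \<and> le W V"
      unfolding AB subset_filter_def by blast
  qed
qed

lemma upward_closed_filter_iff:
  assumes "product_closed_filter I \<Phi>" "B \<subseteq> I"
  shows "B \<in> \<Phi> \<longleftrightarrow> (\<exists>A\<in>\<Phi>. A \<subseteq> B)"
  using assms by (auto simp: product_closed_filter_def)

section \<open>Filtered colimits and products of simplicial sets\<close>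

locale sset_system = directed_index +
  fixes E :: "'v \<Rightarrow> 'a sset" and t :: "'v \<Rightarrow> 'v \<Rightarrow> nat \<Rightarrow> 'a \<Rightarrow> 'a"
  assumes sset_E: "V \<in> J \<Longrightarrow> sset (E V)"
    and t_map: "V \<in> J \<Longrightarrow> W \<in> J \<Longrightarrow> le W V \<Longrightarrow> sset_map (E V) (E W) (t V W)"
    and t_refl: "V \<in> J \<Longrightarrow> x \<in> simp (E V) n \<Longrightarrow> t V V n x = x"
    and t_trans: "U \<in> J \<Longrightarrow> V \<in> J \<Longrightarrow> W \<in> J \<Longrightarrow> le V U \<Longrightarrow> le W V \<Longrightarrow> x \<in> simp (E U) n \<Longrightarrow>
      t V W n (t U V n x) = t U W n x"
begin

lemma level: "directed_system J le (\<lambda>V. simp (E V) n) (\<lambda>V W. t V W n)"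
  by unfold_locales (simp_all add: sset_map_in[OF t_map] t_refl t_trans)

lemma class_cls: "colim_class J le E t V n x =
    directed_system.cls J le (\<lambda>V. simp (E V) n) (\<lambda>V W. t V W n) V x"
  by (simp add: colim_class_def directed_system.cls_def[OF level])

lemma class_map: "V \<in> J \<Longrightarrow> sset_map (E V) (sset_colim J le E t) (colim_class J le E t V)"
  unfolding sset_map_def
proof (intro conjI allI ballI)
  fix n x assume V: "V \<in> J" and x: "x \<in> simp (E V) n"
  show "colim_class J le E t V n x \<in> simp (sset_colim J le E t) n"
    using directed_system.cls_in[OF level V x] by (simp add: class_cls sset_colim_def)
  fix m \<alpha> assume \<alpha>: "\<alpha> \<in> ord_maps m n"
  show "colim_class J le E t V m (act (E V) m n \<alpha> x) =
    act (sset_colim J le E t) m n \<alpha> (colim_class J le E t V n x)"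
    unfolding class_cls sset_colim_def sset.select_convs
    by (rule directed_system.cls_image[OF level level, where h="\<lambda>V. act (E V) m n \<alpha>", symmetric])
      (simp_all add: V x \<alpha> sset.act_in[OF sset_E] sset_map_act[OF t_map])
qed

lemma simp_colim_iff:
  "x \<in> simp (sset_colim J le E t) n \<longleftrightarrow> (\<exists>V\<in>J. \<exists>y\<in>simp (E V) n. x = colim_class J le E t V n y)"
  by (auto simp: sset_colim_def class_cls directed_system.quotient_cls[OF level])

lemma class_t:
  "V \<in> J \<Longrightarrow> W \<in> J \<Longrightarrow> le W V \<Longrightarrow> x \<in> simp (E V) n \<Longrightarrow>
    colim_class J le E t W n (t V W n x) = colim_class J le E t V n x"
  by (simp add: class_cls directed_system.cls_t[OF level])

text \<open>In a level-wise colimit an edge comes, together with its end points, from an edge of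
  some stage, so the zigzag argument applies with the edges of the stages as the relations
  \<open>G\<close>.\<close>

lemma same_path_component_colim:
  assumes V: "V \<in> J" "x \<in> simp (E V) 0" "y \<in> simp (E V) 0"
  shows "same_path_component (sset_colim J le E t) (colim_class J le E t V 0 x) (colim_class J le E t V 0 y)
    \<longleftrightarrow> (\<exists>W\<in>J. le W V \<and> same_path_component (E W) (t V W 0 x) (t V W 0 y))" (is "?L \<longleftrightarrow> ?R")
proof
  interpret S: directed_system J le "\<lambda>V. simp (E V) 0" "\<lambda>V W. t V W 0" by (rule level)
  let ?Q = "sset_colim J le E t"
  assume ?L
  have "\<exists>W\<in>J. le W V \<and> (t V W 0 x, t V W 0 y) \<in> (path_edges (E W) \<union> (path_edges (E W))\<inverse>)\<^sup>*"
  proof (rule S.zigzag_stage[where G="\<lambda>V. path_edges (E V)", OF _ _ V])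
    show "(S.cls V x, S.cls V y) \<in> (path_edges ?Q \<union> (path_edges ?Q)\<inverse>)\<^sup>*"
      using \<open>?L\<close> by (simp add: same_path_component_iff class_cls)
  next
    fix c d assume "(c, d) \<in> path_edges ?Q"
    then obtain e where e: "e \<in> simp ?Q 1" "c = vertex ?Q 1 0 e" "d = vertex ?Q 1 1 e"
      by (auto simp: path_edges_def)
    then obtain U e' where U: "U \<in> J" "e' \<in> simp (E U) 1" "e = colim_class J le E t U 1 e'"
      using simp_colim_iff by blast
    have "c = S.cls U (vertex (E U) 1 0 e')" "d = S.cls U (vertex (E U) 1 1 e')"
      using e U sset_map_vertex[OF class_map[OF U(1)] U(2)] by (simp_all add: class_cls)
    then show "\<exists>V\<in>J. \<exists>x\<in>simp (E V) 0. \<exists>y\<in>simp (E V) 0. c = S.cls V x \<and> d = S.cls V y \<and> (x, y) \<in> path_edges (E V)"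
      using U sset.vertex_in[OF sset_E[OF U(1)] U(2)]
      by (intro bexI[of _ U] bexI[of _ "vertex (E U) 1 0 e'"] bexI[of _ "vertex (E U) 1 1 e'"])
        (auto simp: path_edges_def)
  next
    fix U W x y assume *: "U \<in> J" "W \<in> J" "le W U" "(x, y) \<in> path_edges (E U)"
    then obtain e where "e \<in> edges (E U) x y" by (auto simp: path_edges_def edges_def)
    from sset_map_edges[OF t_map[OF *(1-3)] this]
    show "(t U W 0 x, t U W 0 y) \<in> path_edges (E W)"
      by (force simp: path_edges_def edges_def)
  qed
  then show ?R
    using V by (auto simp: same_path_component_iff sset_map_in[OF t_map])
next
  assume ?R
  then obtain W where W: "W \<in> J" "le W V" "same_path_component (E W) (t V W 0 x) (t V W 0 y)" by blast
  from same_path_component_map[OF class_map[OF W(1)] W(3)] show ?L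
    using V W by (simp add: class_t)
qed

end

section \<open>Products of simplicial sets\<close>

lemma sset_Pi_simps:
  "simp (sset_Pi I E) n = PiE I (\<lambda>i. simp (E i) n)"
  "act (sset_Pi I E) m n \<alpha> x = (\<lambda>i\<in>I. act (E i) m n \<alpha> (x i))"
  "face (sset_Pi I E) n k x = (\<lambda>i\<in>I. face (E i) n k (x i))"
  "vertex (sset_Pi I E) n k x = (\<lambda>i\<in>I. vertex (E i) n k (x i))"
  "const_simp (sset_Pi I E) n x = (\<lambda>i\<in>I. const_simp (E i) n (x i))"
  by (simp_all add: sset_Pi_def face_def vertex_def const_simp_def)

lemma sset_Pi: 
  assumes "\<And>i. i \<in> I \<Longrightarrow> sset (E i)" shows "sset (sset_Pi I E)"
proof
  show "simplicial_set (sset_Pi I E)"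
    unfolding simplicial_set_def
  proof (intro conjI allI ballI impI)
    fix m n \<alpha> x assume *: "\<alpha> \<in> ord_maps m n" "x \<in> simp (sset_Pi I E) n"
    show "act (sset_Pi I E) m n \<alpha> x \<in> simp (sset_Pi I E) m"
      using * sset.act_in[OF assms] by (auto simp: sset_Pi_simps PiE_iff)
  next
    fix m n \<alpha> \<beta> x assume *: "\<alpha> \<in> ord_maps m n" "x \<in> simp (sset_Pi I E) n" "\<forall>i\<le>m. \<alpha> i = \<beta> i"
    show "act (sset_Pi I E) m n \<alpha> x = act (sset_Pi I E) m n \<beta> x"
      unfolding sset_Pi_simps
      by (rule restrict_ext, rule sset.act_cong[OF assms]) (use * in \<open>auto simp: sset_Pi_simps\<close>)
  next
    fix n x assume "x \<in> simp (sset_Pi I E) n"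
    then show "act (sset_Pi I E) n n id x = x"
      using sset.act_id[OF assms] by (auto simp: sset_Pi_simps fun_eq_iff PiE_def extensional_def restrict_def)
  next
    fix l m n \<beta> \<alpha> x assume *: "\<beta> \<in> ord_maps l m" "\<alpha> \<in> ord_maps m n" "x \<in> simp (sset_Pi I E) n"
    show "act (sset_Pi I E) l m \<beta> (act (sset_Pi I E) m n \<alpha> x) = act (sset_Pi I E) l n (\<alpha> \<circ> \<beta>) x"
      unfolding sset_Pi_simps
      by (rule restrict_ext) (use * sset.act_act[OF assms *(1,2)] in \<open>auto simp: sset_Pi_simps\<close>)
  qed
qed

lemma sset_prod:
  assumes "sset X" "sset Y" shows "sset (sset_prod X Y)"
proof
  interpret X: sset X by fact
  interpret Y: sset Y by fact
  show "simplicial_set (sset_prod X Y)"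
    unfolding simplicial_set_def
  proof (intro conjI allI ballI impI)
    fix m n \<alpha> x assume *: "\<alpha> \<in> ord_maps m n" "x \<in> simp (sset_prod X Y) n"
    show "act (sset_prod X Y) m n \<alpha> x \<in> simp (sset_prod X Y) m"
      using * by (auto simp: sset_prod_def X.act_in Y.act_in)
    fix \<beta> assume "\<forall>i\<le>m. \<alpha> i = \<beta> i"
    then show "act (sset_prod X Y) m n \<alpha> x = act (sset_prod X Y) m n \<beta> x"
      using * X.act_cong[OF *(1), of "fst x" \<beta>] Y.act_cong[OF *(1), of "snd x" \<beta>]
      by (auto simp: sset_prod_def)
  next
    fix n x assume "x \<in> simp (sset_prod X Y) n"
    then show "act (sset_prod X Y) n n id x = x"
      by (auto simp: sset_prod_def X.act_id Y.act_id)
  next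
    fix l m n \<beta> \<alpha> x assume "\<beta> \<in> ord_maps l m" "\<alpha> \<in> ord_maps m n" "x \<in> simp (sset_prod X Y) n"
    then show "act (sset_prod X Y) l m \<beta> (act (sset_prod X Y) m n \<alpha> x) = act (sset_prod X Y) l n (\<alpha> \<circ> \<beta>) x"
      by (auto simp: sset_prod_def X.act_act Y.act_act)
  qed
qed

text \<open>A horn in a product is a family of horns. One shape (n, k) is fixed, so that the lemma
  applies to all horns of Kan complexes as well as to the inner horns of quasi-categories.\<close>

lemma horn_Pi_fill:
  assumes "\<And>i z. i \<in> I \<Longrightarrow> horn (E i) n k z \<Longrightarrow>
      \<exists>x\<in>simp (E i) n. \<forall>j\<le>n. j \<noteq> k \<longrightarrow> face (E i) n j x = z j"
    and y: "horn (sset_Pi I E) n k y"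
  shows "\<exists>x\<in>simp (sset_Pi I E) n. \<forall>j\<le>n. j \<noteq> k \<longrightarrow> face (sset_Pi I E) n j x = y j"
proof -
  have Y: "y j \<in> PiE I (\<lambda>i. simp (E i) (n - 1))" if "j \<le> n" "j \<noteq> k" for j
    using y that by (simp add: horn_def sset_Pi_simps)
  have "horn (E i) n k (\<lambda>j. y j i)" if "i \<in> I" for i
    unfolding horn_def
  proof (intro conjI allI impI)
    fix j assume "j \<le> n" "j \<noteq> k" then show "y j i \<in> simp (E i) (n - 1)" using Y that by (auto simp: PiE_iff)
  next
    fix a b assume "2 \<le> n" "a < b \<and> b \<le> n \<and> a \<noteq> k \<and> b \<noteq> k"
    then have "face (sset_Pi I E) (n - 1) a (y b) = face (sset_Pi I E) (n - 1) (b - 1) (y a)"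
      using y by (simp add: horn_def)
    from fun_cong[OF this, of i] show "face (E i) (n - 1) a (y b i) = face (E i) (n - 1) (b - 1) (y a i)"
      using that by (simp add: sset_Pi_simps)
  qed
  then have "\<forall>i\<in>I. \<exists>x\<in>simp (E i) n. \<forall>j\<le>n. j \<noteq> k \<longrightarrow> face (E i) n j x = y j i" using assms(1) by blast
  then obtain x where x: "\<And>i. i \<in> I \<Longrightarrow> x i \<in> simp (E i) n \<and> (\<forall>j\<le>n. j \<noteq> k \<longrightarrow> face (E i) n j (x i) = y j i)"
    by metis
  have "face (sset_Pi I E) n j (restrict x I) = y j" if "j \<le> n" "j \<noteq> k" for j
    using x Y[OF that] that by (auto simp: sset_Pi_simps fun_eq_iff PiE_iff extensional_def restrict_def)
  then show ?thesis
    using x by (intro bexI[of _ "restrict x I"]) (auto simp: sset_Pi_simps)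
qed

lemma kan_complex_Pi:
  assumes "\<And>i. i \<in> I \<Longrightarrow> kan_complex (E i)" shows "kan_complex (sset_Pi I E)"
  unfolding kan_complex_def
proof (intro conjI allI impI)
  show "simplicial_set (sset_Pi I E)" by (rule sset.simplicial[OF sset_Pi[OF kan_complex_sset[OF assms]]])
  fix n k y assume "1 \<le> n \<and> k \<le> n \<and> horn (sset_Pi I E) n k y"
  then show "\<exists>x\<in>simp (sset_Pi I E) n. \<forall>i\<le>n. i \<noteq> k \<longrightarrow> face (sset_Pi I E) n i x = y i"
    by (intro horn_Pi_fill kan_fill[OF assms]) auto
qed

lemma quasi_category_Pi:
  assumes "\<And>i. i \<in> I \<Longrightarrow> quasi_category (E i)" shows "quasi_category (sset_Pi I E)"
  unfolding quasi_category_def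
proof (intro conjI allI impI)
  show "simplicial_set (sset_Pi I E)"
    by (rule sset.simplicial[OF sset_Pi]) (use assms in \<open>simp add: quasi_category_def sset_def\<close>)
  fix n k y assume "0 < k \<and> k < n \<and> horn (sset_Pi I E) n k y"
  then show "\<exists>x\<in>simp (sset_Pi I E) n. \<forall>i\<le>n. i \<noteq> k \<longrightarrow> face (sset_Pi I E) n i x = y i"
    using assms unfolding quasi_category_def by (intro horn_Pi_fill) auto
qed

lemma proj_map: "i \<in> I \<Longrightarrow> sset_map (sset_Pi I E) (E i) (\<lambda>n x. x i)"
  by (auto simp: sset_map_def sset_Pi_simps)

lemma tri_Pi_iff:
  assumes "a \<in> simp (sset_Pi I E) 1" "b \<in> simp (sset_Pi I E) 1" "c \<in> simp (sset_Pi I E) 1"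
  shows "tri (sset_Pi I E) a b c \<longleftrightarrow> (\<forall>i\<in>I. tri (E i) (a i) (b i) (c i))"
proof
  show "\<forall>i\<in>I. tri (E i) (a i) (b i) (c i)" if "tri (sset_Pi I E) a b c"
    by (rule ballI, rule sset_map_tri[OF proj_map that])
  assume "\<forall>i\<in>I. tri (E i) (a i) (b i) (c i)"
  then obtain w where w: "\<And>i. i \<in> I \<Longrightarrow> w i \<in> simp (E i) 2 \<and> face (E i) 2 2 (w i) = a i \<and>
      face (E i) 2 0 (w i) = b i \<and> face (E i) 2 1 (w i) = c i"
    unfolding tri_def by metis
  then show "tri (sset_Pi I E) a b c"
    unfolding tri_def using assms
    by (intro bexI[of _ "restrict w I"]) (auto simp: sset_Pi_simps fun_eq_iff PiE_iff extensional_def restrict_def)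
qed

lemma edges_Pi_iff:
  assumes "x \<in> simp (sset_Pi I E) 0" "y \<in> simp (sset_Pi I E) 0"
  shows "e \<in> edges (sset_Pi I E) x y \<longleftrightarrow> e \<in> extensional I \<and> (\<forall>i\<in>I. e i \<in> edges (E i) (x i) (y i))"
  using assms by (auto simp: edges_def sset_Pi_simps fun_eq_iff PiE_iff extensional_def restrict_def)

lemma same_path_component_Pi:
  "same_path_component (sset_Pi I E) x y \<Longrightarrow> i \<in> I \<Longrightarrow> same_path_component (E i) (x i) (y i)"
  by (rule same_path_component_map[OF proj_map])

text \<open>For general factors the zigzags at different indices may have unbounded length. In Kan
  complexes one edge at each index suffices, and a family of edges is an edge of the
  product.\<close>

lemma kan_same_path_component_Pi:
  assumes "\<And>i. i \<in> I \<Longrightarrow> kan_complex (E i)"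
    and xy: "x \<in> simp (sset_Pi I E) 0" "y \<in> simp (sset_Pi I E) 0"
    and "\<And>i. i \<in> I \<Longrightarrow> same_path_component (E i) (x i) (y i)"
  shows "same_path_component (sset_Pi I E) x y"
proof -
  have "\<forall>i\<in>I. \<exists>e. e \<in> edges (E i) (x i) (y i)" by (intro ballI kan_path_edge assms)
  then obtain e where "\<And>i. i \<in> I \<Longrightarrow> e i \<in> edges (E i) (x i) (y i)" by metis
  then have "restrict e I \<in> edges (sset_Pi I E) x y" by (subst edges_Pi_iff[OF xy]) auto
  then show ?thesis
    by (intro same_path_component_edge[of "sset_Pi I E"] sset_Pi kan_complex_sset assms(1))
qed

section \<open>Kan enriched categories\<close>

locale kan_enriched =
  fixes C :: "('o, 'm) enriched"
  assumes enriched: "kan_enriched_category C"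
begin

lemma kan_Map: "X \<in> obj C \<Longrightarrow> Y \<in> obj C \<Longrightarrow> kan_complex (Map C X Y)"
  using enriched unfolding kan_enriched_category_def by blast

lemma sset_Map: "X \<in> obj C \<Longrightarrow> Y \<in> obj C \<Longrightarrow> sset (Map C X Y)"
  by (rule kan_complex_sset[OF kan_Map])

lemma ident_in: "X \<in> obj C \<Longrightarrow> ident C X \<in> simp (Map C X X) 0"
  using enriched unfolding kan_enriched_category_def by blast

lemma comp_map: "X \<in> obj C \<Longrightarrow> Y \<in> obj C \<Longrightarrow> Z \<in> obj C \<Longrightarrow>
    sset_map (sset_prod (Map C Y Z) (Map C X Y)) (Map C X Z) (\<lambda>n (g, f). comp C X Y Z n g f)"
  using enriched unfolding kan_enriched_category_def by blast

lemma comp_in: "X \<in> obj C \<Longrightarrow> Y \<in> obj C \<Longrightarrow> Z \<in> obj C \<Longrightarrow> g \<in> simp (Map C Y Z) n \<Longrightarrow>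
    f \<in> simp (Map C X Y) n \<Longrightarrow> comp C X Y Z n g f \<in> simp (Map C X Z) n"
  using sset_map_in[OF comp_map, of X Y Z "(g, f)" n] by (simp add: sset_prod_def)

lemma comp_act: "X \<in> obj C \<Longrightarrow> Y \<in> obj C \<Longrightarrow> Z \<in> obj C \<Longrightarrow> g \<in> simp (Map C Y Z) n \<Longrightarrow>
    f \<in> simp (Map C X Y) n \<Longrightarrow> \<alpha> \<in> ord_maps m n \<Longrightarrow>
    comp C X Y Z m (act (Map C Y Z) m n \<alpha> g) (act (Map C X Y) m n \<alpha> f) =
    act (Map C X Z) m n \<alpha> (comp C X Y Z n g f)"
  using sset_map_act[OF comp_map, of X Y Z \<alpha> m n "(g, f)"] by (simp add: sset_prod_def)

lemma comp_const: "X \<in> obj C \<Longrightarrow> Y \<in> obj C \<Longrightarrow> Z \<in> obj C \<Longrightarrow> g \<in> simp (Map C Y Z) 0 \<Longrightarrow>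
    f \<in> simp (Map C X Y) 0 \<Longrightarrow>
    comp C X Y Z n (const_simp (Map C Y Z) n g) (const_simp (Map C X Y) n f) =
    const_simp (Map C X Z) n (comp C X Y Z 0 g f)"
  unfolding const_simp_def by (simp add: comp_act const_ord_maps)

lemma comp_ident:
  assumes "X \<in> obj C" "Y \<in> obj C" "f \<in> simp (Map C X Y) n"
  shows "comp C X X Y n f (const_simp (Map C X X) n (ident C X)) = f"
    "comp C X Y Y n (const_simp (Map C Y Y) n (ident C Y)) f = f"
  using enriched assms unfolding kan_enriched_category_def by blast+

lemma comp_assoc: "X \<in> obj C \<Longrightarrow> Y \<in> obj C \<Longrightarrow> Z \<in> obj C \<Longrightarrow> W \<in> obj C \<Longrightarrow>
    f \<in> simp (Map C X Y) n \<Longrightarrow> g \<in> simp (Map C Y Z) n \<Longrightarrow> h \<in> simp (Map C Z W) n \<Longrightarrow>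
    comp C X Y W n (comp C Y Z W n h g) f = comp C X Z W n h (comp C X Y Z n g f)"
  using enriched unfolding kan_enriched_category_def by metis

lemma precomp_map:
  assumes "X \<in> obj C" "Y \<in> obj C" "Z \<in> obj C" "f \<in> simp (Map C X Y) 0"
  shows "sset_map (Map C Y Z) (Map C X Z) (kan_precomp C X Y Z f)"
  using assms sset.const_simp_in[OF sset_Map[OF assms(1,2)]] sset.act_const_simp[OF sset_Map[OF assms(1,2)]]
  unfolding sset_map_def kan_precomp_def
  by (simp add: comp_in comp_act[symmetric])

lemma postcomp_map:
  assumes "X \<in> obj C" "Y \<in> obj C" "Z \<in> obj C" "g \<in> simp (Map C Y Z) 0"
  shows "sset_map (Map C X Y) (Map C X Z) (kan_postcomp C X Y Z g)"
  using assms sset.const_simp_in[OF sset_Map[OF assms(2,3)]] sset.act_const_simp[OF sset_Map[OF assms(2,3)]]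
  unfolding sset_map_def kan_postcomp_def
  by (simp add: comp_in comp_act[symmetric])

lemma precomp_0: "X \<in> obj C \<Longrightarrow> Y \<in> obj C \<Longrightarrow> f \<in> simp (Map C X Y) 0 \<Longrightarrow>
    kan_precomp C X Y Z f 0 g = comp C X Y Z 0 g f"
  by (simp add: kan_precomp_def sset.const_simp_0[OF sset_Map])

lemma postcomp_0: "Y \<in> obj C \<Longrightarrow> Z \<in> obj C \<Longrightarrow> g \<in> simp (Map C Y Z) 0 \<Longrightarrow>
    kan_postcomp C X Y Z g 0 f = comp C X Y Z 0 g f"
  by (simp add: kan_postcomp_def sset.const_simp_0[OF sset_Map])

lemma same_path_component_precomp:
  assumes "X \<in> obj C" "Y \<in> obj C" "Z \<in> obj C" "f \<in> simp (Map C X Y) 0"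
    and "same_path_component (Map C Y Z) g g'"
  shows "same_path_component (Map C X Z) (comp C X Y Z 0 g f) (comp C X Y Z 0 g' f)"
  using same_path_component_map[OF precomp_map[OF assms(1-4)] assms(5)] assms by (simp add: precomp_0)

lemma same_path_component_postcomp:
  assumes "X \<in> obj C" "Y \<in> obj C" "Z \<in> obj C" "g \<in> simp (Map C Y Z) 0"
    and "same_path_component (Map C X Y) f f'"
  shows "same_path_component (Map C X Z) (comp C X Y Z 0 g f) (comp C X Y Z 0 g f')"
  using same_path_component_map[OF postcomp_map[OF assms(1-4)] assms(5)] assms by (simp add: postcomp_0)

lemma comp_ident_0:
  assumes "X \<in> obj C" "Y \<in> obj C" "f \<in> simp (Map C X Y) 0"
  shows "comp C X X Y 0 f (ident C X) = f"
  using comp_ident(1)[OF assms] assms by (simp add: sset.const_simp_0[OF sset_Map] ident_in)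

text \<open>With a section \<open>u\<close> up to homotopy, \<open>f\<close> is joined to
  \<open>f p u\<close>, this to \<open>g p u\<close>, and this to \<open>g\<close>.\<close>

lemma same_path_component_section:
  assumes obj: "X \<in> obj C" "Y \<in> obj C" "P \<in> obj C"
    and fg: "f \<in> simp (Map C X Y) 0" "g \<in> simp (Map C X Y) 0"
    and p: "p \<in> simp (Map C P X) 0" "u \<in> simp (Map C X P) 0"
    and pu: "same_path_component (Map C X X) (comp C X P X 0 p u) (ident C X)"
    and fp: "same_path_component (Map C P Y) (comp C P X Y 0 f p) (comp C P X Y 0 g p)"
  shows "same_path_component (Map C X Y) f g"
proof -
  have "same_path_component (Map C X Y) (comp C X P Y 0 (comp C P X Y 0 h p) u) h"
    if "h \<in> simp (Map C X Y) 0" for h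
    using same_path_component_postcomp[OF obj(1,1,2) that pu] that obj p
    by (simp add: comp_ident_0 comp_assoc)
  note h = this[OF fg(1)] this[OF fg(2)]
  show ?thesis
    by (rule same_path_component_trans[OF same_path_component_sym[OF h(1)]
      same_path_component_trans[OF same_path_component_precomp[OF obj(1,3,2) p(2) fp] h(2)]])
qed

end

section \<open>The enriched category of families and sections of its product projections\<close>

lemma kan_power_simps:
  "obj (kan_power I C) = PiE I (\<lambda>_. obj C)"
  "Map (kan_power I C) X Y = sset_Pi I (\<lambda>i. Map C (X i) (Y i))"
  "comp (kan_power I C) X Y Z n g f = (\<lambda>i\<in>I. comp C (X i) (Y i) (Z i) n (g i) (f i))"
  "ident (kan_power I C) X = (\<lambda>i\<in>I. ident C (X i))"
  by (simp_all add: kan_power_def)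

lemma (in kan_enriched) kan_enriched_power: "kan_enriched (kan_power I C)"
proof
  have o: "X i \<in> obj C" if "X \<in> PiE I (\<lambda>_. obj C)" "i \<in> I" for X i using that by (auto simp: PiE_iff)
  show "kan_enriched_category (kan_power I C)"
    unfolding kan_enriched_category_def kan_power_simps
  proof (intro conjI ballI allI)
    fix X Y assume "X \<in> PiE I (\<lambda>_. obj C)" "Y \<in> PiE I (\<lambda>_. obj C)"
    then show "kan_complex (sset_Pi I (\<lambda>i. Map C (X i) (Y i)))"
      using o by (intro kan_complex_Pi kan_Map)
  next
    fix X assume "X \<in> PiE I (\<lambda>_. obj C)"
    then show "(\<lambda>i\<in>I. ident C (X i)) \<in> simp (sset_Pi I (\<lambda>i. Map C (X i) (X i))) 0"
      using o ident_in by (auto simp: sset_Pi_simps)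
  next
    fix X Y Z assume XYZ: "X \<in> PiE I (\<lambda>_. obj C)" "Y \<in> PiE I (\<lambda>_. obj C)" "Z \<in> PiE I (\<lambda>_. obj C)"
    show "sset_map (sset_prod (sset_Pi I (\<lambda>i. Map C (Y i) (Z i))) (sset_Pi I (\<lambda>i. Map C (X i) (Y i))))
        (sset_Pi I (\<lambda>i. Map C (X i) (Z i)))
        (\<lambda>n (g, f). \<lambda>i\<in>I. comp C (X i) (Y i) (Z i) n (g i) (f i))"
      unfolding sset_map_def using o[OF XYZ(1)] o[OF XYZ(2)] o[OF XYZ(3)]
      by (auto simp: sset_prod_def sset_Pi_simps PiE_iff comp_in comp_act intro!: restrict_ext)
  next
    fix X Y n f assume XY: "X \<in> PiE I (\<lambda>_. obj C)" "Y \<in> PiE I (\<lambda>_. obj C)"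
      "f \<in> simp (sset_Pi I (\<lambda>i. Map C (X i) (Y i))) n"
    show "(\<lambda>i\<in>I. comp C (X i) (X i) (Y i) n (f i)
        (const_simp (sset_Pi I (\<lambda>i. Map C (X i) (X i))) n (\<lambda>i\<in>I. ident C (X i)) i)) = f"
      "(\<lambda>i\<in>I. comp C (X i) (Y i) (Y i) n
        (const_simp (sset_Pi I (\<lambda>i. Map C (Y i) (Y i))) n (\<lambda>i\<in>I. ident C (Y i)) i) (f i)) = f"
      using o[OF XY(1)] o[OF XY(2)] XY(3)
      by (auto simp: sset_Pi_simps PiE_iff comp_ident extensional_def restrict_def fun_eq_iff)
  next
    fix X Y Z W n f g h
    assume XYZ: "X \<in> PiE I (\<lambda>_. obj C)" "Y \<in> PiE I (\<lambda>_. obj C)" "Z \<in> PiE I (\<lambda>_. obj C)"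
      "W \<in> PiE I (\<lambda>_. obj C)"
      and fgh: "f \<in> simp (sset_Pi I (\<lambda>i. Map C (X i) (Y i))) n" "g \<in> simp (sset_Pi I (\<lambda>i. Map C (Y i) (Z i))) n"
      "h \<in> simp (sset_Pi I (\<lambda>i. Map C (Z i) (W i))) n"
    show "(\<lambda>i\<in>I. comp C (X i) (Z i) (W i) n (h i) ((\<lambda>i\<in>I. comp C (X i) (Y i) (Z i) n (g i) (f i)) i)) =
      (\<lambda>i\<in>I. comp C (X i) (Y i) (W i) n ((\<lambda>i\<in>I. comp C (Y i) (Z i) (W i) n (h i) (g i)) i) (f i))"
      by (rule restrict_ext)
        (use fgh o[OF XYZ(1)] o[OF XYZ(2)] o[OF XYZ(3)] o[OF XYZ(4)] in
          \<open>auto simp: sset_Pi_simps PiE_iff comp_assoc\<close>)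
  qed
qed

lemma (in kan_enriched) product_section:
  assumes prod: "kan_product (kan_power I C) X (subset_object I zero one B) P p q"
    and X: "X \<in> obj (kan_power I C)" and B: "B \<subseteq> I" "i \<in> B"
    and obj: "zero \<in> obj C" and final: "kan_final C one"
  shows "\<exists>u\<in>simp (Map C (X i) (P i)) 0.
    same_path_component (Map C (X i) (X i)) (comp C (X i) (P i) (X i) 0 (p i) u) (ident C (X i))"
proof -
  let ?D = "kan_power I C" and ?V = "subset_object I zero one B"
  interpret D: kan_enriched ?D by (rule kan_enriched_power)
  have one: "one \<in> obj C" "\<And>Z. Z \<in> obj C \<Longrightarrow> simp (Map C Z one) 0 \<noteq> {}"
    using final contractible_path(1)[OF sset_Map] by (auto simp: kan_final_def)
  have P: "P \<in> obj ?D" "p \<in> simp (Map ?D P X) 0" "q \<in> simp (Map ?D P ?V) 0"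
    using prod by (auto simp: kan_product_def)
  have V: "?V \<in> obj ?D" using one obj by (auto simp: subset_object_def kan_power_simps)
  \<comment> \<open>The test object agrees with \<open>X\<close> over \<open>B\<close>, where a
    section is wanted. At the other indices no map from \<open>X\<close> to \<open>P\<close> is at
    hand, and the product cone itself completes the cone \<open>h\<close>, \<open>k\<close>.\<close>
  define Z where "Z = (\<lambda>j\<in>I. if j \<in> B then X j else P j)"
  have Z: "Z \<in> obj ?D" using X P by (auto simp: Z_def kan_power_simps PiE_iff)
  define h where "h = (\<lambda>j\<in>I. if j \<in> B then ident C (X j) else p j)"
  define k where "k = (\<lambda>j\<in>I. if j \<in> B then (SOME k. k \<in> simp (Map C (X j) one) 0) else q j)"
  have h: "h \<in> simp (Map ?D Z X) 0"
    using P X ident_in by (auto simp: h_def Z_def kan_power_simps sset_Pi_simps PiE_iff)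
  have "(SOME k. k \<in> simp (Map C (X j) one) 0) \<in> simp (Map C (X j) one) 0" if "j \<in> I" for j
    using one(2)[of "X j"] that X by (auto simp: kan_power_simps PiE_iff some_in_eq)
  then have k: "k \<in> simp (Map ?D Z ?V) 0"
    using P X by (auto simp: k_def Z_def kan_power_simps sset_Pi_simps PiE_iff subset_object_def)
  let ?T = "sset_prod (Map ?D Z X) (Map ?D Z ?V)"
  have "homotopy_equivalence (Map ?D Z P) ?T
      (\<lambda>n u. (kan_postcomp ?D Z P X p n u, kan_postcomp ?D Z P ?V q n u))"
    using prod Z by (simp add: kan_product_def)
  then obtain g where g: "sset_map ?T (Map ?D Z P) g"
    "homotopic ?T ?T (\<lambda>n y. (kan_postcomp ?D Z P X p n (g n y), kan_postcomp ?D Z P ?V q n (g n y))) (\<lambda>n y. y)"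
    by (auto simp: homotopy_equivalence_def)
  have hk: "(h, k) \<in> simp ?T 0" using h k by (simp add: sset_prod_def)
  have "sset ?T" by (rule sset_prod[OF D.sset_Map[OF Z X] D.sset_Map[OF Z V]])
  \<comment> \<open>The homotopy inverse sends the cone to a map into \<open>P\<close>, and the
    homotopy at this vertex joins its composites with \<open>p\<close> and \<open>q\<close> to
    \<open>h\<close> and \<open>k\<close>.\<close>
  from homotopic_edge[OF this g(2) hk] obtain e where
    e: "e \<in> edges ?T (kan_postcomp ?D Z P X p 0 (g 0 (h, k)), kan_postcomp ?D Z P ?V q 0 (g 0 (h, k))) (h, k)"
    by blast
  define u where "u = g 0 (h, k)"
  have u: "u \<in> simp (Map ?D Z P) 0" unfolding u_def by (rule sset_map_in[OF g(1) hk])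
  have "sset_map ?T (Map ?D Z X) (\<lambda>n. fst)" by (auto simp: sset_map_def sset_prod_def)
  from sset_map_edges[OF this e] have "fst e \<in> edges (Map ?D Z X) (comp ?D Z P X 0 p u) h"
    using P X by (simp add: D.postcomp_0 u_def)
  then have "same_path_component (Map ?D Z X) (comp ?D Z P X 0 p u) h"
    by (rule same_path_component_edge[OF D.sset_Map[OF Z X]])
  then have "same_path_component (Map C (Z i) (X i)) (comp ?D Z P X 0 p u i) (h i)"
    unfolding kan_power_simps(2) by (rule same_path_component_Pi) (use B in blast)
  moreover have "u i \<in> simp (Map C (Z i) (P i)) 0"
    using u B by (simp add: kan_power_simps sset_Pi_simps PiE_iff subset_iff)
  moreover have "i \<in> I" "Z i = X i" "h i = ident C (X i)"
    using B by (auto simp: Z_def h_def)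
  ultimately show ?thesis
    by (intro bexI[of _ "u i"]) (simp_all add: kan_power_simps(3))
qed

text \<open>A path at the stage of \<open>B\<close> shows that \<open>B\<close> is contained in the
  set of good indices, which is then in the filter as well; conversely that set itself serves as the
  stage.\<close>

theorem kan_filter_quotient_eq_iff:
  fixes C :: "('o, 'm) enriched" and I :: "'i set"
  assumes filter: "product_closed_filter I \<Phi>" and C: "kan_enriched_category C"
    and final: "kan_final C one" and initial: "kan_strict_initial C zero"
    and sys: "kan_product_system (kan_power I C) (subset_filter I zero one \<Phi>) pr p tr"
    and XY: "X \<in> obj (kan_power I C)" "Y \<in> obj (kan_power I C)"
    and fg: "f \<in> simp (Map (kan_power I C) X Y) 0" "g \<in> simp (Map (kan_power I C) X Y) 0"
  defines "P \<equiv> kan_quotient_functor (kan_power I C) (subset_filter I zero one \<Phi>) pr p tr (subset_object I zero one I)"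
  shows "same_path_component (kan_quotient_Map (kan_power I C) (subset_filter I zero one \<Phi>) pr tr X Y)
      (P X Y 0 f) (P X Y 0 g) \<longleftrightarrow>
    {i \<in> I. same_path_component (Map C (X i) (Y i)) (f i) (g i)} \<in> \<Phi>"
proof -
  interpret kan_enriched C by unfold_locales (rule C)
  let ?D = "kan_power I C" and ?F = "subset_filter I zero one \<Phi>" and ?V = "subset_object I zero one"
  interpret D: kan_enriched ?D by (rule kan_enriched_power)
  have obj: "zero \<in> obj C" "one \<in> obj C"
    using final initial by (auto simp: kan_final_def kan_strict_initial_def)
  have le_one: "kan_le C Z one" if "Z \<in> obj C" for Z
    using that final contractible_path(1)[OF sset_Map[OF that obj(2)]] by (simp add: kan_final_def kan_le_def)
  have le: "kan_le ?D U V \<longleftrightarrow> (\<forall>i\<in>I. kan_le C (U i) (V i))" for U V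
    unfolding kan_le_def kan_power_simps sset_Pi_simps by (simp add: PiE_eq_empty_iff)
  have le00: "kan_le C zero zero" using ident_in[OF obj(1)] by (auto simp: kan_le_def)
  note dir = subset_filter_directed[OF filter le00 le_one[OF obj(1)] le_one[OF obj(2)] le]
  interpret F: directed_index ?F "kan_le ?D" by (rule dir(1))
  have prod: "\<exists>q. kan_product ?D X V (pr X V) (p X V) q" and tr_refl: "tr X V V = ident ?D (pr X V)"
    if "V \<in> ?F" for V
    using sys XY(1) that unfolding kan_product_system_def by blast+
  have tr: "tr X V U \<in> simp (Map ?D (pr X U) (pr X V)) 0"
    "comp ?D (pr X U) (pr X V) X 0 (p X V) (tr X V U) = p X U"
    if "V \<in> ?F" "U \<in> ?F" "kan_le ?D U V" for U V
    using sys XY(1) that unfolding kan_product_system_def by blast+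
  have tr_trans: "comp ?D (pr X W) (pr X U) (pr X V) 0 (tr X V U) (tr X U W) = tr X V W"
    if "V \<in> ?F" "U \<in> ?F" "W \<in> ?F" "kan_le ?D U V" "kan_le ?D W U" for U V W
    using sys XY(1) that unfolding kan_product_system_def by blast
  have pr: "pr X V \<in> obj ?D" "p X V \<in> simp (Map ?D (pr X V) X) 0" if "V \<in> ?F" for V
    using prod[OF that] by (auto simp: kan_product_def)
  let ?E = "\<lambda>V. Map ?D (pr X V) Y" and ?t = "\<lambda>V U. kan_precomp ?D (pr X U) (pr X V) Y (tr X V U)"
  interpret S: sset_system ?F "kan_le ?D" ?E ?t
  proof
    fix V assume V: "V \<in> ?F"
    show "simplicial_set (?E V)" using sset.simplicial[OF D.sset_Map] pr V XY by blast
    fix x n assume "x \<in> simp (?E V) n"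
    then show "?t V V n x = x" using V XY(2) pr by (simp add: kan_precomp_def tr_refl D.comp_ident)
  next
    fix V W assume "V \<in> ?F" "W \<in> ?F" "kan_le ?D W V"
    then show "sset_map (?E V) (?E W) (?t V W)" using XY(2) pr tr by (intro D.precomp_map)
  next
    fix U V W x n
    assume *: "U \<in> ?F" "V \<in> ?F" "W \<in> ?F" "kan_le ?D V U" "kan_le ?D W V" "x \<in> simp (?E U) n"
    note c = sset.const_simp_in[OF D.sset_Map]
    show "?t V W n (?t U V n x) = ?t U W n x"
      using * tr_trans[OF *(1-5)] tr[OF *(1,2,4)] tr[OF *(2,3,5)] pr XY(2)
      by (simp add: kan_precomp_def D.comp_assoc c D.comp_const)
  qed
  let ?one = "?V I"
  have one: "?one \<in> ?F" by (rule dir(2))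
  \<comment> \<open>The canonical functor represents \<open>f\<close> at the top stage by its
    composite with the projection. Transition maps commute with the projections, so at the stage
    \<open>W\<close> the representative is the composite of \<open>f\<close> with
    \<open>p X W\<close>.\<close>
  have stage: "same_path_component (kan_quotient_Map ?D ?F pr tr X Y) (P X Y 0 f) (P X Y 0 g) \<longleftrightarrow>
    (\<exists>W\<in>?F. same_path_component (?E W) (comp ?D (pr X W) X Y 0 f (p X W)) (comp ?D (pr X W) X Y 0 g (p X W)))"
  proof -
    have P: "P X Y 0 h = colim_class ?F (kan_le ?D) ?E ?t ?one 0 (comp ?D (pr X ?one) X Y 0 h (p X ?one))" for h
      using pr[OF one] XY by (simp add: P_def kan_quotient_functor_def D.precomp_0)
    have "comp ?D (pr X ?one) X Y 0 h (p X ?one) \<in> simp (?E ?one) 0"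
      if "h \<in> simp (Map ?D X Y) 0" for h
      using that pr[OF one] XY by (simp add: D.comp_in)
    moreover have "?t ?one W 0 (comp ?D (pr X ?one) X Y 0 h (p X ?one)) = comp ?D (pr X W) X Y 0 h (p X W)"
      if "h \<in> simp (Map ?D X Y) 0" "W \<in> ?F" for h W
      using that pr[OF one] pr[OF that(2)] XY tr[OF one that(2) dir(3)[OF that(2)]]
      by (simp add: D.precomp_0 D.comp_assoc)
    ultimately show ?thesis
      unfolding kan_quotient_Map_def P
      using S.same_path_component_colim[OF one] fg dir(3) by auto
  qed
  let ?A = "{i \<in> I. same_path_component (Map C (X i) (Y i)) (f i) (g i)}"
  have coord: "X i \<in> obj C" "Y i \<in> obj C" "f i \<in> simp (Map C (X i) (Y i)) 0" "g i \<in> simp (Map C (X i) (Y i)) 0"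
    if "i \<in> I" for i
    using XY fg that by (auto simp: kan_power_simps sset_Pi_simps PiE_iff)
  have prc: "pr X V i \<in> obj C" "p X V i \<in> simp (Map C (pr X V i) (X i)) 0" if "i \<in> I" "V \<in> ?F" for i V
    using pr[OF that(2)] that(1) by (auto simp: kan_power_simps sset_Pi_simps PiE_iff)
  show ?thesis unfolding stage
  proof
    assume "\<exists>W\<in>?F. same_path_component (?E W) (comp ?D (pr X W) X Y 0 f (p X W)) (comp ?D (pr X W) X Y 0 g (p X W))"
    then obtain B where B: "B \<in> \<Phi>"
      and path: "same_path_component (?E (?V B)) (comp ?D (pr X (?V B)) X Y 0 f (p X (?V B)))
        (comp ?D (pr X (?V B)) X Y 0 g (p X (?V B)))"
      by (auto simp: subset_filter_def)
    have F: "?V B \<in> ?F" and BI: "B \<subseteq> I"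
      using B filter by (auto simp: subset_filter_def product_closed_filter_def)
    have "B \<subseteq> ?A"
    proof
      fix i assume i: "i \<in> B"
      then have iI: "i \<in> I" using BI by blast
      obtain q where "kan_product ?D X (?V B) (pr X (?V B)) (p X (?V B)) q" using prod[OF F] by blast
      from product_section[OF this XY(1) BI i obj(1) final] obtain u where
        u: "u \<in> simp (Map C (X i) (pr X (?V B) i)) 0"
          "same_path_component (Map C (X i) (X i))
            (comp C (X i) (pr X (?V B) i) (X i) 0 (p X (?V B) i) u) (ident C (X i))" by blast
      have "same_path_component (Map C (pr X (?V B) i) (Y i))
          (comp C (pr X (?V B) i) (X i) (Y i) 0 (f i) (p X (?V B) i))
          (comp C (pr X (?V B) i) (X i) (Y i) 0 (g i) (p X (?V B) i))"
        using same_path_component_Pi[OF path[unfolded kan_power_simps(2)] iI] iI by (simp add: kan_power_simps)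
      then have "same_path_component (Map C (X i) (Y i)) (f i) (g i)"
        using same_path_component_section[OF coord(1,2) prc(1) coord(3,4) prc(2) u] iI F by blast
      then show "i \<in> ?A" using iI by simp
    qed
    then show "?A \<in> \<Phi>" using upward_closed_filter_iff[OF filter, of ?A] B by auto
  next
    assume A: "?A \<in> \<Phi>"
    let ?U = "?V ?A"
    have F: "?U \<in> ?F" using A by (auto simp: subset_filter_def)
    have in_E: "comp ?D (pr X ?U) X Y 0 h (p X ?U) \<in> simp (?E ?U) 0" if "h \<in> simp (Map ?D X Y) 0" for h
      using that pr[OF F] XY by (simp add: D.comp_in)
    \<comment> \<open>Paths at the single indices assemble because the factors are Kan complexes: at
      good indices precompose with the projection, at the others the source is initial.\<close>
    have "same_path_component (?E ?U) (comp ?D (pr X ?U) X Y 0 f (p X ?U)) (comp ?D (pr X ?U) X Y 0 g (p X ?U))"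
      unfolding kan_power_simps(2)
    proof (rule kan_same_path_component_Pi)
      fix i assume i: "i \<in> I"
      show "kan_complex (Map C (pr X ?U i) (Y i))" using kan_Map prc F i coord by blast
      show "same_path_component (Map C (pr X ?U i) (Y i)) (comp ?D (pr X ?U) X Y 0 f (p X ?U) i)
          (comp ?D (pr X ?U) X Y 0 g (p X ?U) i)"
      proof (cases "i \<in> ?A")
        case True
        then show ?thesis
          using same_path_component_precomp[OF prc(1)[OF i F] coord(1,2)[OF i] prc(2)[OF i F]] i
          by (simp add: kan_power_simps)
      next
        case False
        obtain q where "kan_product ?D X ?U (pr X ?U) (p X ?U) q" using prod[OF F] by blast
        \<comment> \<open>The other projection maps the product to \<open>zero\<close> at this
          index, and strictness of \<open>zero\<close> makes the source of that map initial.\<close>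
        then have "q \<in> simp (Map ?D (pr X ?U) ?U) 0" by (simp add: kan_product_def)
        then have "q i \<in> simp (Map C (pr X ?U i) (?U i)) 0"
          unfolding kan_power_simps(2) sset_Pi_simps(1) by (rule PiE_mem[OF _ i])
        moreover have "?U i = zero" using i False by (simp add: subset_object_def)
        ultimately have "kan_initial C (pr X ?U i)"
          using initial prc(1)[OF i F] by (auto simp: kan_strict_initial_def kan_le_def)
        then have "contractible (Map C (pr X ?U i) (Y i))" using coord(2)[OF i] by (simp add: kan_initial_def)
        from contractible_path(2)[OF sset_Map[OF prc(1)[OF i F] coord(2)[OF i]] this] show ?thesis
          using i comp_in[OF prc(1)[OF i F] coord(1,2)[OF i] _ prc(2)[OF i F]] coord(3,4)[OF i]
          by (simp add: kan_power_simps)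
      qed
    qed (use in_E[OF fg(1)] in_E[OF fg(2)] in \<open>simp_all add: kan_power_simps(2)\<close>)
    then show "\<exists>W\<in>?F. same_path_component (?E W) (comp ?D (pr X W) X Y 0 f (p X W)) (comp ?D (pr X W) X Y 0 g (p X W))"
      using F by blast
  qed
qed

section \<open>Slices and the functors \<open>- \<times> V\<close>\<close>

lemma sset_slice:
  assumes "sset X" shows "sset (qc_slice X v)"
proof
  interpret sset X by fact
  have o: "join_id m n \<alpha> \<in> ord_maps (m + 1) (n + 1)" if "\<alpha> \<in> ord_maps m n" for m n \<alpha>
    using join_id_ord_maps[OF that] by simp
  show "simplicial_set (qc_slice X v)"
    unfolding simplicial_set_def
  proof (intro conjI allI ballI impI)
    fix m n \<alpha> s assume *: "\<alpha> \<in> ord_maps m n" "s \<in> simp (qc_slice X v) n"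
    then have s: "s \<in> simp X (n + 1)" "vertex X (n + 1) (n + 1) s = v" by (simp_all add: qc_slice_def)
    have "vertex X (m + 1) (m + 1) (act X (m + 1) (n + 1) (join_id m n \<alpha>) s) = vertex X (n + 1) (n + 1) s"
      unfolding vertex_def
      by (rule act_act_cong[OF _ o[OF *(1)] s(1)]) (simp_all add: const_ord_maps join_id_def)
    then show "act (qc_slice X v) m n \<alpha> s \<in> simp (qc_slice X v) m"
      using act_in[OF o[OF *(1)] s(1)] s(2) by (simp add: qc_slice_def)
    fix \<beta> assume "\<forall>i\<le>m. \<alpha> i = \<beta> i"
    then show "act (qc_slice X v) m n \<alpha> s = act (qc_slice X v) m n \<beta> s"
      unfolding qc_slice_def sset.select_convs
      by (intro act_cong[OF o[OF *(1)] s(1)]) (simp add: join_id_def)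
  next
    fix n s assume "s \<in> simp (qc_slice X v) n"
    then show "act (qc_slice X v) n n id s = s"
      unfolding qc_slice_def sset.select_convs
      by (intro act_id_on) (auto simp: join_id_def)
  next
    fix l m n \<beta> \<alpha> s
    assume *: "\<beta> \<in> ord_maps l m" "\<alpha> \<in> ord_maps m n" "s \<in> simp (qc_slice X v) n"
    then have s: "s \<in> simp X (n + 1)" by (simp add: qc_slice_def)
    show "act (qc_slice X v) l m \<beta> (act (qc_slice X v) m n \<alpha> s) = act (qc_slice X v) l n (\<alpha> \<circ> \<beta>) s"
      unfolding qc_slice_def sset.select_convs
      by (rule act_act_cong[OF o[OF *(1)] o[OF *(2)] s])
        (use *(1) in \<open>auto simp: join_id_def ord_maps_def\<close>)
  qed
qed

lemma forget_map:
  assumes "sset X" shows "sset_map (qc_slice X v) X (qc_forget X)"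
  unfolding sset_map_def
proof (intro conjI allI ballI)
  interpret sset X by fact
  fix n s assume "s \<in> simp (qc_slice X v) n"
  then have s: "s \<in> simp X (n + 1)" by (simp add: qc_slice_def)
  then show "qc_forget X n s \<in> simp X n" using face_in[of s n] by (simp add: qc_forget_def)
  fix m \<alpha> assume \<alpha>: "\<alpha> \<in> ord_maps m n"
  have "act X m (m + 1) (coface (m + 1)) (act X (m + 1) (n + 1) (join_id m n \<alpha>) s) =
    act X m n \<alpha> (act X n (n + 1) (coface (n + 1)) s)"
    by (rule act_act_eq)
      (use s \<alpha> join_id_ord_maps[OF \<alpha>] coface_ord_maps[of _ m] coface_ord_maps[of _ n] in
        \<open>auto simp: coface_def join_id_def ord_maps_def\<close>)
  then show "qc_forget X m (act (qc_slice X v) m n \<alpha> s) = act X m n \<alpha> (qc_forget X n s)"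
    by (simp add: qc_forget_def face_def qc_slice_def)
qed

lemma sset_slice_pair:
  assumes "sset X" shows "sset (qc_slice_pair X u v)"
proof (rule sub_sset)
  let ?S = "sset_prod (qc_slice X u) (qc_slice X v)"
  show S: "sset ?S" by (intro sset_prod sset_slice assms)
  show "act (qc_slice_pair X u v) = act ?S" by (simp add: qc_slice_pair_def sset_prod_def fun_eq_iff)
  show "simp (qc_slice_pair X u v) n \<subseteq> simp ?S n" for n by (auto simp: qc_slice_pair_def sset_prod_def)
  fix m n \<alpha> p assume *: "\<alpha> \<in> ord_maps m n" "p \<in> simp (qc_slice_pair X u v) n"
  then show "act ?S m n \<alpha> p \<in> simp (qc_slice_pair X u v) m"
    using sset.act_in[OF sset_slice[OF assms] *(1)]
      sset_map_act[OF forget_map[OF assms, of u] *(1)] sset_map_act[OF forget_map[OF assms, of v] *(1)]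
    by (auto simp: qc_slice_pair_def sset_prod_def)
qed

lemma simp_slice_0: "x \<in> simp (qc_slice X v) 0 \<longleftrightarrow> x \<in> simp X 1 \<and> vertex X 1 1 x = v"
  by (simp add: qc_slice_def)

lemma (in sset) forget_0: "x \<in> simp X 1 \<Longrightarrow> qc_forget X 0 x = vertex X 1 0 x"
  by (simp add: qc_forget_def face_1[simplified])

text \<open>A 1-simplex of the slice is a triangle ending in \<open>v\<close>. Passing to a vertex
  of the slice keeps the last vertex of the triangle, so source and target are its edges 02 and
  12.\<close>

lemma (in sset) vertex_slice:
  assumes "w \<in> simp X 2"
  shows "vertex (qc_slice X v) 1 0 w = face X 2 1 w" "vertex (qc_slice X v) 1 1 w = face X 2 0 w"
proof -
  have o: "join_id 0 1 (\<lambda>_. i) \<in> ord_maps 1 2" if "i \<le> 1" for i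
    using join_id_ord_maps[OF const_ord_maps[OF that, of 0]] by (simp add: numeral_2_eq_2)
  show "vertex (qc_slice X v) 1 0 w = face X 2 1 w" "vertex (qc_slice X v) 1 1 w = face X 2 0 w"
    unfolding vertex_def face_def qc_slice_def
    using act_cong[OF o assms, of 0 "coface 1"] act_cong[OF o assms, of 1 "coface 0"]
    by (auto simp: join_id_def coface_def numeral_2_eq_2 le_Suc_eq)
qed

lemma (in sset) edges_slice_iff:
  "w \<in> edges (qc_slice X v) x y \<longleftrightarrow> w \<in> simp X 2 \<and> vertex X 1 1 y = v \<and> face X 2 1 w = x \<and> face X 2 0 w = y"
  using vertex_slice[of w v] vertex_face_2[of w 1 0]
  by (auto simp: edges_def qc_slice_def coface_def numeral_2_eq_2)

text \<open>A map of cones is a pair of triangles over the same edge between the apexes.\<close>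

lemma (in sset) edges_slice_pair_iff:
  "(w, w') \<in> edges (qc_slice_pair X u v) (k, x) (l, y) \<longleftrightarrow>
    w \<in> edges (qc_slice X u) k l \<and> w' \<in> edges (qc_slice X v) x y \<and> face X 2 2 w = face X 2 2 w'"
  by (auto simp: edges_def qc_slice_pair_def vertex_def qc_forget_def numeral_2_eq_2)

lemma simp_slice_pair_0:
  assumes "sset X"
  shows "(k, x) \<in> simp (qc_slice_pair X u v) 0 \<longleftrightarrow>
    k \<in> simp X 1 \<and> vertex X 1 1 k = u \<and> x \<in> simp X 1 \<and> vertex X 1 1 x = v \<and> vertex X 1 0 k = vertex X 1 0 x"
  using sset.forget_0[OF assms] by (auto simp: qc_slice_pair_def simp_slice_0)

text \<open>The functor \<open>- \<times> V\<close> on the slice over the final object \<open>u\<close>, restricted along the section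
  \<open>\<sigma>\<close>, and the projection \<open>\<eta>\<close> from it to the identity.\<close>

locale times_stage = D: sset D for D :: "'a sset" +
  fixes u v :: 'a and \<sigma> T :: "nat \<Rightarrow> 'a \<Rightarrow> 'a" and \<eta> :: "nat \<Rightarrow> 'a \<times> (nat \<Rightarrow> nat) \<Rightarrow> 'a"
  assumes \<sigma>: "sset_map D (qc_slice D u) \<sigma>" "x \<in> simp D n \<Longrightarrow> qc_forget D n (\<sigma> n x) = x"
    and T: "sset_map (qc_slice D u) (qc_slice D v) T"
    and \<eta>: "sset_map (sset_prod (qc_slice D u) (std_simplex 1)) D \<eta>"
      "s \<in> simp (qc_slice D u) n \<Longrightarrow> \<eta> n (s, std_const 0 n) = qc_forget D n (T n s)"
      "s \<in> simp (qc_slice D u) n \<Longrightarrow> \<eta> n (s, std_const 1 n) = qc_forget D n s"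
begin

text \<open>The structure map to \<open>v\<close> of the product of \<open>x\<close> and
  \<open>v\<close>. Below, \<open>map_at f\<close> is the triangle over \<open>v\<close> given by
  the product map of \<open>f\<close>, \<open>proj_at x\<close> is the projection to
  \<open>x\<close>, and \<open>diag_at f\<close> is the diagonal of the naturality square of the
  projection at \<open>f\<close>.\<close>

definition obj_at :: "'a \<Rightarrow> 'a" where "obj_at x = T 0 (\<sigma> 0 x)"
definition map_at :: "'a \<Rightarrow> 'a" where "map_at f = T 1 (\<sigma> 1 f)"
definition proj_at :: "'a \<Rightarrow> 'a" where "proj_at x = \<eta> 1 (const_simp (qc_slice D u) 1 (\<sigma> 0 x), iota)"
definition diag_at :: "'a \<Rightarrow> 'a" where "diag_at f = \<eta> 1 (\<sigma> 1 f, iota)"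

lemma map_at_edge: "f \<in> edges D x y \<Longrightarrow> map_at f \<in> edges (qc_slice D v) (obj_at x) (obj_at y)"
  unfolding map_at_def obj_at_def by (intro sset_map_edges[OF T] sset_map_edges[OF \<sigma>(1)])

lemma obj_at_in: "x \<in> simp D 0 \<Longrightarrow> obj_at x \<in> simp (qc_slice D v) 0"
  unfolding obj_at_def by (intro sset_map_in[OF T] sset_map_in[OF \<sigma>(1)])

lemma proj_at_edge: 
  assumes "x \<in> simp D 0" shows "proj_at x \<in> edges D (vertex D 1 0 (obj_at x)) x"
proof -
  have s: "\<sigma> 0 x \<in> simp (qc_slice D u) 0" by (rule sset_map_in[OF \<sigma>(1) assms])
  then have "T 0 (\<sigma> 0 x) \<in> simp D 1" using obj_at_in[OF assms] by (simp add: obj_at_def simp_slice_0)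
  then show ?thesis
    using homotopy_edge[OF sset_slice[OF D.sset_axioms] \<eta>(1) s]
    unfolding proj_at_def obj_at_def \<eta>(2,3)[OF s] \<sigma>(2)[OF assms] by (simp only: D.forget_0)
qed

text \<open>Naturality of the projection, as the two triangles of a prism;
  \<open>face D 2 2 (map_at f)\<close> is the product map without its structure maps to
  \<open>v\<close>.\<close>

lemma map_at_tri:
  assumes "f \<in> edges D x y"
  shows "tri D (proj_at x) f (diag_at f)" "tri D (face D 2 2 (map_at f)) (proj_at y) (diag_at f)"
proof -
  have f: "f \<in> simp D 1" using assms by (simp add: edges_def)
  have s: "\<sigma> 1 f \<in> simp (qc_slice D u) 1" by (rule sset_map_in[OF \<sigma>(1) f])
  have "qc_forget D 1 (T 1 (\<sigma> 1 f)) = face D 2 2 (map_at f)"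
    by (simp add: qc_forget_def map_at_def numeral_2_eq_2)
  with prism[OF sset_slice[OF D.sset_axioms] \<eta>(1) sset_map_edges[OF \<sigma>(1) assms]]
  show "tri D (proj_at x) f (diag_at f)" "tri D (face D 2 2 (map_at f)) (proj_at y) (diag_at f)"
    unfolding proj_at_def diag_at_def \<eta>(2,3)[OF s] \<sigma>(2)[OF f] by simp_all
qed

end

text \<open>\<open>C\<close> enters only through its triangles, so that the locale can be
  interpreted for a quasi-category and for the zeroth row of a complete Segal space. Finality and
  initiality, whose formulations differ, become hypotheses of the lemmas about existence and
  uniqueness of edges.\<close>

locale power_stage = C: tri_calculus C + times_stage "qc_power I C" "subset_object I zero one I" "subset_object I zero one B" \<sigma> T \<eta>
  for C :: "'a sset" and I :: "'i set" and zero one :: 'a and B :: "'i set" and \<sigma> T \<eta> +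
  assumes B: "B \<subseteq> I" and one: "one \<in> simp C 0"
begin

abbreviation "V \<equiv> subset_object I zero one B"

lemma qc_power_simps:
  "simp (qc_power I C) n = PiE I (\<lambda>i. simp C n)"
  "face (qc_power I C) n k x = (\<lambda>i\<in>I. face C n k (x i))"
  "vertex (qc_power I C) n k x = (\<lambda>i\<in>I. vertex C n k (x i))"
  by (simp_all add: qc_power_def sset_Pi_simps)

lemma tri_power: "tri (qc_power I C) a b c \<Longrightarrow> i \<in> I \<Longrightarrow> tri C (a i) (b i) (c i)"
  unfolding qc_power_def by (rule sset_map_tri[OF proj_map])

lemma edges_power: "e \<in> edges (qc_power I C) x y \<Longrightarrow> i \<in> I \<Longrightarrow> e i \<in> edges C (x i) (y i)"
  unfolding qc_power_def by (rule sset_map_edges[OF proj_map])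

lemma obj_at_edge:
  assumes "x \<in> simp (qc_power I C) 0" "i \<in> I"
  shows "obj_at x i \<in> edges C (vertex C 1 0 (obj_at x i)) (V i)"
proof -
  have o: "obj_at x \<in> simp (qc_power I C) 1" and v: "vertex (qc_power I C) 1 1 (obj_at x) = V"
    using obj_at_in[OF assms(1)] by (simp_all add: simp_slice_0)
  show ?thesis
    using o fun_cong[OF v, unfolded qc_power_simps, of i] assms(2) by (auto simp: qc_power_simps edges_def)
qed

text \<open>A section of the projection is obtained by comparing the product cone with the cone given by
  the identity over the coordinates in \<open>B\<close>.\<close>

lemma proj_section:
  assumes ex: "\<And>p. p \<in> simp (qc_slice_pair (qc_power I C) x V) 0 \<Longrightarrow>
      edges (qc_slice_pair (qc_power I C) x V) p (proj_at x, obj_at x) \<noteq> {}"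
    and final: "\<And>z. z \<in> simp C 0 \<Longrightarrow> edges C z one \<noteq> {}"
    and x: "x \<in> simp (qc_power I C) 0" and i: "i \<in> B"
  shows "\<exists>s. tri C s (proj_at x i) (const_simp C 1 (x i))"
proof -
  let ?D = "qc_power I C"
  let ?e = "\<lambda>j. SOME e. e \<in> edges C (x j) one"
  \<comment> \<open>The legs of the test cone. Over \<open>B\<close> the apex is \<open>x\<close>,
    with any map to \<open>one\<close>; elsewhere the legs are those of the product cone, so that a
    cone results at every index.\<close>
  define k where "k = (\<lambda>j\<in>I. if j \<in> B then const_simp C 1 (x j) else proj_at x j)"
  define l where "l = (\<lambda>j\<in>I. if j \<in> B then ?e j else obj_at x j)"
  have xj: "x j \<in> simp C 0" if "j \<in> I" for j using x that by (auto simp: qc_power_simps)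
  have e: "?e j \<in> edges C (x j) one" if "j \<in> I" for j
    using final[OF xj[OF that]] by (simp add: some_in_eq)
  note obj = obj_at_edge[OF x]
  have proj: "proj_at x j \<in> edges C (vertex C 1 0 (obj_at x j)) (x j)" if "j \<in> I" for j
    using edges_power[OF proj_at_edge[OF x] that] that by (simp add: qc_power_simps)
  have kj: "k j \<in> simp C 1" "vertex C 1 1 (k j) = x j" "l j \<in> simp C 1" "vertex C 1 1 (l j) = V j"
    "vertex C 1 0 (k j) = vertex C 1 0 (l j)" if "j \<in> I" for j
    using that e[OF that] C.const_simp_edge[OF xj[OF that]] proj[OF that] obj[OF that] i
    by (auto simp: k_def l_def edges_def subset_object_def)
  have "(k, l) \<in> simp (qc_slice_pair ?D x V) 0"
    unfolding simp_slice_pair_0[OF D.sset_axioms] qc_power_simps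
    using kj x by (auto simp: k_def l_def qc_power_simps PiE_iff subset_object_def fun_eq_iff extensional_def restrict_def)
  from ex[OF this] obtain w w' where "(w, w') \<in> edges (qc_slice_pair ?D x V) (k, l) (proj_at x, obj_at x)"
    by auto
  \<comment> \<open>The first component of the map of cones is a triangle that factors
    \<open>k\<close> through the projection. Over \<open>B\<close> the leg \<open>k\<close> is
    degenerate, so the base edge is a section there.\<close>
  then have "w \<in> simp ?D 2" "face ?D 2 1 w = k" "face ?D 2 0 w = proj_at x"
    by (auto simp: D.edges_slice_pair_iff D.edges_slice_iff)
  then have "tri ?D (face ?D 2 2 w) (proj_at x) k" by (auto simp: tri_def)
  from tri_power[OF this, of i] show ?thesis using B i by (auto simp: k_def subset_iff)
qed

lemma eqv_if_eqv_at:
  assumes ex: "\<And>p. p \<in> simp (qc_slice_pair (qc_power I C) x V) 0 \<Longrightarrow>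
      edges (qc_slice_pair (qc_power I C) x V) p (proj_at x, obj_at x) \<noteq> {}"
    and final: "\<And>z. z \<in> simp C 0 \<Longrightarrow> edges C z one \<noteq> {}"
    and x: "x \<in> simp (qc_power I C) 0" and i: "i \<in> B"
    and fg: "f \<in> edges (qc_power I C) x y" "g \<in> edges (qc_power I C) x y"
    and eqv: "C.eqv (face (qc_power I C) 2 2 (map_at f) i) (face (qc_power I C) 2 2 (map_at g) i)"
  shows "C.eqv (f i) (g i)"
proof -
  have iI: "i \<in> I" using B i by blast
  obtain s where s: "tri C s (proj_at x i) (const_simp C 1 (x i))"
    using proj_section[OF ex final x i] by blast
  show ?thesis
    by (rule C.eqv_descend[OF tri_power[OF map_at_tri(2)[OF fg(1)] iI] tri_power[OF map_at_tri(2)[OF fg(2)] iI] eqv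
      tri_power[OF map_at_tri(1)[OF fg(1)] iI] tri_power[OF map_at_tri(1)[OF fg(2)] iI] s
      edges_power[OF fg(1) iI] edges_power[OF fg(2) iI]])
qed

text \<open>The maps \<open>f \<times> V\<close> and \<open>g \<times> V\<close> over \<open>V\<close> have homotopic composites with the projection to
  \<open>y\<close>, so both of them represent a map from one and the same cone to the product cone.\<close>

lemma common_cone:
  assumes eqv: "\<And>i. i \<in> B \<Longrightarrow> C.eqv (f i) (g i)"
    and init: "\<And>i h h'. i \<in> I - B \<Longrightarrow> h \<in> edges C (vertex C 1 0 (obj_at x i)) (y i) \<Longrightarrow>
      h' \<in> edges C (vertex C 1 0 (obj_at x i)) (y i) \<Longrightarrow> C.eqv h h'"
    and fg: "f \<in> edges (qc_power I C) x y" "g \<in> edges (qc_power I C) x y"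
  shows "\<exists>w w'. (diag_at f, obj_at x) \<in> simp (qc_slice_pair (qc_power I C) y V) 0 \<and>
     (w, map_at f) \<in> edges (qc_slice_pair (qc_power I C) y V) (diag_at f, obj_at x) (proj_at y, obj_at y) \<and>
     (w', map_at g) \<in> edges (qc_slice_pair (qc_power I C) y V) (diag_at f, obj_at x) (proj_at y, obj_at y)"
proof -
  let ?D = "qc_power I C"
  let ?f = "face ?D 2 2 (map_at f)" and ?g = "face ?D 2 2 (map_at g)"
  have xy: "x \<in> simp ?D 0" "y \<in> simp ?D 0" using D.edges_vertices[OF fg(1)] by auto
  have diag: "diag_at h \<in> edges ?D (vertex ?D 1 0 (obj_at x)) y" if "h \<in> edges ?D x y" for h
    using map_at_tri(1)[OF that]
  proof (rule D.triE)
    fix a b c assume "proj_at x \<in> edges ?D a b" "h \<in> edges ?D b c" "diag_at h \<in> edges ?D a c"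
    then show ?thesis using proj_at_edge[OF xy(1)] that by (auto simp: edges_def)
  qed
  \<comment> \<open>Both maps must start at literally the same cone, so the composite of the product
    map of \<open>g\<close> with the projection is changed from \<open>diag_at g\<close> to
    \<open>diag_at f\<close>: over \<open>B\<close> by the homotopy of \<open>f\<close> and
    \<open>g\<close>, elsewhere by the assumption \<open>init\<close> on the apex.\<close>
  have "tri C (?g i) (proj_at y i) (diag_at f i)" if i: "i \<in> I" for i
  proof -
    have "C.eqv (diag_at g i) (diag_at f i)"
    proof (cases "i \<in> B")
      case True
      show ?thesis
        by (rule C.tri_unique[OF tri_power[OF map_at_tri(1)[OF fg(2)] i]
          C.tri_cong_middle[OF tri_power[OF map_at_tri(1)[OF fg(1)] i] eqv[OF True]]])
    next
      case False
      then show ?thesis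
        using i edges_power[OF diag[OF fg(1)] i] edges_power[OF diag[OF fg(2)] i]
        by (intro init) (simp_all add: qc_power_simps)
    qed
    then show ?thesis by (rule C.tri_cong_right[OF tri_power[OF map_at_tri(2)[OF fg(2)] i]])
  qed
  moreover have "?g \<in> simp ?D 1" "proj_at y \<in> simp ?D 1" "diag_at f \<in> simp ?D 1"
    using map_at_tri(2)[OF fg(2)] diag[OF fg(1)] by (auto elim!: D.triE simp: edges_def)
  ultimately have g: "tri ?D ?g (proj_at y) (diag_at f)"
    unfolding qc_power_def by (subst tri_Pi_iff) auto
  have proj: "vertex ?D 1 1 (proj_at y) = y" using proj_at_edge[OF xy(2)] by (simp add: edges_def)
  have "(w, map_at h) \<in> edges (qc_slice_pair ?D y V) (diag_at f, obj_at x) (proj_at y, obj_at y)"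
    if "h \<in> edges ?D x y" "w \<in> simp ?D 2" "face ?D 2 2 w = face ?D 2 2 (map_at h)" "face ?D 2 0 w = proj_at y"
      "face ?D 2 1 w = diag_at f" for h w
    using map_at_edge[OF that(1)] that(2-5) proj
    by (simp add: D.edges_slice_pair_iff D.edges_slice_iff)
  then obtain w w' where
    "(w, map_at f) \<in> edges (qc_slice_pair ?D y V) (diag_at f, obj_at x) (proj_at y, obj_at y)"
    "(w', map_at g) \<in> edges (qc_slice_pair ?D y V) (diag_at f, obj_at x) (proj_at y, obj_at y)"
    using map_at_tri(2)[OF fg(1)] g fg unfolding tri_def by metis
  moreover from this(1) have "(diag_at f, obj_at x) \<in> simp (qc_slice_pair ?D y V) 0"
    using sset.edges_vertices[OF sset_slice_pair[OF D.sset_axioms]] by blast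
  ultimately show ?thesis by blast
qed

end

section \<open>Quasi-categories\<close>

lemma qc_Map_simps:
  "s \<in> simp (qc_Map X x y) n \<longleftrightarrow> s \<in> simp X (Suc n) \<and> vertex X (Suc n) (Suc n) s = y \<and>
     face X (Suc n) (Suc n) s = const_simp X n x"
  "act (qc_Map X x y) = act (qc_slice X y)"
  by (auto simp: qc_Map_def qc_slice_def qc_forget_def)

lemma sset_qc_Map:
  assumes "sset X" "x \<in> simp X 0" shows "sset (qc_Map X x y)"
proof (rule sub_sset[OF sset_slice[OF assms(1), of y]])
  fix m n \<alpha> s assume *: "\<alpha> \<in> ord_maps m n" "s \<in> simp (qc_Map X x y) n"
  then show "act (qc_slice X y) m n \<alpha> s \<in> simp (qc_Map X x y) m"
    using sset.act_in[OF sset_slice[OF assms(1)] *(1)] sset_map_act[OF forget_map[OF assms(1), of y] *(1)]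
      sset.act_const_simp[OF assms(1) *(1) assms(2)]
    by (simp add: qc_Map_def)
qed (auto simp: qc_Map_def)

lemma simp_qc_Map_0:
  assumes "sset X" "x \<in> simp X 0" shows "simp (qc_Map X x y) 0 = edges X x y"
  using sset.face_1[OF assms(1)] sset.const_simp_0[OF assms] by (auto simp: qc_Map_simps edges_def)

lemma qc_Map_map:
  assumes \<phi>: "sset_map X Y \<phi>" and x: "x \<in> simp X 0"
  shows "sset_map (qc_Map X x y) (qc_Map Y (\<phi> 0 x) (\<phi> 0 y)) (\<lambda>n. \<phi> (Suc n))"
  unfolding sset_map_def
proof (intro conjI allI ballI)
  fix n s assume "s \<in> simp (qc_Map X x y) n"
  then have s: "s \<in> simp X (Suc n)" "vertex X (Suc n) (Suc n) s = y" "face X (Suc n) (Suc n) s = const_simp X n x"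
    by (simp_all add: qc_Map_simps)
  then show "\<phi> (Suc n) s \<in> simp (qc_Map Y (\<phi> 0 x) (\<phi> 0 y)) n"
    using sset_map_in[OF \<phi> s(1)] sset_map_vertex[OF \<phi> s(1), of "Suc n"] sset_map_face[OF \<phi> s(1), of "Suc n"]
      sset_map_const[OF \<phi> x, of n]
    by (simp add: qc_Map_simps)
  fix m \<alpha> assume "\<alpha> \<in> ord_maps m n"
  then show "\<phi> (Suc m) (act (qc_Map X x y) m n \<alpha> s) = act (qc_Map Y (\<phi> 0 x) (\<phi> 0 y)) m n \<alpha> (\<phi> (Suc n) s)"
    using sset_map_act[OF \<phi> join_id_ord_maps s(1)] by (simp add: qc_Map_simps qc_slice_def)
qed

lemma same_path_component_qc_Map:
  assumes "sset_map X Y \<phi>" "x \<in> simp X 0" "same_path_component (qc_Map X x y) f g"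
  shows "same_path_component (qc_Map Y (\<phi> 0 x) (\<phi> 0 y)) (\<phi> 1 f) (\<phi> 1 g)"
  using same_path_component_map[OF qc_Map_map[OF assms(1,2)] assms(3)] by simp

lemma (in sset) edges_qc_Map_iff:
  assumes "x \<in> simp X 0"
  shows "w \<in> edges (qc_Map X x y) f g \<longleftrightarrow>
    w \<in> simp X 2 \<and> f \<in> edges X x y \<and> g \<in> edges X x y \<and>
    face X 2 2 w = const_simp X 1 x \<and> face X 2 0 w = g \<and> face X 2 1 w = f" (is "?l \<longleftrightarrow> ?r")
proof
  have v: "vertex (qc_Map X x y) 1 i w = vertex (qc_slice X y) 1 i w" for i
    by (simp add: vertex_def qc_Map_simps)
  assume l: ?l
  then have w: "w \<in> simp X 2" "vertex X 2 2 w = y" "face X 2 2 w = const_simp X 1 x"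
    by (auto simp: edges_def qc_Map_simps numeral_2_eq_2)
  have "f \<in> edges X x y" "g \<in> edges X x y"
    using sset.edges_vertices[OF sset_qc_Map[OF sset_axioms assms] l] simp_qc_Map_0[OF sset_axioms assms] by auto
  then show ?r using w l v vertex_slice[OF w(1), of y] by (auto simp: edges_def)
next
  have v: "vertex (qc_Map X x y) 1 i w = vertex (qc_slice X y) 1 i w" for i
    by (simp add: vertex_def qc_Map_simps)
  assume r: ?r
  then have w: "w \<in> simp X 2" by simp
  have "vertex X 2 2 w = y" using vertex_face_2[OF w, of 1 0] r by (auto simp: edges_def coface_def numeral_2_eq_2)
  then show ?l
    using r v vertex_slice[OF w, of y] by (auto simp: edges_def qc_Map_simps numeral_2_eq_2)
qed

text \<open>The edges of the right mapping space are the triangles defining \<open>eqv\<close>, and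
  \<open>eqv\<close> is already an equivalence relation, so zigzags collapse to one
  triangle.\<close>

lemma (in tri_calculus) same_path_component_qc_Map_iff:
  assumes "x \<in> simp X 0"
  shows "same_path_component (qc_Map X x y) f g \<longleftrightarrow> f \<in> edges X x y \<and> g \<in> edges X x y \<and> eqv f g"
proof
  note S = sset_qc_Map[OF sset_axioms assms, of y] and S0 = simp_qc_Map_0[OF sset_axioms assms, of y]
  {
    assume p: "same_path_component (qc_Map X x y) f g"
    have "eqv f g"
    proof (rule same_path_component_induct[OF p, of eqv])
      fix f g w assume "w \<in> edges (qc_Map X x y) f g"
      then have "f \<in> edges X x y" "tri X (const_simp X 1 x) g f"
        by (auto simp: edges_qc_Map_iff[OF assms] tri_def)
      then show "eqv f g" by (rule eqvI)
    next
      fix f assume "f \<in> simp (qc_Map X x y) 0"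
      then show "eqv f f" unfolding S0 by (rule eqv_refl)
    qed (rule eqv_sym, assumption, rule eqv_trans)
    then show "f \<in> edges X x y \<and> g \<in> edges X x y \<and> eqv f g"
      using p S0 by (simp add: same_path_component_iff)
  next
    assume *: "f \<in> edges X x y \<and> g \<in> edges X x y \<and> eqv f g"
    then have "tri X (const_simp X 1 x) g f" by (auto simp: eqv_def edges_def)
    then obtain w where "w \<in> edges (qc_Map X x y) f g"
      using * by (auto simp: edges_qc_Map_iff[OF assms] tri_def)
    then show "same_path_component (qc_Map X x y) f g" by (rule same_path_component_edge[OF S])
  }
qed

text \<open>The mapping space is formed after the colimit. An edge of it lifts to a 2-simplex of a
  stage, but the last vertex and the face opposite to it have the required values only up to the
  colimit relation; a later stage is needed to obtain an edge of a mapping space.\<close>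

lemma (in sset_system) same_path_component_Map_colim:
  assumes V: "V \<in> J" "\<And>W. W \<in> J \<Longrightarrow> le W V" and xy: "x \<in> simp (E V) 0" "y \<in> simp (E V) 0"
    and fg: "f \<in> edges (E V) x y" "g \<in> edges (E V) x y"
  defines "Q \<equiv> sset_colim J le E t" and "c \<equiv> colim_class J le E t"
  shows "same_path_component (qc_Map Q (c V 0 x) (c V 0 y)) (c V 1 f) (c V 1 g) \<longleftrightarrow>
    (\<exists>W\<in>J. same_path_component (qc_Map (E W) (t V W 0 x) (t V W 0 y)) (t V W 1 f) (t V W 1 g))"
    (is "?L \<longleftrightarrow> ?R")
proof
  interpret S: directed_system J le "\<lambda>V. simp (E V) 1" "\<lambda>V W. t V W 1" by (rule level)
  interpret S0: directed_system J le "\<lambda>V. simp (E V) 0" "\<lambda>V W. t V W 0" by (rule level)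
  have c_map: "W \<in> J \<Longrightarrow> sset_map (E W) Q (c W)" for W unfolding Q_def c_def by (rule class_map)
  have c_cls: "c W 1 z = S.cls W z" "c W 0 z = S0.cls W z" for W z unfolding c_def by (rule class_cls)+
  have c_t: "c W n (t V W n z) = c V n z" if "W \<in> J" "z \<in> simp (E V) n" for W n z
    unfolding c_def using that V by (intro class_t)
  let ?M = "\<lambda>W. qc_Map (E W) (t V W 0 x) (t V W 0 y)" and ?QM = "qc_Map Q (c V 0 x) (c V 0 y)"
  have tx: "t V W 0 x \<in> simp (E W) 0" "t V W 0 y \<in> simp (E W) 0" if "W \<in> J" for W
    using that V xy by (auto intro: sset_map_in[OF t_map])
  have c_Map: "sset_map (?M W) ?QM (\<lambda>n. c W (Suc n))" if "W \<in> J" for W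
    using qc_Map_map[OF c_map[OF that] tx(1)[OF that], of "t V W 0 y"] c_t[OF that] xy by simp
  have fg1: "f \<in> simp (E V) 1" "g \<in> simp (E V) 1" using fg by (simp_all add: edges_def)
  {
    assume L: ?L
    have "\<exists>W\<in>J. le W V \<and> (t V W 1 f, t V W 1 g) \<in> (path_edges (?M W) \<union> (path_edges (?M W))\<inverse>)\<^sup>*"
    proof (rule S.zigzag_stage[where G="\<lambda>W. path_edges (?M W)", OF _ _ V(1) fg1])
      show "(S.cls V f, S.cls V g) \<in> (path_edges ?QM \<union> (path_edges ?QM)\<inverse>)\<^sup>*"
        using L unfolding c_cls(1)[symmetric] same_path_component_iff by blast
    next
      fix a b assume "(a, b) \<in> path_edges ?QM"
      then obtain e where e: "e \<in> simp ?QM 1" "a = vertex ?QM 1 0 e" "b = vertex ?QM 1 1 e"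
        by (auto simp: path_edges_def)
      then have eQ: "e \<in> simp Q 2" "vertex Q 2 2 e = c V 0 y" "face Q 2 2 e = const_simp Q 1 (c V 0 x)"
        by (simp_all add: qc_Map_simps numeral_2_eq_2)
      then obtain U e' where U: "U \<in> J" "e' \<in> simp (E U) 2" "e = c U 2 e'"
        unfolding Q_def c_def using simp_colim_iff by blast
      interpret U: sset "E U" by (rule sset_E[OF U(1)])
      \<comment> \<open>The equation for the last vertex, and below the one for the opposite face,
        hold in the colimit. Each is realised from some stage on, and \<open>W\<close> lies below
        both.\<close>
      have "S0.cls U (vertex (E U) 2 2 e') = S0.cls V y"
        using eQ(2) U(3) sset_map_vertex[OF c_map[OF U(1)] U(2), of 2] by (simp add: c_cls)
      from S0.common_stage[OF U(1) U.vertex_in[OF U(2) order_refl] V(1) xy(2) this]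
      obtain W1 where W1: "W1 \<in> J" "le W1 U"
        "\<forall>Z\<in>J. le Z W1 \<longrightarrow> t U Z 0 (vertex (E U) 2 2 e') = t V Z 0 y" by blast
      have "S.cls U (face (E U) 2 2 e') = S.cls V (const_simp (E V) 1 x)"
        using eQ(3) U(3) sset_map_face[OF c_map[OF U(1)], of e' 1 2] U(2)
          sset_map_const[OF c_map[OF V(1)] xy(1), of 1]
        unfolding c_cls(1)[symmetric] by (simp add: numeral_2_eq_2)
      from S.common_stage[OF U(1) U.face_2_in[OF U(2)] V(1) sset.const_simp_in[OF sset_E[OF V(1)] xy(1)] this]
      obtain W2 where W2: "W2 \<in> J" "le W2 U"
        "\<forall>Z\<in>J. le Z W2 \<longrightarrow> t U Z 1 (face (E U) 2 2 e') = t V Z 1 (const_simp (E V) 1 x)" by blast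
      obtain W where W: "W \<in> J" "le W W1" "le W W2" using directed W1(1) W2(1) by blast
      have WU: "le W U" using le_trans W W1 U(1) by blast
      let ?e = "t U W 2 e'"
      note tUW = t_map[OF U(1) W(1) WU] and tVW = t_map[OF V(1) W(1) V(2)[OF W(1)]]
      have "?e \<in> simp (E W) 2" by (rule sset_map_in[OF tUW U(2)])
      moreover have "vertex (E W) 2 2 ?e = t V W 0 y"
        using sset_map_vertex[OF tUW U(2), of 2] W1(3) W by simp
      moreover have "face (E W) 2 2 ?e = const_simp (E W) 1 (t V W 0 x)"
        using sset_map_face[OF tUW, of e' 1 2] U(2) W2(3) W sset_map_const[OF tVW xy(1), of 1]
        by (simp add: numeral_2_eq_2)
      ultimately have em: "?e \<in> simp (?M W) 1" by (simp add: qc_Map_simps numeral_2_eq_2)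
      have "c W 2 ?e = e" unfolding U(3) c_def by (rule class_t[OF U(1) W(1) WU U(2)])
      then have "c W 1 (vertex (?M W) 1 i ?e) = vertex ?QM 1 i e" if "i \<le> 1" for i
        using sset_map_vertex[OF c_Map[OF W(1)] em that] by (simp add: numeral_2_eq_2)
      then have "a = S.cls W (vertex (?M W) 1 0 ?e)" "b = S.cls W (vertex (?M W) 1 1 ?e)"
        unfolding e c_cls[symmetric] by simp_all
      moreover have "vertex (?M W) 1 i ?e \<in> simp (E W) 1" if "i \<le> 1" for i
        using sset.vertex_in[OF sset_qc_Map[OF sset_E[OF W(1)] tx(1)[OF W(1)]] em that]
        by (simp add: qc_Map_simps)
      ultimately show "\<exists>V\<in>J. \<exists>x\<in>simp (E V) 1. \<exists>y\<in>simp (E V) 1. a = S.cls V x \<and> b = S.cls V y \<and> (x, y) \<in> path_edges (?M V)"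
        using W(1) em
        by (intro bexI[of _ W] bexI[of _ "vertex (?M W) 1 0 ?e"] bexI[of _ "vertex (?M W) 1 1 ?e"])
          (auto simp: path_edges_def)
    next
      fix U W a b assume UW: "U \<in> J" "W \<in> J" "le W U" and "(a, b) \<in> path_edges (?M U)"
      then obtain e where e: "e \<in> edges (?M U) a b" by (auto simp: path_edges_def edges_def)
      have "t U W 0 (t V U 0 z) = t V W 0 z" if "z \<in> simp (E V) 0" for z
        by (rule t_trans[OF V(1) UW(1,2) V(2)[OF UW(1)] UW(3) that])
      with sset_map_edges[OF qc_Map_map[OF t_map[OF UW] tx(1)[OF UW(1)]] e] xy
      show "(t U W 1 a, t U W 1 b) \<in> path_edges (?M W)"
        by (force simp: path_edges_def edges_def)
    qed
    then obtain W where W: "W \<in> J"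
      "(t V W 1 f, t V W 1 g) \<in> (path_edges (?M W) \<union> (path_edges (?M W))\<inverse>)\<^sup>*" by blast
    have "t V W 1 h \<in> simp (?M W) 0" if "h \<in> edges (E V) x y" for h
      using sset_map_edges[OF t_map[OF V(1) W(1) V(2)[OF W(1)]] that]
      by (simp add: simp_qc_Map_0[OF sset_E[OF W(1)] tx(1)[OF W(1)]])
    then show ?R using W fg by (auto simp: same_path_component_iff)
  next
    assume ?R
    then obtain W where W: "W \<in> J" "same_path_component (?M W) (t V W 1 f) (t V W 1 g)" by blast
    from same_path_component_map[OF c_Map[OF W(1)] W(2)] show ?L
      using c_t[OF W(1), of _ 1] fg1 by simp
  }
qed

lemma sset_map_snd: "sset_map (qc_slice_pair X u v) (qc_slice X v) (\<lambda>n. snd)"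
  by (auto simp: sset_map_def qc_slice_pair_def)

theorem qc_filter_quotient_eq_iff:
  fixes C :: "'a sset" and I :: "'i set"
  assumes filter: "product_closed_filter I \<Phi>" and C: "quasi_category C"
    and final: "qc_final C one" and initial: "qc_strict_initial C zero"
    and sys: "qc_product_system (qc_power I C) (subset_filter I zero one \<Phi>) T"
    and sec: "qc_section (qc_power I C) (subset_object I zero one I) \<sigma>"
    and XY: "X \<in> simp (qc_power I C) 0" "Y \<in> simp (qc_power I C) 0"
    and fg: "f \<in> simp (qc_Map (qc_power I C) X Y) 0" "g \<in> simp (qc_Map (qc_power I C) X Y) 0"
  defines "P \<equiv> qc_quotient_functor (qc_power I C) (subset_filter I zero one \<Phi>) T (subset_object I zero one I) \<sigma>"
  shows "same_path_component
      (qc_Map (qc_filter_quotient (qc_power I C) (subset_filter I zero one \<Phi>) T) (P 0 X) (P 0 Y)) (P 1 f) (P 1 g)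
    \<longleftrightarrow> {i \<in> I. same_path_component (qc_Map C (X i) (Y i)) (f i) (g i)} \<in> \<Phi>"
proof -
  let ?D = "qc_power I C" and ?F = "subset_filter I zero one \<Phi>" and ?V = "subset_object I zero one"
  interpret C: tri_calculus C by (rule quasi_category_tri_calculus[OF C])
  have "quasi_category ?D" unfolding qc_power_def by (rule quasi_category_Pi[OF C])
  then interpret D: sset ?D by (simp add: quasi_category_def sset_def)
  have obj: "zero \<in> simp C 0" "one \<in> simp C 0"
    using final initial by (auto simp: qc_final_def qc_strict_initial_def)
  have D0: "simp ?D 0 = PiE I (\<lambda>_. simp C 0)" by (simp add: qc_power_def sset_Pi_simps)
  have final': "edges C z one \<noteq> {}" if "z \<in> simp C 0" for z
    using that final contractible_path(1)[OF sset_qc_Map[OF C.sset_axioms that]]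
    by (simp add: qc_final_def simp_qc_Map_0[OF C.sset_axioms that])
  have le_C: "qc_le C z w \<longleftrightarrow> edges C z w \<noteq> {}" if "z \<in> simp C 0" for z w
    by (simp add: qc_le_def simp_qc_Map_0[OF C.sset_axioms that])
  have V0: "?V B \<in> simp ?D 0" for B using obj by (auto simp: D0 subset_object_def)
  have FV: "V \<in> simp ?D 0" if "V \<in> ?F" for V using that V0 by (auto simp: subset_filter_def)
  have le: "qc_le ?D U V \<longleftrightarrow> (\<forall>i\<in>I. qc_le C (U i) (V i))" if "U \<in> ?F" "V \<in> ?F" for U V
  proof -
    have U: "U i \<in> simp C 0" if "i \<in> I" for i using FV[OF \<open>U \<in> ?F\<close>] that by (auto simp: D0)
    have "edges ?D U V = PiE I (\<lambda>i. edges C (U i) (V i))"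
      using edges_Pi_iff[of U I "\<lambda>_. C" V] FV[OF that(1)] FV[OF that(2)]
      by (intro set_eqI) (auto simp: qc_power_def PiE_iff)
    then show ?thesis
      using le_C[OF U] FV[OF that(1)]
      by (simp add: qc_le_def simp_qc_Map_0[OF D.sset_axioms] PiE_eq_empty_iff)
  qed
  have le00: "qc_le C zero zero" using le_C[OF obj(1)] C.const_simp_edge[OF obj(1)] by blast
  note dir = subset_filter_directed[of I \<Phi> "qc_le C", OF filter le00
      le_C[THEN iffD2, OF obj(1) final'[OF obj(1)]] le_C[THEN iffD2, OF obj(2) final'[OF obj(2)]] le]
  interpret F: directed_index ?F "qc_le ?D" by (rule dir(1))
  interpret S: sset_system ?F "qc_le ?D" "qc_slice ?D" T
  proof
    show "simplicial_set (qc_slice ?D V)" for V by (rule sset.simplicial[OF sset_slice[OF D.sset_axioms]])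
    show "T V V n x = x" if "V \<in> ?F" "x \<in> simp (qc_slice ?D V) n" for V n x
      using sys that unfolding qc_product_system_def by blast
    show "sset_map (qc_slice ?D V) (qc_slice ?D W) (T V W)" if "V \<in> ?F" "W \<in> ?F" "qc_le ?D W V" for V W
      using sys that unfolding qc_product_system_def qc_times_functor_def by blast
    show "T V W n (T U V n x) = T U W n x"
      if "U \<in> ?F" "V \<in> ?F" "W \<in> ?F" "qc_le ?D V U" "qc_le ?D W V" "x \<in> simp (qc_slice ?D U) n" for U V W n x
      using sys that unfolding qc_product_system_def by blast
  qed
  let ?one = "?V I"
  have one: "?one \<in> ?F" by (rule dir(2))
  have \<sigma>: "sset_map ?D (qc_slice ?D ?one) \<sigma>" "\<And>n x. x \<in> simp ?D n \<Longrightarrow> qc_forget ?D n (\<sigma> n x) = x"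
    using sec by (simp_all add: qc_section_def)
  have fg': "f \<in> edges ?D X Y" "g \<in> edges ?D X Y"
    using fg by (simp_all add: simp_qc_Map_0[OF D.sset_axioms XY(1)])
  let ?M = "\<lambda>W. qc_Map (qc_slice ?D W) (T ?one W 0 (\<sigma> 0 X)) (T ?one W 0 (\<sigma> 0 Y))"
  let ?path = "\<lambda>W. same_path_component (?M W) (T ?one W 1 (\<sigma> 1 f)) (T ?one W 1 (\<sigma> 1 g))"
  have stage: "same_path_component (qc_Map (qc_filter_quotient ?D ?F T) (P 0 X) (P 0 Y)) (P 1 f) (P 1 g)
    \<longleftrightarrow> (\<exists>W\<in>?F. ?path W)"
    unfolding P_def qc_quotient_functor_def qc_filter_quotient_def
    by (rule S.same_path_component_Map_colim[OF one dir(3) sset_map_in[OF \<sigma>(1) XY(1)] sset_map_in[OF \<sigma>(1) XY(2)]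
      sset_map_edges[OF \<sigma>(1) fg'(1)] sset_map_edges[OF \<sigma>(1) fg'(2)]])
  \<comment> \<open>The natural transformation is only asserted to exist, so it is obtained
    separately for each stage, together with the finality of the product cones that it
    defines.\<close>
  have stage_data: "\<exists>\<eta>. power_stage C I zero one B \<sigma> (T ?one (?V B)) \<eta> \<and>
    (\<forall>x\<in>simp ?D 0. qc_final (qc_slice_pair ?D x (?V B)) (times_stage.proj_at ?D ?one \<sigma> \<eta> x, T ?one (?V B) 0 (\<sigma> 0 x)))"
    if "B \<in> \<Phi>" for B
  proof -
    have "?V B \<in> ?F" using that by (auto simp: subset_filter_def)
    then have "qc_times_functor ?D ?one (?V B) (T ?one (?V B))"
      using sys one dir(3) unfolding qc_product_system_def by blast
    then obtain \<eta> where T: "sset_map (qc_slice ?D ?one) (qc_slice ?D (?V B)) (T ?one (?V B))"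
      and \<eta>0: "sset_map (sset_prod (qc_slice ?D ?one) (std_simplex 1)) ?D \<eta>"
        "\<And>n s. s \<in> simp (qc_slice ?D ?one) n \<Longrightarrow> \<eta> n (s, std_const 0 n) = qc_forget ?D n (T ?one (?V B) n s)"
        "\<And>n s. s \<in> simp (qc_slice ?D ?one) n \<Longrightarrow> \<eta> n (s, std_const 1 n) = qc_forget ?D n s"
        "\<And>a. a \<in> simp (qc_slice ?D ?one) 0 \<Longrightarrow> qc_final (qc_slice_pair ?D (qc_forget ?D 0 a) (?V B))
             (\<eta> 1 (const_simp (qc_slice ?D ?one) 1 a, iota), T ?one (?V B) 0 a)"
      unfolding qc_times_functor_def iota_def by blast
    interpret power_stage C I zero one B \<sigma> "T ?one (?V B)" \<eta>
      by unfold_locales (use \<sigma> T \<eta>0 obj that filter in \<open>auto simp: product_closed_filter_def\<close>)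
    have "qc_final (qc_slice_pair ?D x (?V B)) (proj_at x, T ?one (?V B) 0 (\<sigma> 0 x))" if "x \<in> simp ?D 0" for x
      using \<eta>0(4)[OF sset_map_in[OF \<sigma>(1) that]] by (simp add: proj_at_def \<sigma>(2)[OF that])
    then show ?thesis using power_stage_axioms by blast
  qed
  let ?A = "{i \<in> I. same_path_component (qc_Map C (X i) (Y i)) (f i) (g i)}"
  have coord: "X i \<in> simp C 0" "Y i \<in> simp C 0" "f i \<in> edges C (X i) (Y i)" "g i \<in> edges C (X i) (Y i)"
    if "i \<in> I" for i
    using XY that sset_map_edges[OF proj_map[OF that, of "\<lambda>_. C"] fg'(1)[unfolded qc_power_def]]
      sset_map_edges[OF proj_map[OF that, of "\<lambda>_. C"] fg'(2)[unfolded qc_power_def]]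
    by (auto simp: D0)
  have A: "i \<in> ?A \<longleftrightarrow> i \<in> I \<and> C.eqv (f i) (g i)" for i
    using C.same_path_component_qc_Map_iff[OF coord(1)] coord(3,4) by blast
  show ?thesis unfolding stage
  proof
    assume "\<exists>W\<in>?F. ?path W"
    then obtain B where B\<Phi>: "B \<in> \<Phi>" and path: "?path (?V B)" by (auto simp: subset_filter_def)
    obtain \<eta> where "power_stage C I zero one B \<sigma> (T ?one (?V B)) \<eta>"
      and fin: "\<And>x. x \<in> simp ?D 0 \<Longrightarrow> qc_final (qc_slice_pair ?D x (?V B))
        (times_stage.proj_at ?D ?one \<sigma> \<eta> x, T ?one (?V B) 0 (\<sigma> 0 x))"
      using stage_data[OF B\<Phi>] by blast
    then interpret power_stage C I zero one B \<sigma> "T ?one (?V B)" \<eta> by simp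
    have ex: "edges (qc_slice_pair ?D X (?V B)) p (proj_at X, obj_at X) \<noteq> {}"
      if p: "p \<in> simp (qc_slice_pair ?D X (?V B)) 0" for p
    proof -
      have "sset (qc_slice_pair ?D X (?V B))" by (rule sset_slice_pair[OF D.sset_axioms])
      from contractible_path(1)[OF sset_qc_Map[OF this p]] simp_qc_Map_0[OF this p] fin[OF XY(1)] p
      show ?thesis by (auto simp: qc_final_def obj_at_def)
    qed
    let ?x = "vertex ?D 1 0 (obj_at X)"
    \<comment> \<open>The path over the stage is pushed along the forgetful functor to
      \<open>?D\<close>, and below along the projection to the index \<open>i\<close>, where it
      becomes a homotopy of the product maps.\<close>
    have "same_path_component (qc_Map ?D (qc_forget ?D 0 (obj_at X)) (qc_forget ?D 0 (obj_at Y)))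
        (qc_forget ?D 1 (map_at f)) (qc_forget ?D 1 (map_at g))"
      using same_path_component_qc_Map[OF forget_map[OF D.sset_axioms] obj_at_in[OF XY(1)]] path
      by (simp add: obj_at_def map_at_def)
    then have p: "same_path_component (qc_Map ?D ?x (qc_forget ?D 0 (obj_at Y)))
        (face ?D 2 2 (map_at f)) (face ?D 2 2 (map_at g))"
      using D.forget_0 obj_at_in[OF XY(1)] by (simp add: qc_forget_def[of _ "Suc 0"] numeral_2_eq_2 simp_slice_0)
    have x: "?x \<in> simp ?D 0" using D.vertex_in obj_at_in[OF XY(1)] by (simp add: simp_slice_0)
    have "i \<in> ?A" if i: "i \<in> B" for i
    proof -
      have iI: "i \<in> I" using i B by blast
      have "same_path_component (qc_Map C (?x i) (qc_forget ?D 0 (obj_at Y) i))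
          (face ?D 2 2 (map_at f) i) (face ?D 2 2 (map_at g) i)"
        using same_path_component_qc_Map[OF proj_map[OF iI, of "\<lambda>_. C"]] p x unfolding qc_power_def by blast
      moreover have "?x i \<in> simp C 0" using x iI by (auto simp: D0)
      ultimately have "C.eqv (face ?D 2 2 (map_at f) i) (face ?D 2 2 (map_at g) i)"
        using C.same_path_component_qc_Map_iff by blast
      from eqv_if_eqv_at[OF ex final' XY(1) i fg' this] show ?thesis using A iI by blast
    qed
    then have "B \<subseteq> ?A" by blast
    then show "?A \<in> \<Phi>" using upward_closed_filter_iff[OF filter, of ?A] B\<Phi> by auto
  next
    assume A\<Phi>: "?A \<in> \<Phi>"
    obtain \<eta> where "power_stage C I zero one ?A \<sigma> (T ?one (?V ?A)) \<eta>"
      and fin: "\<And>x. x \<in> simp ?D 0 \<Longrightarrow> qc_final (qc_slice_pair ?D x (?V ?A))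
        (times_stage.proj_at ?D ?one \<sigma> \<eta> x, T ?one (?V ?A) 0 (\<sigma> 0 x))"
      using stage_data[OF A\<Phi>] by blast
    then interpret power_stage C I zero one ?A \<sigma> "T ?one (?V ?A)" \<eta> by simp
    let ?S = "qc_slice_pair ?D Y (?V ?A)" and ?p = "(diag_at f, obj_at X)" and ?q = "(proj_at Y, obj_at Y)"
    have S: "sset ?S" by (rule sset_slice_pair[OF D.sset_axioms])
    have "\<exists>w w'. ?p \<in> simp ?S 0 \<and> (w, map_at f) \<in> edges ?S ?p ?q \<and> (w', map_at g) \<in> edges ?S ?p ?q"
    proof (rule common_cone[OF _ _ fg'])
      fix i assume "i \<in> ?A" then show "C.eqv (f i) (g i)" using A by blast
    next
      fix i h h'
      let ?x = "vertex C 1 0 (obj_at X i)"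
      assume i: "i \<in> I - ?A" and h: "h \<in> edges C ?x (Y i)" "h' \<in> edges C ?x (Y i)"
      have "obj_at X i \<in> edges C ?x zero"
        using obj_at_edge[OF XY(1), of i] i by (simp add: subset_object_def)
      moreover have x: "?x \<in> simp C 0" using C.edges_vertices h by blast
      ultimately have "qc_initial C ?x" using initial le_C[OF x] by (auto simp: qc_strict_initial_def)
      then have "contractible (qc_Map C ?x (Y i))" using coord i by (simp add: qc_initial_def)
      from contractible_path(2)[OF sset_qc_Map[OF C.sset_axioms x] this] show "C.eqv h h'"
        using h simp_qc_Map_0[OF C.sset_axioms x] C.same_path_component_qc_Map_iff[OF x] by blast
    qed
    then obtain w w' where p: "?p \<in> simp ?S 0" and w: "(w, map_at f) \<in> edges ?S ?p ?q" "(w', map_at g) \<in> edges ?S ?p ?q"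
      by blast
    \<comment> \<open>Both product maps are components of maps from the cone \<open>?p\<close> to
      the final cone \<open>?q\<close>. The path between these maps of cones is projected to the
      second component, which lives in the slice over the stage.\<close>
    have "contractible (qc_Map ?S ?p ?q)" using fin[OF XY(2)] p by (simp add: qc_final_def obj_at_def)
    from contractible_path(2)[OF sset_qc_Map[OF S p] this] w
    have "same_path_component (qc_Map ?S ?p ?q) (w, map_at f) (w', map_at g)"
      by (simp add: simp_qc_Map_0[OF S p])
    from same_path_component_qc_Map[OF sset_map_snd p this] have "?path (?V ?A)"
      by (simp add: obj_at_def map_at_def)
    moreover have "?V ?A \<in> ?F" using A\<Phi> by (auto simp: subset_filter_def)
    ultimately show "\<exists>W\<in>?F. ?path W" by blast
  qed
qed

section \<open>Kan fibrations that are homotopy equivalences\<close>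

lemma kan_fibration_lift:
  "kan_fibration E B p \<Longrightarrow> b \<in> simp B n \<Longrightarrow> 1 \<le> n \<Longrightarrow> k \<le> n \<Longrightarrow> horn E n k y \<Longrightarrow>
    (\<And>i. i \<le> n \<Longrightarrow> i \<noteq> k \<Longrightarrow> face B n i b = p (n - 1) (y i)) \<Longrightarrow>
    \<exists>x\<in>simp E n. p n x = b \<and> (\<forall>i\<le>n. i \<noteq> k \<longrightarrow> face E n i x = y i)"
  unfolding kan_fibration_def by blast

lemma horn_map:
  assumes f: "sset_map X Y f" and y: "horn X n k y" "1 \<le> n"
  shows "horn Y n k (\<lambda>i. f (n - 1) (y i))"
  unfolding horn_def
proof (intro conjI impI allI)
  fix i assume "i \<le> n" "i \<noteq> k"
  then show "f (n - 1) (y i) \<in> simp Y (n - 1)" using y by (auto simp: horn_def intro: sset_map_in[OF f])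
next
  fix i j assume n: "2 \<le> n" and ij: "i < j \<and> j \<le> n \<and> i \<noteq> k \<and> j \<noteq> k"
  then obtain m where m: "n = Suc (Suc m)" by (metis add_2_eq_Suc le_Suc_ex)
  have "y i \<in> simp X (Suc m)" "y j \<in> simp X (Suc m)"
    "face X (Suc m) i (y j) = face X (Suc m) (j - 1) (y i)"
    using y ij m by (auto simp: horn_def)
  then show "face Y (n - 1) i (f (n - 1) (y j)) = face Y (n - 1) (j - 1) (f (n - 1) (y i))"
    using sset_map_face[OF f] m by (metis diff_Suc_1)
qed

lemma kan_fibration_total:
  assumes p: "kan_fibration E B p" and B: "kan_complex B" and E: "sset E"
  shows "kan_complex E"
  unfolding kan_complex_def
proof (intro conjI allI impI)
  show "simplicial_set E" by (rule sset.simplicial[OF E])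
  fix n k y assume *: "1 \<le> n \<and> k \<le> n \<and> horn E n k y"
  have pm: "sset_map E B p" using p by (simp add: kan_fibration_def)
  have "horn B n k (\<lambda>i. p (n - 1) (y i))" by (rule horn_map[OF pm]) (use * in auto)
  then have "\<exists>b\<in>simp B n. \<forall>i\<le>n. i \<noteq> k \<longrightarrow> face B n i b = p (n - 1) (y i)"
    by (intro kan_fill[OF B]) (use * in auto)
  then obtain b where b: "b \<in> simp B n" "\<And>i. i \<le> n \<Longrightarrow> i \<noteq> k \<Longrightarrow> face B n i b = p (n - 1) (y i)"
    by auto
  have "\<exists>x\<in>simp E n. p n x = b \<and> (\<forall>i\<le>n. i \<noteq> k \<longrightarrow> face E n i x = y i)"
    by (rule kan_fibration_lift[OF p b(1) _ _ _ b(2)]) (use * in auto)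
  then show "\<exists>x\<in>simp E n. \<forall>i\<le>n. i \<noteq> k \<longrightarrow> face E n i x = y i" by auto
qed

lemma kan_fibration_lift_edge:
  assumes p: "kan_fibration E B p" and E: "sset E" and B: "sset B"
    and "e \<in> simp E 0" "\<beta> \<in> edges B (p 0 e) b"
  obtains c where "c \<in> simp E 1" "vertex E 1 0 c = e" "p 1 c = \<beta>"
proof -
  have "horn E 1 0 (\<lambda>_. e)" using assms by (simp add: horn_def)
  moreover have \<beta>: "\<beta> \<in> simp B 1" "vertex B 1 0 \<beta> = p 0 e" using assms by (auto simp: edges_def)
  ultimately have "\<exists>x\<in>simp E 1. p 1 x = \<beta> \<and> (\<forall>i\<le>1. i \<noteq> 0 \<longrightarrow> face E 1 i x = e)"
    by (intro kan_fibration_lift[OF p]) (auto simp: le_Suc_eq sset.face_1[OF B, simplified])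
  then obtain c where "c \<in> simp E 1" "p 1 c = \<beta>" "face E 1 1 c = e" by auto
  then show thesis using that sset.face_1(2)[OF E] by simp
qed

text \<open>The equivalence reaches \<open>b\<close> up to a path, and lifting that path corrects
  the end point.\<close>

lemma trivial_fibration_surj:
  assumes p: "kan_fibration E B p" and E: "sset E" and B: "sset B"
    and h: "homotopy_equivalence E B p" and b: "b \<in> simp B 0"
  obtains e where "e \<in> simp E 0" "p 0 e = b"
proof -
  obtain x \<beta> where x: "x \<in> simp E 0" "\<beta> \<in> edges B (p 0 x) b"
    using homotopy_equivalence_surj[OF B h b] by blast
  obtain c where c: "c \<in> simp E 1" "p 1 c = \<beta>"
    using kan_fibration_lift_edge[OF p E B x] by blast
  have "sset_map E B p" using p by (simp add: kan_fibration_def)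
  from sset_map_vertex[OF this c(1), of 1] have "p 0 (vertex E 1 1 c) = b"
    using c x by (simp add: edges_def)
  then show thesis using that sset.vertex_in[OF E c(1) order_refl] by blast
qed

text \<open>In terms of fundamental groupoids: \<open>p\<close> is fully faithful, so there is a path \<open>c\<close> whose image
  is null homotopic, and the null homotopy can be lifted.\<close>

lemma trivial_fibration_fibre:
  assumes p: "kan_fibration E B p" and E: "kan_complex E" and B: "kan_complex B"
    and h: "homotopy_equivalence E B p"
    and e: "e0 \<in> simp E 0" "e1 \<in> simp E 0" "p 0 e0 = b" "p 0 e1 = b"
  obtains c where "c \<in> edges E e0 e1" "p 1 c = const_simp B 1 b"
proof -
  interpret E: tri_calculus E by (rule quasi_category_tri_calculus[OF kan_complex_quasi_category[OF E]])
  interpret B: tri_calculus B by (rule quasi_category_tri_calculus[OF kan_complex_quasi_category[OF B]])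
  have pm: "sset_map E B p" using p by (simp add: kan_fibration_def)
  obtain g where g: "sset_map B E g" "homotopic E E (\<lambda>n x. g n (p n x)) (\<lambda>n x. x)"
      "homotopic B B (\<lambda>n y. p n (g n y)) (\<lambda>n y. y)"
    using h by (auto simp: homotopy_equivalence_def)
  obtain H where H: "sset_map (sset_prod E (std_simplex 1)) E H"
    "\<And>n x. x \<in> simp E n \<Longrightarrow> H n (x, std_const 0 n) = g n (p n x) \<and> H n (x, std_const 1 n) = x"
    using g(2) by (auto simp: homotopic_def)
  obtain K where K: "sset_map (sset_prod B (std_simplex 1)) B K"
    "\<And>n x. x \<in> simp B n \<Longrightarrow> K n (x, std_const 0 n) = p n (g n x) \<and> K n (x, std_const 1 n) = x"
    using g(3) by (auto simp: homotopic_def)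
  have b: "b \<in> simp B 0" using sset_map_in[OF pm e(1)] e by simp
  have gb: "g 0 b \<in> simp E 0" by (rule sset_map_in[OF g(1) b])
  let ?h = "\<lambda>e. H 1 (const_simp E 1 e, iota)" and ?k = "K 1 (const_simp B 1 b, iota)"
  have h0: "?h e0 \<in> edges E (g 0 b) e0" and h1: "?h e1 \<in> edges E (g 0 b) e1"
    using homotopy_edge[OF E.sset_axioms H(1)] H(2)[OF e(1)] H(2)[OF e(2)] e by metis+
  have k: "?k \<in> edges B (p 0 (g 0 b)) b"
    using homotopy_edge[OF B.sset_axioms K(1) b] K(2)[OF b] by metis
  \<comment> \<open>The candidate path goes back along the component of \<open>H\<close> at
    \<open>e0\<close> and out along the one at \<open>e1\<close>.\<close>
  obtain c where c: "tri E (?h e0) c (?h e1)" using kan_tri_divide[OF E h0 h1] by blast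
  then have ce: "c \<in> edges E e0 e1"
    by (rule E.triE) (use h0 h1 in \<open>auto simp: edges_def\<close>)
  then have c1: "c \<in> simp E 1" by (simp add: edges_def)
  let ?l = "g 1 (p 1 c)" and ?m = "p 1 c"
  have me: "?m \<in> edges B b b" using sset_map_edges[OF pm ce] e by simp
  then have m1: "?m \<in> simp B 1" by (simp add: edges_def)
  let ?i = "const_simp E 1 (g 0 b)"
  \<comment> \<open>Naturality of \<open>H\<close> at \<open>c\<close> and the choice of
    \<open>c\<close> show that \<open>?l\<close> followed by \<open>?h e1\<close> is
    \<open>?h e1\<close>; cancelling \<open>?h e1\<close> makes \<open>?l\<close> trivial.\<close>
  have "tri E (?h e0) c (H 1 (c, iota))" "tri E ?l (?h e1) (H 1 (c, iota))"
    using prism[OF E.sset_axioms H(1) ce] H(2)[OF c1] by simp_all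
  then have "tri E ?l (?h e1) (?h e1)" using E.tri_cong_right E.tri_unique[OF _ c] by blast
  from kan_tri_outer(2)[OF E this E.tri_deg_left[OF h1] E.tri_deg_left[OF h1]]
  have "tri E ?i ?l ?i" .
  from sset_map_tri[OF pm this] have "tri B (const_simp B 1 (p 0 (g 0 b))) (p 1 ?l) (const_simp B 1 (p 0 (g 0 b)))"
    by (simp add: sset_map_const[OF pm gb])
  then have l: "B.eqv (const_simp B 1 (p 0 (g 0 b))) (p 1 ?l)"
    by (rule B.eqvI[OF B.const_simp_edge[OF sset_map_in[OF pm gb]]])
  \<comment> \<open>Naturality of \<open>K\<close> at \<open>?m\<close> carries the triviality from
    \<open>p 1 ?l\<close> to \<open>?m\<close>; cancelling \<open>?k\<close> leaves the triangle
    \<open>v\<close>, which contracts \<open>?m\<close>.\<close>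
  have kt: "tri B ?k ?m (K 1 (?m, iota))" "tri B (p 1 ?l) ?k (K 1 (?m, iota))"
    using prism[OF B.sset_axioms K(1) me] K(2)[OF m1] by simp_all
  have "tri B (const_simp B 1 (p 0 (g 0 b))) ?k (K 1 (?m, iota))"
    by (rule B.tri_cong_left[OF kt(2) B.eqv_sym[OF l]])
  from B.tri_cong_right[OF kt(1) B.tri_unique[OF this B.tri_deg_left[OF k]]]
  have "tri B ?k ?m ?k" .
  from kan_tri_outer(1)[OF B B.tri_deg_right[OF k] B.tri_deg_right[OF k] this]
  obtain v where v: "v \<in> simp B 2" "face B 2 2 v = const_simp B 1 b" "face B 2 0 v = ?m"
    "face B 2 1 v = const_simp B 1 b"
    unfolding tri_def by blast
  \<comment> \<open>An inner horn over \<open>v\<close>, with the degenerate edge at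
    \<open>e0\<close> followed by \<open>c\<close>; the remaining edge of the lift lies over a
    degenerate edge.\<close>
  let ?y = "\<lambda>i::nat. if i = 0 then c else const_simp E 1 e0"
  have i0: "const_simp E 1 e0 \<in> edges E e0 e0" by (rule E.const_simp_edge[OF e(1)])
  have "horn E 2 1 ?y"
    using ce i0 E.face_1 by (auto simp: horn_def edges_def le_2_cases)
  then have "\<exists>x\<in>simp E 2. p 2 x = v \<and> (\<forall>i\<le>2. i \<noteq> 1 \<longrightarrow> face E 2 i x = ?y i)"
    by (intro kan_fibration_lift[OF p v(1)])
      (use v e sset_map_const[OF pm e(1), of 1] in \<open>auto simp: le_2_cases\<close>)
  then obtain x where x: "x \<in> simp E 2" "p 2 x = v" "face E 2 0 x = c" "face E 2 2 x = const_simp E 1 e0"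
    by fastforce
  have "tri E (const_simp E 1 e0) c (face E 2 1 x)" using x by (auto simp: tri_def)
  then have "face E 2 1 x \<in> edges E e0 e1"
    by (rule E.triE) (use i0 ce in \<open>auto simp: edges_def\<close>)
  moreover have "p 1 (face E 2 1 x) = const_simp B 1 b"
    using sset_map_face[OF pm, of x 1 1] x v by (simp add: numeral_2_eq_2)
  ultimately show thesis by (rule that)
qed

section \<open>Composition in complete Segal spaces\<close>

text \<open>The categorical direction of \<open>W\<close> at a fixed spatial dimension
  \<open>k\<close>. Objects, maps and witnesses of composition are the simplices of
  \<open>row W 0\<close> in dimensions 0, 1 and 2.\<close>

definition row :: "'a bsset \<Rightarrow> nat \<Rightarrow> 'a sset" where
  "row W k = \<lparr>simp = \<lambda>n. bsimp W n k, act = \<lambda>m n \<alpha>. bact W m n \<alpha> k k id\<rparr>"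

lemma row_simps:
  "simp (row W k) n = bsimp W n k" "act (row W k) m n \<alpha> = hact W m n \<alpha> k"
  "face (row W k) n i = hface W n i k" "vertex (row W k) n i = hvertex W n i k"
  "const_simp (row W k) 1 = hdeg W k"
  by (simp_all add: row_def hact_def face_def hface_def vertex_def hvertex_def const_simp_def hdeg_def fun_eq_iff)

lemma space_at_simps: "simp (space_at W n) k = bsimp W n k" "act (space_at W n) j k \<beta> = bact W n n id j k \<beta>"
  by (simp_all add: space_at_def)

locale simp_space =
  fixes W :: "'a bsset"
  assumes simplicial_space: "simplicial_space W"
begin

lemmas simplicial_spaceD = simplicial_space[unfolded simplicial_space_def]

lemma bact_in: "\<alpha> \<in> ord_maps m n \<Longrightarrow> \<beta> \<in> ord_maps j k \<Longrightarrow> x \<in> bsimp W n k \<Longrightarrow>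
    bact W m n \<alpha> j k \<beta> x \<in> bsimp W m j"
  by (rule simplicial_spaceD[THEN conjunct1, rule_format])

lemma bact_cong: "\<alpha> \<in> ord_maps m n \<Longrightarrow> \<alpha>' \<in> ord_maps m n \<Longrightarrow> \<beta> \<in> ord_maps j k \<Longrightarrow> \<beta>' \<in> ord_maps j k \<Longrightarrow>
    x \<in> bsimp W n k \<Longrightarrow> (\<And>i. i \<le> m \<Longrightarrow> \<alpha> i = \<alpha>' i) \<Longrightarrow> (\<And>i. i \<le> j \<Longrightarrow> \<beta> i = \<beta>' i) \<Longrightarrow>
    bact W m n \<alpha> j k \<beta> x = bact W m n \<alpha>' j k \<beta>' x"
  by (rule simplicial_spaceD[THEN conjunct2, THEN conjunct1, rule_format]) simp_all

lemma bact_id: "x \<in> bsimp W n k \<Longrightarrow> bact W n n id k k id x = x"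
  using simplicial_space unfolding simplicial_space_def by blast

lemma bact_bact: "\<alpha>' \<in> ord_maps l m \<Longrightarrow> \<alpha> \<in> ord_maps m n \<Longrightarrow> \<beta>' \<in> ord_maps i j \<Longrightarrow> \<beta> \<in> ord_maps j k \<Longrightarrow>
    x \<in> bsimp W n k \<Longrightarrow>
    bact W l m \<alpha>' i j \<beta>' (bact W m n \<alpha> j k \<beta> x) = bact W l n (\<alpha> \<circ> \<alpha>') i k (\<beta> \<circ> \<beta>') x"
  using simplicial_space unfolding simplicial_space_def by blast

lemma sset_row: "sset (row W k)"
proof
  show "simplicial_set (row W k)"
    unfolding simplicial_set_def row_simps hact_def
  proof (intro conjI allI ballI impI)
    fix m n \<alpha> x assume *: "\<alpha> \<in> ord_maps m n" "x \<in> bsimp W n k"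
    show "bact W m n \<alpha> k k id x \<in> bsimp W m k" by (rule bact_in[OF *(1) id_ord_maps *(2)])
    fix \<beta> assume "\<beta> \<in> ord_maps m n" "\<forall>i\<le>m. \<alpha> i = \<beta> i"
    then show "bact W m n \<alpha> k k id x = bact W m n \<beta> k k id x"
      by (intro bact_cong) (simp_all add: * id_ord_maps)
  next
    fix n x assume "x \<in> bsimp W n k" then show "bact W n n id k k id x = x" by (rule bact_id)
  next
    fix l m n \<beta> \<alpha> x assume "\<beta> \<in> ord_maps l m" "\<alpha> \<in> ord_maps m n" "x \<in> bsimp W n k"
    then show "bact W l m \<beta> k k id (bact W m n \<alpha> k k id x) = bact W l n (\<alpha> \<circ> \<beta>) k k id x"
      by (simp add: bact_bact id_ord_maps)
  qed
qed

lemma sset_space_at: "sset (space_at W n)"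
proof
  show "simplicial_set (space_at W n)"
    unfolding simplicial_set_def space_at_simps
  proof (intro conjI allI ballI impI)
    fix j k \<beta> x assume *: "\<beta> \<in> ord_maps j k" "x \<in> bsimp W n k"
    show "bact W n n id j k \<beta> x \<in> bsimp W n j" by (rule bact_in[OF id_ord_maps *])
    fix \<beta>' assume "\<beta>' \<in> ord_maps j k" "\<forall>i\<le>j. \<beta> i = \<beta>' i"
    then show "bact W n n id j k \<beta> x = bact W n n id j k \<beta>' x"
      by (intro bact_cong) (simp_all add: * id_ord_maps)
  next
    fix k x assume "x \<in> bsimp W n k" then show "bact W n n id k k id x = x" by (rule bact_id)
  next
    fix i j k \<beta>' \<beta> x assume "\<beta>' \<in> ord_maps i j" "\<beta> \<in> ord_maps j k" "x \<in> bsimp W n k"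
    then show "bact W n n id i j \<beta>' (bact W n n id j k \<beta> x) = bact W n n id i k (\<beta> \<circ> \<beta>') x"
      by (simp add: bact_bact id_ord_maps)
  qed
qed

lemma hact_map: "\<alpha> \<in> ord_maps m n \<Longrightarrow> sset_map (space_at W n) (space_at W m) (hact W m n \<alpha>)"
  unfolding sset_map_def space_at_simps hact_def by (simp add: bact_in bact_bact id_ord_maps)

lemma hface_map: "sset_map (space_at W (Suc n)) (space_at W n) (hface W (Suc n) i)"
  unfolding hface_def using hact_map[OF coface_ord_maps] by simp

lemma hvertex_map: "i \<le> n \<Longrightarrow> sset_map (space_at W n) (space_at W 0) (hvertex W n i)"
  unfolding hvertex_def by (rule hact_map[OF const_ord_maps])

lemma hface_1: "x \<in> bsimp W 1 k \<Longrightarrow> hface W 1 0 k x = hvertex W 1 1 k x"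
  "x \<in> bsimp W 1 k \<Longrightarrow> hface W 1 1 k x = hvertex W 1 0 k x"
  using sset.face_1[OF sset_row[of k]] by (simp_all add: row_simps)

lemma hface_in: "x \<in> bsimp W (Suc n) k \<Longrightarrow> hface W (Suc n) i k x \<in> bsimp W n k"
  using sset_map_in[OF hface_map] by (simp add: space_at_simps)

lemma hface_in_2: "x \<in> bsimp W 2 k \<Longrightarrow> hface W 2 i k x \<in> bsimp W 1 k"
  and hface_in_3: "x \<in> bsimp W 3 k \<Longrightarrow> hface W 3 i k x \<in> bsimp W 2 k"
  using hface_in[of x 1 k] hface_in[of x 2 k] by (simp_all add: numeral_2_eq_2 numeral_3_eq_3)

lemma hvertex_in: "x \<in> bsimp W n k \<Longrightarrow> i \<le> n \<Longrightarrow> hvertex W n i k x \<in> bsimp W 0 k"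
  using sset_map_in[OF hvertex_map] by (simp add: space_at_simps)

lemma vconst_in: "x \<in> bsimp W n 0 \<Longrightarrow> vconst W n k x \<in> bsimp W n k"
  using sset.const_simp_in[OF sset_space_at] by (simp add: vconst_def space_at_simps)

lemma vconst_0: "x \<in> bsimp W n 0 \<Longrightarrow> vconst W n 0 x = x"
  using sset.const_simp_0[OF sset_space_at] by (simp add: vconst_def space_at_simps)

lemma hvertex_vconst: "x \<in> bsimp W n 0 \<Longrightarrow> i \<le> n \<Longrightarrow> hvertex W n i k (vconst W n k x) = vconst W 0 k (hvertex W n i 0 x)"
  unfolding vconst_def by (rule sset_map_const[OF hvertex_map]) (simp_all add: space_at_simps)

lemma hface_hface_2:
  assumes "x \<in> bsimp W 2 k" "i < j" shows "hface W 1 i k (hface W 2 j k x) = hface W 1 (j - 1) k (hface W 2 i k x)"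
  using sset.face_face[OF sset_row[of k], of x 0 i j] assms by (simp add: row_simps numeral_2_eq_2)

lemma hface_hface_3:
  assumes "x \<in> bsimp W 3 k" "i < j" shows "hface W 2 i k (hface W 3 j k x) = hface W 2 (j - 1) k (hface W 3 i k x)"
  using sset.face_face[OF sset_row[of k], of x 1 i j] assms by (simp add: row_simps numeral_2_eq_2 numeral_3_eq_3)

lemma simp_css_Map_0: "x \<in> bsimp W 0 0 \<Longrightarrow> y \<in> bsimp W 0 0 \<Longrightarrow> simp (css_Map W x y) 0 = edges (row W 0) x y"
  by (auto simp: css_Map_def edges_def row_simps vconst_0)

lemma sset_css_Map: 
  assumes "x \<in> bsimp W 0 0" "y \<in> bsimp W 0 0" shows "sset (css_Map W x y)"
proof (rule sub_sset[OF sset_space_at[of 1]])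
  show "act (css_Map W x y) = act (space_at W 1)" by (simp add: css_Map_def)
  show s: "simp (css_Map W x y) k \<subseteq> simp (space_at W 1) k" for k
    by (auto simp: css_Map_def space_at_simps)
  fix m n \<alpha> e assume *: "\<alpha> \<in> ord_maps m n" "e \<in> simp (css_Map W x y) n"
  have e: "e \<in> simp (space_at W 1) n" using * s by blast
  have "hvertex W 1 i m (act (space_at W 1) m n \<alpha> e) = act (space_at W 0) m n \<alpha> (hvertex W 1 i n e)" if "i \<le> 1" for i
    by (rule sset_map_act[OF hvertex_map[OF that] *(1) e])
  moreover have "act (space_at W 0) m n \<alpha> (vconst W 0 n z) = vconst W 0 m z" if "z \<in> bsimp W 0 0" for z
    unfolding vconst_def by (rule sset.act_const_simp[OF sset_space_at *(1)]) (simp add: space_at_simps that)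
  ultimately show "act (space_at W 1) m n \<alpha> e \<in> simp (css_Map W x y) m"
    using *(2) sset.act_in[OF sset_space_at *(1) e] assms by (simp add: css_Map_def space_at_simps)
qed

end

section \<open>Consequences of Reedy fibrancy\<close>

locale segal_space = simp_space +
  assumes reedy: "reedy_fibrant W" and segal: "segal W"
begin

abbreviation "v0 n \<equiv> vertex (space_at W n) 1 0"
abbreviation "v1 n \<equiv> vertex (space_at W n) 1 1"

text \<open>The fibration to the matching object with its target spelled out: a horn in the spatial
  direction can be filled as soon as compatible fillers \<open>b\<close> of its categorical faces
  are given.\<close>

lemma reedy_fill:
  assumes "1 \<le> N" "k \<le> N" and y: "horn (space_at W n) N k y"
    and b: "\<And>l. l \<in> matching_index n \<Longrightarrow> b l \<in> bsimp W (n - 1) N"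
    and compat: "\<And>i j. 2 \<le> n \<Longrightarrow> i < j \<Longrightarrow> j \<le> n \<Longrightarrow> hface W (n - 1) i N (b j) = hface W (n - 1) (j - 1) N (b i)"
    and faces: "\<And>i l. i \<le> N \<Longrightarrow> i \<noteq> k \<Longrightarrow> l \<in> matching_index n \<Longrightarrow>
      face (space_at W (n - 1)) N i (b l) = hface W n l (N - 1) (y i)"
  obtains x where "x \<in> bsimp W n N" "\<And>l. l \<in> matching_index n \<Longrightarrow> hface W n l N x = b l"
    "\<And>i. i \<le> N \<Longrightarrow> i \<noteq> k \<Longrightarrow> face (space_at W n) N i x = y i"
proof -
  let ?p = "\<lambda>k w. \<lambda>i\<in>matching_index n. hface W n i k w" and ?b = "restrict b (matching_index n)"
  have p: "kan_fibration (space_at W n) (matching W n) ?p"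
    using reedy by (simp add: reedy_fibrant_def)
  have "?b \<in> simp (matching W n) N"
    using b compat by (auto simp: matching_def matching_index_def)
  moreover have "face (matching W n) N i ?b = ?p (N - 1) (y i)" if "i \<le> N" "i \<noteq> k" for i
    using faces[OF that] by (auto simp: matching_def face_def intro!: restrict_ext)
  ultimately have "\<exists>x\<in>simp (space_at W n) N. ?p N x = ?b \<and> (\<forall>i\<le>N. i \<noteq> k \<longrightarrow> face (space_at W n) N i x = y i)"
    by (intro kan_fibration_lift[OF p] assms)
  then obtain x where x: "x \<in> bsimp W n N" "?p N x = ?b" "\<And>i. i \<le> N \<Longrightarrow> i \<noteq> k \<Longrightarrow> face (space_at W n) N i x = y i"
    by (auto simp: space_at_simps)
  have "hface W n l N x = b l" if "l \<in> matching_index n" for l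
    using fun_cong[OF x(2), of l] that by simp
  with x show thesis by (intro that) auto
qed

text \<open>Path lifting for the boundary map in degree 2. The lift starts at \<open>w\<close>, and
  only its boundary is recorded.\<close>

lemma reedy_path_2:
  assumes w: "w \<in> bsimp W 2 0" and b: "\<And>l. l \<le> 2 \<Longrightarrow> b l \<in> bsimp W 1 1"
    and compat: "\<And>i j. i < j \<Longrightarrow> j \<le> 2 \<Longrightarrow> hface W 1 i 1 (b j) = hface W 1 (j - 1) 1 (b i)"
    and v0: "\<And>l. l \<le> 2 \<Longrightarrow> v0 1 (b l) = hface W 2 l 0 w"
  obtains x where "x \<in> bsimp W 2 1" "\<And>l. l \<le> 2 \<Longrightarrow> hface W 2 l 1 x = b l"
proof -
  have "horn (space_at W 2) 1 0 (\<lambda>_. w)" using w by (simp add: horn_def space_at_simps)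
  then show thesis
  proof (rule reedy_fill[rotated 2, where b=b and n=2])
    fix i l assume "i \<le> (1::nat)" "i \<noteq> 0" "l \<in> matching_index 2"
    then have "i = 1" "l \<le> 2" by (auto simp: matching_index_def)
    then show "face (space_at W (2 - 1)) 1 i (b l) = hface W 2 l (1 - 1) w"
      using v0[of l] sset.face_1(2)[OF sset_space_at, of "b l" 1] b[of l] by (simp add: space_at_simps)
  qed (use b compat that in \<open>auto simp: matching_index_def\<close>)
qed

lemma kan_space_0: "kan_complex (space_at W 0)"
  unfolding kan_complex_def
proof (intro conjI allI impI)
  show "simplicial_set (space_at W 0)" by (rule sset.simplicial[OF sset_space_at])
  fix N k y assume *: "1 \<le> N \<and> k \<le> N \<and> horn (space_at W 0) N k y"
  show "\<exists>x\<in>simp (space_at W 0) N. \<forall>i\<le>N. i \<noteq> k \<longrightarrow> face (space_at W 0) N i x = y i"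
    by (rule reedy_fill[of N k 0 y]) (use * in \<open>auto simp: matching_index_def space_at_simps\<close>)
qed

lemma fill_1:
  assumes "1 \<le> N" "k \<le> N" and y: "horn (space_at W 1) N k y"
    and b: "s \<in> bsimp W 0 N" "t \<in> bsimp W 0 N"
    and faces: "\<And>i. i \<le> N \<Longrightarrow> i \<noteq> k \<Longrightarrow> face (space_at W 0) N i s = hvertex W 1 0 (N - 1) (y i)"
      "\<And>i. i \<le> N \<Longrightarrow> i \<noteq> k \<Longrightarrow> face (space_at W 0) N i t = hvertex W 1 1 (N - 1) (y i)"
  obtains x where "x \<in> bsimp W 1 N" "hvertex W 1 0 N x = s" "hvertex W 1 1 N x = t"
    "\<And>i. i \<le> N \<Longrightarrow> i \<noteq> k \<Longrightarrow> face (space_at W 1) N i x = y i"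
\<comment> \<open>The matching object in degree 1 consists of pairs of objects: face 0 is the target
  \<open>t\<close>, face 1 the source \<open>s\<close>.\<close>
proof (rule reedy_fill[OF assms(1-3), where b="\<lambda>l::nat. if l = 0 then t else s"])
  have yi: "y i \<in> bsimp W 1 (N - 1)" if "i \<le> N" "i \<noteq> k" for i
    using y that by (auto simp: horn_def space_at_simps)
  fix i l assume i: "i \<le> N" "i \<noteq> k" and l: "l \<in> matching_index 1"
  show "face (space_at W (1 - 1)) N i (if l = 0 then t else s) = hface W 1 l (N - 1) (y i)"
    using faces[OF i] hface_1[OF yi[OF i]] l by (auto simp: matching_index_def le_Suc_eq)
next
  fix x assume x: "x \<in> bsimp W 1 N" "\<And>l. l \<in> matching_index 1 \<Longrightarrow> hface W 1 l N x = (if l = 0 then t else s)"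
    and f: "\<And>i. i \<le> N \<Longrightarrow> i \<noteq> k \<Longrightarrow> face (space_at W 1) N i x = y i"
  have "hvertex W 1 0 N x = s" "hvertex W 1 1 N x = t"
    using x(2)[of 0] x(2)[of 1] hface_1[OF x(1)] by (simp_all add: matching_index_def)
  then show thesis using x(1) f that by blast
qed (use b in \<open>auto simp: matching_index_def\<close>)

lemma css_Map_edges_iff:
  assumes "x \<in> bsimp W 0 0" "y \<in> bsimp W 0 0"
  shows "e \<in> edges (css_Map W x y) f g \<longleftrightarrow> e \<in> bsimp W 1 1 \<and> hvertex W 1 0 1 e = vconst W 0 1 x \<and>
     hvertex W 1 1 1 e = vconst W 0 1 y \<and> v0 1 e = f \<and> v1 1 e = g"
  by (auto simp: edges_def css_Map_def vertex_def)

text \<open>The mapping space is a fibre of the Kan fibration sending an edge to its source and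
  target, so horns are filled with both end points held constant.\<close>

lemma kan_css_Map:
  assumes xy: "x \<in> bsimp W 0 0" "y \<in> bsimp W 0 0" shows "kan_complex (css_Map W x y)"
  unfolding kan_complex_def
proof (intro conjI allI impI)
  show "simplicial_set (css_Map W x y)" by (rule sset.simplicial[OF sset_css_Map[OF xy]])
  fix N k z assume *: "1 \<le> N \<and> k \<le> N \<and> horn (css_Map W x y) N k z"
  have h: "horn (space_at W 1) N k z" using * by (auto simp: horn_def css_Map_def space_at_simps face_def)
  have f: "face (space_at W 0) N i (vconst W 0 N u) = vconst W 0 (N - 1) u" if "u \<in> bsimp W 0 0" for i u
    using * that
    by (cases N)
      (simp_all add: face_def vconst_def space_at_simps(1) sset.act_const_simp[OF sset_space_at coface_ord_maps])
  have zi: "hvertex W 1 0 (N - 1) (z i) = vconst W 0 (N - 1) x" "hvertex W 1 1 (N - 1) (z i) = vconst W 0 (N - 1) y"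
    if "i \<le> N" "i \<noteq> k" for i
    using * that by (auto simp: horn_def css_Map_def)
  obtain w where "w \<in> bsimp W 1 N" "hvertex W 1 0 N w = vconst W 0 N x" "hvertex W 1 1 N w = vconst W 0 N y"
    "\<And>i. i \<le> N \<Longrightarrow> i \<noteq> k \<Longrightarrow> face (space_at W 1) N i w = z i"
    by (rule fill_1[OF _ _ h vconst_in[OF xy(1)] vconst_in[OF xy(2)]]) (use * f xy zi in auto)
  then show "\<exists>w\<in>simp (css_Map W x y) N. \<forall>i\<le>N. i \<noteq> k \<longrightarrow> face (css_Map W x y) N i w = z i"
    by (intro bexI[of _ w]) (auto simp: css_Map_def face_def)
qed

lemma tri_vertex:
  assumes x: "x \<in> bsimp W 2 1" and i: "i \<le> 1"
  shows "tri (row W 0) (vertex (space_at W 1) 1 i (hface W 2 2 1 x)) (vertex (space_at W 1) 1 i (hface W 2 0 1 x))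
    (vertex (space_at W 1) 1 i (hface W 2 1 1 x))"
proof -
  have x': "x \<in> simp (space_at W 2) 1" using x by (simp add: space_at_simps)
  have "vertex (space_at W 1) 1 i (hface W 2 l 1 x) = hface W 2 l 0 (vertex (space_at W 2) 1 i x)" for l
    using sset_map_vertex[OF hface_map[of 1 l], of x 1 i] x' i by (simp add: numeral_2_eq_2)
  moreover have "vertex (space_at W 2) 1 i x \<in> bsimp W 2 0"
    using sset.vertex_in[OF sset_space_at x' i] by (simp add: space_at_simps)
  ultimately show ?thesis by (auto simp: tri_def row_simps)
qed

text \<open>Homotopies of the three edges form a path of boundaries, which lifts to a path of
  2-simplices; the end of that path has the new edges. Hence the strict relation \<open>tri\<close>
  depends only on path components.\<close>

lemma tri_path:
  assumes obj: "x \<in> bsimp W 0 0" "y \<in> bsimp W 0 0" "z \<in> bsimp W 0 0"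
    and t: "tri (row W 0) a b c"
    and p: "same_path_component (css_Map W x y) a a'" "same_path_component (css_Map W y z) b b'"
      "same_path_component (css_Map W x z) c c'"
  shows "tri (row W 0) a' b' c'"
proof -
  obtain d where d: "d \<in> edges (css_Map W x y) a a'" using kan_path_edge[OF kan_css_Map[OF obj(1,2)] p(1)] by blast
  obtain e where e: "e \<in> edges (css_Map W y z) b b'" using kan_path_edge[OF kan_css_Map[OF obj(2,3)] p(2)] by blast
  obtain f where f: "f \<in> edges (css_Map W x z) c c'" using kan_path_edge[OF kan_css_Map[OF obj(1,3)] p(3)] by blast
  note def = d[unfolded css_Map_edges_iff[OF obj(1,2)]] e[unfolded css_Map_edges_iff[OF obj(2,3)]]
    f[unfolded css_Map_edges_iff[OF obj(1,3)]]
  obtain w where w: "w \<in> bsimp W 2 0" "hface W 2 2 0 w = a" "hface W 2 0 0 w = b" "hface W 2 1 0 w = c"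
    using t by (auto simp: tri_def row_simps)
  let ?b = "\<lambda>l::nat. if l = 0 then e else if l = 1 then f else d"
  obtain v where v: "v \<in> bsimp W 2 1" "\<And>l. l \<le> 2 \<Longrightarrow> hface W 2 l 1 v = ?b l"
  proof (rule reedy_path_2[OF w(1), of ?b])
    fix i j :: nat assume "i < j" "j \<le> 2"
    then have "i = 0 \<and> j = 1 \<or> i = 0 \<and> j = 2 \<or> i = 1 \<and> j = 2" by auto
    then show "hface W 1 i 1 (?b j) = hface W 1 (j - 1) 1 (?b i)"
      using def by (auto simp: hface_1[simplified])
  qed (use def w in \<open>auto simp: le_2_cases\<close>)
  from tri_vertex[OF v(1), of 1] v(2)[of 0] v(2)[of 1] v(2)[of 2] def show ?thesis by simp
qed

section \<open>The Segal map in degree two as a trivial fibration\<close>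

lemma spine_simps:
  "y \<in> simp (spine W n) k \<longleftrightarrow> y \<in> PiE {..<n} (\<lambda>_. bsimp W 1 k) \<and>
     (\<forall>i. i + 1 < n \<longrightarrow> hvertex W 1 1 k (y i) = hvertex W 1 0 k (y (i + 1)))"
  "act (spine W n) j k \<beta> y = (\<lambda>i\<in>{..<n}. act (space_at W 1) j k \<beta> (y i))"
  "face (spine W n) k j y = (\<lambda>i\<in>{..<n}. face (space_at W 1) k j (y i))"
  "vertex (spine W n) k j y = (\<lambda>i\<in>{..<n}. vertex (space_at W 1) k j (y i))"
  by (auto simp: spine_def face_def vertex_def)

lemma spine_entry: "y \<in> simp (spine W n) k \<Longrightarrow> i < n \<Longrightarrow> y i \<in> bsimp W 1 k"
  unfolding spine_simps by blast

lemma spine_adjacent: "y \<in> simp (spine W n) k \<Longrightarrow> Suc i < n \<Longrightarrow> hvertex W 1 1 k (y i) = hvertex W 1 0 k (y (Suc i))"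
  unfolding spine_simps by simp

lemma sset_spine: "sset (spine W n)"
proof (rule sub_sset)
  let ?S = "sset_Pi {..<n} (\<lambda>_. space_at W 1)"
  show S: "sset ?S" by (rule sset_Pi[OF sset_space_at])
  show "act (spine W n) = act ?S" by (simp add: spine_simps sset_Pi_simps fun_eq_iff)
  show s: "simp (spine W n) k \<subseteq> simp ?S k" for k
    by (auto simp: spine_simps sset_Pi_simps space_at_simps)
  fix j k \<beta> y assume *: "\<beta> \<in> ord_maps j k" "y \<in> simp (spine W n) k"
  have "hvertex W 1 l j (act (space_at W 1) j k \<beta> (y i)) = act (space_at W 0) j k \<beta> (hvertex W 1 l k (y i))"
    if "i < n" "l \<le> 1" for i l
    by (rule sset_map_act[OF hvertex_map[OF that(2)] *(1)])
      (use spine_entry[OF *(2) that(1)] in \<open>simp add: space_at_simps\<close>)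
  then show "act ?S j k \<beta> y \<in> simp (spine W n) j"
    using sset.act_in[OF S *(1)] s *(2) by (auto simp: spine_simps sset_Pi_simps space_at_simps)
qed

definition spine_map :: "nat \<Rightarrow> nat \<Rightarrow> 'a \<Rightarrow> nat \<Rightarrow> 'a" where
  "spine_map n = (\<lambda>k w. \<lambda>i\<in>{..<n}. hact W 1 n (\<lambda>r. i + r) k w)"

definition pair :: "'a \<Rightarrow> 'a \<Rightarrow> nat \<Rightarrow> 'a" where
  "pair a b = (\<lambda>i\<in>{..<2}. if i = 0 then a else b)"

lemma pair_eq_iff: "pair a b = pair c d \<longleftrightarrow> a = c \<and> b = d"
proof
  assume "pair a b = pair c d"
  from fun_cong[OF this, of 0] fun_cong[OF this, of 1] show "a = c \<and> b = d"
    by (simp add: pair_def)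
qed simp

lemma pair_eta: "y \<in> extensional {..<2} \<Longrightarrow> pair (y 0) (y 1) = y"
  by (auto simp: pair_def fun_eq_iff extensional_def less_2_cases_iff)

lemma spine_2_iff: "y \<in> simp (spine W 2) k \<longleftrightarrow>
    (\<exists>a\<in>bsimp W 1 k. \<exists>b\<in>bsimp W 1 k. y = pair a b \<and> hvertex W 1 1 k a = hvertex W 1 0 k b)"
proof
  assume y: "y \<in> simp (spine W 2) k"
  then have "y \<in> extensional {..<2}" by (simp add: spine_simps PiE_iff)
  then have e: "y = pair (y 0) (y 1)" by (rule pair_eta[symmetric])
  have "y 0 \<in> bsimp W 1 k" "y 1 \<in> bsimp W 1 k" "hvertex W 1 1 k (y 0) = hvertex W 1 0 k (y 1)"
    using spine_entry[OF y] spine_adjacent[OF y, of 0] by simp_all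
  with e show "\<exists>a\<in>bsimp W 1 k. \<exists>b\<in>bsimp W 1 k. y = pair a b \<and> hvertex W 1 1 k a = hvertex W 1 0 k b"
    by blast
qed (auto simp: spine_simps pair_def split: if_splits)

lemma pair_simps:
  "face (spine W 2) k j (pair a b) = pair (face (space_at W 1) k j a) (face (space_at W 1) k j b)"
  "act (spine W 2) j k \<beta> (pair a b) = pair (act (space_at W 1) j k \<beta> a) (act (space_at W 1) j k \<beta> b)"
  by (auto simp: spine_simps pair_def)

lemma spine_map_2: 
  assumes w: "w \<in> bsimp W 2 k" shows "spine_map 2 k w = pair (hface W 2 2 k w) (hface W 2 0 k w)"
proof -
  have o: "(+) i \<in> ord_maps 1 2" if "i \<le> 1" for i using that by (auto simp: ord_maps_def)
  have "hact W 1 2 ((+) 0) k w = hface W 2 2 k w" "hact W 1 2 ((+) 1) k w = hface W 2 0 k w"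
    using sset.act_cong[OF sset_row o, of 0 w k "coface 2"] sset.act_cong[OF sset_row o, of 1 w k "coface 0"] w
    by (auto simp: row_simps hface_def coface_def)
  then show ?thesis by (auto simp: spine_map_def pair_def less_2_cases_iff intro!: restrict_ext)
qed

text \<open>From a spine to a full boundary only the edge 02 is missing. It can be filled because
  the source-target map is a fibration, and the boundary map then lifts the rest.\<close>

lemma kan_fibration_spine_2: "kan_fibration (space_at W 2) (spine W 2) (spine_map 2)"
  unfolding kan_fibration_def
proof (intro conjI allI ballI impI)
  have f: "hvertex W 1 1 k (hface W 2 2 k w) = hvertex W 1 0 k (hface W 2 0 k w)" if "w \<in> bsimp W 2 k" for w k
    using hface_hface_2[OF that, of 0 2] hface_1 hface_in_2[OF that] by simp
  have h2: "sset_map (space_at W 2) (space_at W 1) (hface W 2 l)" for l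
    using hface_map[of 1 l] by (simp add: numeral_2_eq_2)
  show "sset_map (space_at W 2) (spine W 2) (spine_map 2)"
    unfolding sset_map_def
  proof (intro conjI allI ballI)
    fix k w assume w: "w \<in> simp (space_at W 2) k"
    then show "spine_map 2 k w \<in> simp (spine W 2) k"
      using hface_in_2 f by (auto simp: space_at_simps spine_map_2 spine_2_iff pair_eq_iff)
    fix j \<beta> assume "\<beta> \<in> ord_maps j k"
    then show "spine_map 2 j (act (space_at W 2) j k \<beta> w) = act (spine W 2) j k \<beta> (spine_map 2 k w)"
      using w sset_map_act[OF h2, of \<beta> j k w] sset.act_in[OF sset_space_at, of \<beta> j k w 2]
      by (simp add: space_at_simps(1) spine_map_2 pair_simps)
  qed
  fix N k y b
  assume b: "b \<in> simp (spine W 2) N"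
    and *: "1 \<le> N \<and> k \<le> N \<and> horn (space_at W 2) N k y \<and>
      (\<forall>i\<le>N. i \<noteq> k \<longrightarrow> face (spine W 2) N i b = spine_map 2 (N - 1) (y i))"
  obtain d e where de: "d \<in> bsimp W 1 N" "e \<in> bsimp W 1 N" "b = pair d e" "hvertex W 1 1 N d = hvertex W 1 0 N e"
    using b by (auto simp: spine_2_iff)
  obtain M where M: "N = Suc M" using * by (cases N) auto
  have y: "y i \<in> bsimp W 2 M" "face (space_at W 1) N i d = hface W 2 2 M (y i)"
    "face (space_at W 1) N i e = hface W 2 0 M (y i)" if "i \<le> N" "i \<noteq> k" for i
  proof -
    show y: "y i \<in> bsimp W 2 M" using * that M by (auto simp: horn_def space_at_simps)
    have "face (spine W 2) N i b = spine_map 2 M (y i)" using * that M by auto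
    then show "face (space_at W 1) N i d = hface W 2 2 M (y i)" "face (space_at W 1) N i e = hface W 2 0 M (y i)"
      by (simp_all add: de(3) pair_simps spine_map_2[OF y] pair_eq_iff)
  qed
  have horn1: "horn (space_at W 1) N k (\<lambda>i. hface W 2 1 M (y i))"
    using horn_map[OF h2, of N k y 1] * M by simp
  have vf: "face (space_at W 0) N i (hvertex W 1 l N u) = hvertex W 1 l M (face (space_at W 1) N i u)"
    if "u \<in> bsimp W 1 N" "l \<le> 1" for u i l
    using sset_map_face[OF hvertex_map[OF that(2)], of u M i] that M by (simp add: space_at_simps)
  have vv: "hvertex W 1 0 M (hface W 2 2 M w) = hvertex W 1 0 M (hface W 2 1 M w)"
    "hvertex W 1 1 M (hface W 2 0 M w) = hvertex W 1 1 M (hface W 2 1 M w)" if "w \<in> bsimp W 2 M" for w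
    using hface_hface_2[OF that, of 1 2] hface_hface_2[OF that, of 0 1] hface_1 hface_in_2[OF that] by simp_all
  have fde: "face (space_at W 0) N i (hvertex W 1 0 N d) = hvertex W 1 0 M (hface W 2 1 M (y i))"
    "face (space_at W 0) N i (hvertex W 1 1 N e) = hvertex W 1 1 M (hface W 2 1 M (y i))"
    if "i \<le> N" "i \<noteq> k" for i
    using vf[OF de(1), of 0 i] vf[OF de(2), of 1 i] y[OF that] vv by simp_all
  \<comment> \<open>The edge 02, from the source of \<open>d\<close> to the target of
    \<open>e\<close>, extending the given middle faces.\<close>
  obtain m where m: "m \<in> bsimp W 1 N" "hvertex W 1 0 N m = hvertex W 1 0 N d" "hvertex W 1 1 N m = hvertex W 1 1 N e"
    "\<And>i. i \<le> N \<Longrightarrow> i \<noteq> k \<Longrightarrow> face (space_at W 1) N i m = hface W 2 1 M (y i)"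
    by (rule fill_1[OF _ _ horn1 hvertex_in[OF de(1), of 0] hvertex_in[OF de(2), of 1]]) (use * fde M in auto)
  let ?b = "\<lambda>l::nat. if l = 0 then e else if l = 1 then m else d"
  obtain x where x: "x \<in> bsimp W 2 N" "\<And>l. l \<in> matching_index 2 \<Longrightarrow> hface W 2 l N x = ?b l"
    "\<And>i. i \<le> N \<Longrightarrow> i \<noteq> k \<Longrightarrow> face (space_at W 2) N i x = y i"
  proof (rule reedy_fill[of N k 2 y ?b])
    fix i j :: nat assume "i < j" "j \<le> 2"
    then have "i = 0 \<and> j = 1 \<or> i = 0 \<and> j = 2 \<or> i = 1 \<and> j = 2" by auto
    then show "hface W (2 - 1) i N (?b j) = hface W (2 - 1) (j - 1) N (?b i)"
      using m de by (auto simp: hface_1[simplified])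
  next
    fix i l assume "i \<le> N" "i \<noteq> k" "l \<in> matching_index 2"
    then show "face (space_at W (2 - 1)) N i (?b l) = hface W 2 l (N - 1) (y i)"
      using y m(4) M by (auto simp: matching_index_def le_2_cases)
  qed (use * de m in \<open>auto simp: matching_index_def\<close>)
  have "spine_map 2 N x = b"
    using x(2)[of 0] x(2)[of 2] by (simp add: spine_map_2[OF x(1)] de(3) matching_index_def)
  then show "\<exists>x\<in>simp (space_at W 2) N. spine_map 2 N x = b \<and> (\<forall>i\<le>N. i \<noteq> k \<longrightarrow> face (space_at W 2) N i x = y i)"
    using x by (intro bexI[of _ x]) (auto simp: space_at_simps)
qed

text \<open>The three vertices are filled before the edges, so that both edges are built with the
  same middle vertex \<open>q\<close>.\<close>

lemma kan_spine_2: "kan_complex (spine W 2)"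
  unfolding kan_complex_def
proof (intro conjI allI impI)
  show "simplicial_set (spine W 2)" by (rule sset.simplicial[OF sset_spine])
  fix N k y assume *: "1 \<le> N \<and> k \<le> N \<and> horn (spine W 2) N k y"
  obtain M where M: "N = Suc M" using * by (cases N) auto
  have y: "y i \<in> simp (spine W 2) M" if "i \<le> N" "i \<noteq> k" for i
    using * that M by (auto simp: horn_def)
  have pr: "sset_map (spine W 2) (space_at W 1) (\<lambda>k y. y l)" if "l < 2" for l
    using that by (auto simp: sset_map_def spine_simps space_at_simps(1) PiE_iff)
  have h1: "horn (space_at W 1) N k (\<lambda>i. y i l)" if "l < 2" for l
    using horn_map[OF pr[OF that]] * by blast
  have h0: "horn (space_at W 0) N k (\<lambda>i. hvertex W 1 r M (y i l))" if "l < 2" "r \<le> 1" for l r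
    using horn_map[OF hvertex_map[OF that(2)] h1[OF that(1)]] * M by simp
  have f0: "\<exists>x\<in>bsimp W 0 N. \<forall>i\<le>N. i \<noteq> k \<longrightarrow> face (space_at W 0) N i x = hvertex W 1 r M (y i l)"
    if "l < 2" "r \<le> 1" for l r
    using kan_fill[OF kan_space_0 _ _ h0[OF that]] * by (auto simp: space_at_simps)
  obtain p where p: "p \<in> bsimp W 0 N" "\<And>i. i \<le> N \<Longrightarrow> i \<noteq> k \<Longrightarrow> face (space_at W 0) N i p = hvertex W 1 0 M (y i 0)"
    using f0[of 0 0] by auto
  obtain q where q: "q \<in> bsimp W 0 N" "\<And>i. i \<le> N \<Longrightarrow> i \<noteq> k \<Longrightarrow> face (space_at W 0) N i q = hvertex W 1 1 M (y i 0)"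
    using f0[of 0 1] by auto
  obtain r where r: "r \<in> bsimp W 0 N" "\<And>i. i \<le> N \<Longrightarrow> i \<noteq> k \<Longrightarrow> face (space_at W 0) N i r = hvertex W 1 1 M (y i 1)"
    using f0[of 1 1] by auto
  have q': "face (space_at W 0) N i q = hvertex W 1 0 M (y i 1)" if "i \<le> N" "i \<noteq> k" for i
    using q(2)[OF that] spine_adjacent[OF y[OF that], of 0] by simp
  obtain a where a: "a \<in> bsimp W 1 N" "hvertex W 1 1 N a = q"
    "\<And>i. i \<le> N \<Longrightarrow> i \<noteq> k \<Longrightarrow> face (space_at W 1) N i a = y i 0"
    by (rule fill_1[OF _ _ h1[of 0] p(1) q(1)]) (use * M p q in auto)
  obtain b where b: "b \<in> bsimp W 1 N" "hvertex W 1 0 N b = q"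
    "\<And>i. i \<le> N \<Longrightarrow> i \<noteq> k \<Longrightarrow> face (space_at W 1) N i b = y i 1"
    by (rule fill_1[OF _ _ h1[of 1] q(1) r(1)]) (use * M q' r in auto)
  have "face (spine W 2) N i (pair a b) = y i" if "i \<le> N" "i \<noteq> k" for i
  proof -
    have "y i \<in> extensional {..<2}" using y[OF that] by (simp add: spine_simps PiE_iff)
    then show ?thesis
      unfolding pair_simps(1) a(3)[OF that] b(3)[OF that] by (rule pair_eta)
  qed
  then show "\<exists>x\<in>simp (spine W 2) N. \<forall>i\<le>N. i \<noteq> k \<longrightarrow> face (spine W 2) N i x = y i"
    using a b by (intro bexI[of _ "pair a b"]) (auto simp: spine_2_iff pair_eq_iff)
qed

lemma kan_space_2: "kan_complex (space_at W 2)"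
  by (rule kan_fibration_total[OF kan_fibration_spine_2 kan_spine_2 sset_space_at])

lemma spine_equivalence: "2 \<le> n \<Longrightarrow> homotopy_equivalence (space_at W n) (spine W n) (spine_map n)"
  using segal by (simp add: segal_def spine_map_def)

lemma row_edges: "a \<in> edges (row W 0) x y \<longleftrightarrow> a \<in> bsimp W 1 0 \<and> hvertex W 1 0 0 a = x \<and> hvertex W 1 1 0 a = y"
  by (auto simp: edges_def row_simps)

text \<open>The Segal map is a fibration and an equivalence, hence surjective on vertices: a
  composable pair is the spine of a 2-simplex on the nose.\<close>

lemma tri_exists:
  assumes "a \<in> edges (row W 0) x y" "b \<in> edges (row W 0) y z" shows "\<exists>c. tri (row W 0) a b c"
proof -
  have "pair a b \<in> simp (spine W 2) 0" using assms by (auto simp: spine_2_iff row_edges pair_eq_iff)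
  then obtain w where w: "w \<in> bsimp W 2 0" "spine_map 2 0 w = pair a b"
    using trivial_fibration_surj[OF kan_fibration_spine_2 sset_space_at sset_spine spine_equivalence[OF order_refl]]
    by (auto simp: space_at_simps)
  then show ?thesis by (auto simp: spine_map_2 pair_eq_iff tri_def row_simps)
qed

text \<open>Two fillers of one spine lie in one fibre of the trivial fibration and are joined by a
  path over the constant spine. The middle face of that path moves from \<open>c\<close> to
  \<open>c'\<close> with fixed end points.\<close>

lemma tri_unique_path:
  assumes "tri (row W 0) a b c" "tri (row W 0) a b c'" "c \<in> edges (row W 0) x z"
  shows "same_path_component (css_Map W x z) c c'"
proof -
  obtain w w' where w: "w \<in> bsimp W 2 0" "hface W 2 2 0 w = a" "hface W 2 0 0 w = b" "hface W 2 1 0 w = c"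
    and w': "w' \<in> bsimp W 2 0" "hface W 2 2 0 w' = a" "hface W 2 0 0 w' = b" "hface W 2 1 0 w' = c'"
    using assms(1,2) by (auto simp: tri_def row_simps)
  obtain e where e: "e \<in> edges (space_at W 2) w w'" "spine_map 2 1 e = const_simp (spine W 2) 1 (pair a b)"
    by (rule trivial_fibration_fibre[OF kan_fibration_spine_2 kan_space_2 kan_spine_2 spine_equivalence[OF order_refl],
        of w w' "pair a b"]) (use w w' in \<open>auto simp: space_at_simps spine_map_2\<close>)
  then have e1: "e \<in> bsimp W 2 1" by (simp add: edges_def space_at_simps)
  have ab: "a \<in> bsimp W 1 0" "b \<in> bsimp W 1 0" using w hface_in_2 by auto
  have xz: "x \<in> bsimp W 0 0" "z \<in> bsimp W 0 0"
    using assms(3) hvertex_in by (auto simp: row_edges)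
  have "hface W 2 2 1 e = vconst W 1 1 a" "hface W 2 0 1 e = vconst W 1 1 b"
    using e(2) by (simp_all add: spine_map_2[OF e1, simplified] const_simp_def pair_simps pair_eq_iff vconst_def)
  moreover have "hvertex W 1 0 1 (hface W 2 1 1 e) = hvertex W 1 0 1 (hface W 2 2 1 e)"
    "hvertex W 1 1 1 (hface W 2 1 1 e) = hvertex W 1 1 1 (hface W 2 0 1 e)"
    using hface_hface_2[OF e1, of 1 2] hface_hface_2[OF e1, of 0 1] hface_1 hface_in_2[OF e1] by simp_all
  moreover have "hvertex W 1 0 0 a = x" "hvertex W 1 1 0 b = z"
    using hface_hface_2[OF w(1), of 1 2] hface_hface_2[OF w(1), of 0 1] hface_1 ab w assms(3)
    by (simp_all add: row_edges)
  ultimately have "hvertex W 1 0 1 (hface W 2 1 1 e) = vconst W 0 1 x" "hvertex W 1 1 1 (hface W 2 1 1 e) = vconst W 0 1 z"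
    using ab by (simp_all add: hvertex_vconst)
  moreover have "hface W 2 1 1 e \<in> edges (space_at W 1) c c'"
    using sset_map_edges[OF hface_map[of 1 1], of e w w'] e(1) w w' by (simp add: numeral_2_eq_2)
  ultimately have "hface W 2 1 1 e \<in> edges (css_Map W x z) c c'"
    unfolding css_Map_edges_iff[OF xz] by (simp add: edges_def space_at_simps(1))
  then show ?thesis by (rule same_path_component_edge[OF sset_css_Map[OF xz]])
qed

lemma spine_2_lift:
  assumes w: "w \<in> bsimp W 2 0" and "d \<in> bsimp W 1 1" "e \<in> bsimp W 1 1" "hvertex W 1 1 1 d = hvertex W 1 0 1 e"
    and "v0 1 d = hface W 2 2 0 w" "v0 1 e = hface W 2 0 0 w"
  obtains x where "x \<in> bsimp W 2 1" "hface W 2 2 1 x = d" "hface W 2 0 1 x = e" "v0 2 x = w"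
proof -
  have "pair d e \<in> edges (spine W 2) (spine_map 2 0 w) (vertex (spine W 2) 1 1 (pair d e))"
    using assms by (auto simp: edges_def spine_2_iff pair_eq_iff spine_map_2 vertex_def pair_simps)
  then obtain x where "x \<in> bsimp W 2 1" "spine_map 2 1 x = pair d e" "v0 2 x = w"
    using kan_fibration_lift_edge[OF kan_fibration_spine_2 sset_space_at sset_spine] w
    by (metis space_at_simps(1))
  then show thesis using that by (simp add: spine_map_2 pair_eq_iff)
qed

lemma spine_map_3: 
  assumes w: "w \<in> bsimp W 3 k"
  shows "spine_map 3 k w 0 = hface W 2 2 k (hface W 3 3 k w)" "spine_map 3 k w 1 = hface W 2 0 k (hface W 3 3 k w)"
    "spine_map 3 k w 2 = hface W 2 0 k (hface W 3 0 k w)"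
proof -
  have c: "coface i \<in> ord_maps 1 2" "coface i \<in> ord_maps 2 3" for i
    using coface_ord_maps[of i 1] coface_ord_maps[of i 2] by (simp_all add: numeral_2_eq_2 numeral_3_eq_3)
  have "act (row W k) 1 2 (coface i) (act (row W k) 2 3 (coface j) w) = act (row W k) 1 3 ((+) l) w"
    if "(i, j, l) \<in> {(2, 3, 0), (0, 3, 1), (0, 0, 2)}" for i j l
    by (rule sset.act_act_cong[OF sset_row c]) (use w that in \<open>auto simp: row_simps coface_def\<close>)
  from this[of 2 3 0] this[of 0 3 1] this[of 0 0 2]
  show "spine_map 3 k w 0 = hface W 2 2 k (hface W 3 3 k w)" "spine_map 3 k w 1 = hface W 2 0 k (hface W 3 3 k w)"
    "spine_map 3 k w 2 = hface W 2 0 k (hface W 3 0 k w)"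
    by (simp_all add: spine_map_def hface_def row_simps)
qed

text \<open>A 3-simplex with a given spine up to homotopy is transported along the homotopy, one face
  after the other.\<close>

lemma tetrahedron:
  assumes abc: "a \<in> edges (row W 0) x y" "b \<in> edges (row W 0) y z" "c \<in> edges (row W 0) z u"
  shows "\<exists>e f g. tri (row W 0) a b e \<and> tri (row W 0) b c f \<and> tri (row W 0) e c g \<and> tri (row W 0) a f g"
proof -
  let ?t = "\<lambda>i\<in>{..<3::nat}. if i = 0 then a else if i = 1 then b else c"
  have "?t \<in> simp (spine W 3) 0"
    using abc by (auto simp: spine_simps row_edges less_Suc_eq numeral_3_eq_3)
  \<comment> \<open>In degree 3 the spine is reached only up to the path \<open>\<beta>\<close>; the
    triangles wanted are found at its end.\<close>
  then obtain w \<beta> where "w \<in> simp (space_at W 3) 0" and \<beta>: "\<beta> \<in> edges (spine W 3) (spine_map 3 0 w) ?t"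
    by (rule homotopy_equivalence_surj[OF sset_spine spine_equivalence[of 3, simplified]])
  then have w: "w \<in> bsimp W 3 0" by (simp add: space_at_simps)
  have \<beta>1: "\<beta> i \<in> bsimp W 1 1" if "i < 3" for i using \<beta> that spine_entry[of \<beta> 3 1 i] by (simp add: edges_def)
  have \<beta>v: "hvertex W 1 1 1 (\<beta> 0) = hvertex W 1 0 1 (\<beta> 1)" "hvertex W 1 1 1 (\<beta> 1) = hvertex W 1 0 1 (\<beta> 2)"
    using \<beta> spine_adjacent[of \<beta> 3 1 0] spine_adjacent[of \<beta> 3 1 1] by (simp_all add: edges_def numeral_2_eq_2)
  have \<beta>s: "(\<lambda>i\<in>{..<3}. v0 1 (\<beta> i)) = spine_map 3 0 w" "(\<lambda>i\<in>{..<3}. v1 1 (\<beta> i)) = ?t"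
    using \<beta> unfolding edges_def spine_simps(4) by blast+
  have "v0 1 (\<beta> i) = spine_map 3 0 w i" "v1 1 (\<beta> i) = ?t i" if "i < 3" for i
    using that fun_cong[OF \<beta>s(1), of i] fun_cong[OF \<beta>s(2), of i] by simp_all
  from this[of 0] this[of 1] this[of 2] have \<beta>0: "v0 1 (\<beta> 0) = hface W 2 2 0 (hface W 3 3 0 w)"
    "v0 1 (\<beta> 1) = hface W 2 0 0 (hface W 3 3 0 w)" "v0 1 (\<beta> 2) = hface W 2 0 0 (hface W 3 0 0 w)"
    "v1 1 (\<beta> 0) = a" "v1 1 (\<beta> 1) = b" "v1 1 (\<beta> 2) = c"
    using spine_map_3[OF w] by simp_all
  note ff = hface_hface_3[OF w]
  have f: "hface W 3 i 0 w \<in> bsimp W 2 0" for i using w by (rule hface_in_3)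
  have v0_hface: "v0 1 (hface W 2 l 1 s) = hface W 2 l 0 (v0 2 s)" if "s \<in> bsimp W 2 1" for l s
    using sset_map_vertex[OF hface_map[of 1 l], of s 1 0] that by (simp add: space_at_simps numeral_2_eq_2)
  have e2: "hvertex W 1 0 1 (hface W 2 2 1 s) = hvertex W 1 0 1 (hface W 2 1 1 s)"
    "hvertex W 1 1 1 (hface W 2 0 1 s) = hvertex W 1 1 1 (hface W 2 1 1 s)"
    "hvertex W 1 1 1 (hface W 2 2 1 s) = hvertex W 1 0 1 (hface W 2 0 1 s)" if "s \<in> bsimp W 2 1" for s
    using hface_hface_2[OF that, of 1 2] hface_hface_2[OF that, of 0 1] hface_hface_2[OF that, of 0 2]
      hface_1 hface_in_2[OF that] by simp_all
  \<comment> \<open>The faces 012, 123 and 023 of \<open>w\<close> are moved along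
    \<open>\<beta>\<close> by lifting paths of spines. This determines a path of boundaries for the
    face 013, which is lifted last.\<close>
  obtain p where p: "p \<in> bsimp W 2 1" "hface W 2 2 1 p = \<beta> 0" "hface W 2 0 1 p = \<beta> 1" "v0 2 p = hface W 3 3 0 w"
    by (rule spine_2_lift[OF f \<beta>1[of 0] \<beta>1[of 1] \<beta>v(1)]) (use \<beta>0 in auto)
  obtain q where q: "q \<in> bsimp W 2 1" "hface W 2 2 1 q = \<beta> 1" "hface W 2 0 1 q = \<beta> 2" "v0 2 q = hface W 3 0 0 w"
    by (rule spine_2_lift[OF f[of 0] \<beta>1[of 1] \<beta>1[of 2] \<beta>v(2)]) (use \<beta>0 ff[of 0 3] in auto)
  let ?e = "hface W 2 1 1 p" and ?f = "hface W 2 1 1 q"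
  obtain r where r: "r \<in> bsimp W 2 1" "hface W 2 2 1 r = ?e" "hface W 2 0 1 r = \<beta> 2" "v0 2 r = hface W 3 1 0 w"
    by (rule spine_2_lift[OF f[of 1] hface_in_2[OF p(1)] \<beta>1[of 2]])
      (use e2[OF p(1)] p q \<beta>v \<beta>0 ff[of 1 3] ff[of 0 1] in \<open>auto simp: v0_hface[simplified]\<close>)
  let ?g = "hface W 2 1 1 r"
  let ?b = "\<lambda>l::nat. if l = 0 then ?f else if l = 1 then ?g else \<beta> 0"
  obtain s where s: "s \<in> bsimp W 2 1" "\<And>l. l \<le> 2 \<Longrightarrow> hface W 2 l 1 s = ?b l"
  proof (rule reedy_path_2[OF f[of 2], of ?b])
    fix l :: nat assume "l \<le> 2"
    then show "?b l \<in> bsimp W 1 1" using hface_in_2[OF q(1)] hface_in_2[OF r(1)] \<beta>1[of 0] by simp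
    show "v0 1 (?b l) = hface W 2 l 0 (hface W 3 2 0 w)"
      using \<open>l \<le> 2\<close> ff[of 0 2] ff[of 1 2] ff[of 2 3] q r \<beta>0 by (auto simp: le_2_cases v0_hface[simplified])
  next
    fix i j :: nat assume "i < j" "j \<le> 2"
    then have "i = 0 \<and> j = 1 \<or> i = 0 \<and> j = 2 \<or> i = 1 \<and> j = 2" by auto
    moreover have "hvertex W 1 1 1 ?g = hvertex W 1 1 1 ?f" using e2[OF r(1)] e2[OF q(1)] q r by simp
    moreover have "hvertex W 1 1 1 (\<beta> 0) = hvertex W 1 0 1 ?f" using e2[OF q(1)] q \<beta>v by simp
    moreover have "hvertex W 1 0 1 (\<beta> 0) = hvertex W 1 0 1 ?g" using e2[OF r(1)] e2[OF p(1)] p r by simp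
    moreover have "?f \<in> bsimp W 1 1" "?g \<in> bsimp W 1 1" using hface_in_2[OF q(1)] hface_in_2[OF r(1)] .
    ultimately show "hface W 1 i 1 (?b j) = hface W 1 (j - 1) 1 (?b i)"
      using \<beta>1[of 0] by (auto simp: hface_1[simplified])
  qed (rule that)
  have "tri (row W 0) a b (v1 1 ?e)" using tri_vertex[OF p(1), of 1] p \<beta>0 by simp
  moreover have "tri (row W 0) b c (v1 1 ?f)" using tri_vertex[OF q(1), of 1] q \<beta>0 by simp
  moreover have "tri (row W 0) (v1 1 ?e) c (v1 1 ?g)" using tri_vertex[OF r(1), of 1] r \<beta>0 by simp
  moreover have "tri (row W 0) a (v1 1 ?f) (v1 1 ?g)"
    using tri_vertex[OF s(1), of 1] s(2)[of 0] s(2)[of 1] s(2)[of 2] \<beta>0 by simp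
  ultimately show ?thesis by blast
qed

lemma same_path_component_css_refl:
  "x \<in> bsimp W 0 0 \<Longrightarrow> y \<in> bsimp W 0 0 \<Longrightarrow> f \<in> edges (row W 0) x y \<Longrightarrow> same_path_component (css_Map W x y) f f"
  by (rule same_path_component_refl) (simp add: simp_css_Map_0)

text \<open>Given triangles are compared with a tetrahedron on the same \<open>a\<close>,
  \<open>b\<close>, \<open>c\<close>. Uniqueness of composites matches the other edges up to paths,
  and invariance of \<open>tri\<close> under paths carries the triangles of the tetrahedron
  back.\<close>

lemma tri_calculus_row: "tri_calculus (row W 0)"
proof -
  interpret R: sset "row W 0" by (rule sset_row)
  have obj: "x \<in> bsimp W 0 0 \<and> y \<in> bsimp W 0 0" if "e \<in> edges (row W 0) x y" for e x y
    using R.edges_vertices[OF that] by (simp add: row_simps)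
  \<comment> \<open>Either of the last two triangles suffices to match \<open>g\<close>, so the
    disjunction covers both inner horns.\<close>
  have key: "tri (row W 0) a f g \<and> tri (row W 0) e c g"
    if t: "tri (row W 0) a b e" "tri (row W 0) b c f" "tri (row W 0) a f g \<or> tri (row W 0) e c g" for a b c e f g
  proof -
    obtain x y z where 1: "a \<in> edges (row W 0) x y" "b \<in> edges (row W 0) y z" "e \<in> edges (row W 0) x z"
      using R.triE[OF t(1)] by metis
    obtain z' u where 2: "c \<in> edges (row W 0) z u" "f \<in> edges (row W 0) y u"
      using R.triE[OF t(2)] 1 by (smt (verit) edges_def mem_Collect_eq)
    have 3: "g \<in> edges (row W 0) x u"
      using t(3) R.triE[of _ _ g] 1 2 by (smt (verit) edges_def mem_Collect_eq)
    obtain e' f' g' where n: "tri (row W 0) a b e'" "tri (row W 0) b c f'" "tri (row W 0) e' c g'" "tri (row W 0) a f' g'"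
      using tetrahedron[OF 1(1,2) 2(1)] by blast
    note o = obj[OF 1(1)] obj[OF 2(1)]
    have ee: "same_path_component (css_Map W x z) e e'" by (rule tri_unique_path[OF t(1) n(1) 1(3)])
    have ff: "same_path_component (css_Map W y u) f f'" by (rule tri_unique_path[OF t(2) n(2) 2(2)])
    have "same_path_component (css_Map W x u) g g'"
      using t(3)
    proof
      assume h: "tri (row W 0) a f g"
      have "tri (row W 0) a f' g"
        by (intro tri_path[OF _ _ _ h _ ff] same_path_component_css_refl) (use o 1 3 in auto)
      then show ?thesis by (rule tri_unique_path[OF _ n(4) 3])
    next
      assume h: "tri (row W 0) e c g"
      have "tri (row W 0) e' c g"
        by (intro tri_path[OF _ _ _ h ee] same_path_component_css_refl) (use o 2 3 in auto)
      then show ?thesis by (rule tri_unique_path[OF _ n(3) 3])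
    qed
    note sym = this[THEN same_path_component_sym] ee[THEN same_path_component_sym] ff[THEN same_path_component_sym]
    have "tri (row W 0) a f g"
      by (intro tri_path[OF _ _ _ n(4) _ sym(3,1)] same_path_component_css_refl) (use o 1 in auto)
    moreover have "tri (row W 0) e c g"
      by (intro tri_path[OF _ _ _ n(3) sym(2) _ sym(1)] same_path_component_css_refl) (use o 2 in auto)
    ultimately show ?thesis ..
  qed
  show ?thesis
  proof
    show "\<exists>c. tri (row W 0) a b c" if "a \<in> edges (row W 0) x y" "b \<in> edges (row W 0) y z" for a b x y z
      using tri_exists that .
  qed (use key in blast)+
qed

text \<open>A path from \<open>f\<close> to \<open>g\<close> deforms the degenerate triangle on
  \<open>f\<close> into one witnessing \<open>eqv\<close>; conversely such a triangle and the
  degenerate one on \<open>g\<close> have the same spine.\<close>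

lemma same_path_component_css_Map_iff:
  assumes xy: "x \<in> bsimp W 0 0" "y \<in> bsimp W 0 0"
  shows "same_path_component (css_Map W x y) f g \<longleftrightarrow>
    f \<in> edges (row W 0) x y \<and> g \<in> edges (row W 0) x y \<and> tri_calculus.eqv (row W 0) f g"
proof -
  interpret tri_calculus "row W 0" by (rule tri_calculus_row)
  have i: "const_simp (row W 0) 1 x \<in> edges (row W 0) x x"
    using const_simp_edge xy by (simp add: row_simps)
  show ?thesis
  proof
    assume p: "same_path_component (css_Map W x y) f g"
    then have fg: "f \<in> edges (row W 0) x y" "g \<in> edges (row W 0) x y"
      using simp_css_Map_0[OF xy] by (auto simp: same_path_component_iff)
    have "tri (row W 0) (const_simp (row W 0) 1 x) g f"
      by (rule tri_path[OF xy(1,1,2) tri_deg_left[OF fg(1)] _ p])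
        (intro same_path_component_css_refl xy i fg)+
    then show "f \<in> edges (row W 0) x y \<and> g \<in> edges (row W 0) x y \<and> eqv f g"
      using fg eqvI by blast
  next
    assume *: "f \<in> edges (row W 0) x y \<and> g \<in> edges (row W 0) x y \<and> eqv f g"
    then have "tri (row W 0) (const_simp (row W 0) 1 x) g f" by (auto simp: eqv_def edges_def)
    from tri_unique_path[OF this tri_deg_left] * show "same_path_component (css_Map W x y) f g" by blast
  qed
qed

end

section \<open>Slices and filtered colimits of simplicial spaces\<close>

lemma bsset_map_in: "bsset_map X Y f \<Longrightarrow> x \<in> bsimp X n k \<Longrightarrow> f n k x \<in> bsimp Y n k"
  by (simp add: bsset_map_def)

lemma bsset_map_act: "bsset_map X Y f \<Longrightarrow> \<alpha> \<in> ord_maps m n \<Longrightarrow> \<beta> \<in> ord_maps j k \<Longrightarrow> x \<in> bsimp X n k \<Longrightarrow>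
    f m j (bact X m n \<alpha> j k \<beta> x) = bact Y m n \<alpha> j k \<beta> (f n k x)"
  unfolding bsset_map_def by blast

lemma row_map: "bsset_map X Y f \<Longrightarrow> sset_map (row X k) (row Y k) (\<lambda>n. f n k)"
  unfolding sset_map_def row_simps hact_def by (simp add: bsset_map_in bsset_map_act id_ord_maps)

lemma space_at_map: "bsset_map X Y f \<Longrightarrow> sset_map (space_at X n) (space_at Y n) (f n)"
  unfolding sset_map_def space_at_simps by (simp add: bsset_map_in bsset_map_act id_ord_maps)

lemma bsset_map_hvertex: "bsset_map X Y f \<Longrightarrow> x \<in> bsimp X n k \<Longrightarrow> i \<le> n \<Longrightarrow> f 0 k (hvertex X n i k x) = hvertex Y n i k (f n k x)"
  using sset_map_vertex[OF row_map[of X Y f k], of x n i] by (simp add: row_simps)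

lemma bsset_map_vconst: "bsset_map X Y f \<Longrightarrow> x \<in> bsimp X n 0 \<Longrightarrow> f n k (vconst X n k x) = vconst Y n k (f n 0 x)"
  unfolding vconst_def by (rule sset_map_const[OF space_at_map]) (simp_all add: space_at_simps)

lemma css_Map_map:
  assumes f: "bsset_map X Y f" and xy: "x \<in> bsimp X 0 0" "y \<in> bsimp X 0 0"
  shows "sset_map (css_Map X x y) (css_Map Y (f 0 0 x) (f 0 0 y)) (f 1)"
  unfolding sset_map_def
proof (intro conjI allI ballI)
  fix k w assume "w \<in> simp (css_Map X x y) k"
  then have w: "w \<in> bsimp X 1 k" "hvertex X 1 0 k w = vconst X 0 k x" "hvertex X 1 1 k w = vconst X 0 k y"
    by (simp_all add: css_Map_def)
  have "hvertex Y 1 0 k (f 1 k w) = vconst Y 0 k (f 0 0 x)" "hvertex Y 1 1 k (f 1 k w) = vconst Y 0 k (f 0 0 y)"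
    by (simp_all only: bsset_map_hvertex[OF f w(1) le0, symmetric] bsset_map_hvertex[OF f w(1) order_refl, symmetric]
      w(2,3) bsset_map_vconst[OF f xy(1)] bsset_map_vconst[OF f xy(2)])
  then show "f 1 k w \<in> simp (css_Map Y (f 0 0 x) (f 0 0 y)) k"
    using bsset_map_in[OF f w(1)] by (simp add: css_Map_def)
  fix j \<beta> assume "\<beta> \<in> ord_maps j k"
  then show "f 1 j (act (css_Map X x y) j k \<beta> w) = act (css_Map Y (f 0 0 x) (f 0 0 y)) j k \<beta> (f 1 k w)"
    using sset_map_act[OF space_at_map[OF f]] w by (simp add: css_Map_def space_at_simps(1))
qed

lemma same_path_component_css_Map:
  "bsset_map X Y f \<Longrightarrow> x \<in> bsimp X 0 0 \<Longrightarrow> y \<in> bsimp X 0 0 \<Longrightarrow> same_path_component (css_Map X x y) g h \<Longrightarrow>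
    same_path_component (css_Map Y (f 0 0 x) (f 0 0 y)) (f 1 0 g) (f 1 0 h)"
  by (rule same_path_component_map[OF css_Map_map])

context simp_space
begin

lemma forget_bsset_map: "bsset_map (css_slice W v) W (css_forget W)"
  unfolding bsset_map_def
proof (intro conjI allI ballI)
  fix n k s assume "s \<in> bsimp (css_slice W v) n k"
  then have s: "s \<in> bsimp W (n + 1) k" by (simp add: css_slice_def)
  then show "css_forget W n k s \<in> bsimp W n k" using hface_in[of s n] by (simp add: css_forget_def)
  fix m j \<alpha> \<beta> assume *: "\<alpha> \<in> ord_maps m n" "\<beta> \<in> ord_maps j k"
  have "bact W m (m + 1) (coface (m + 1)) j j id (bact W (m + 1) (n + 1) (join_id m n \<alpha>) j k \<beta> s) =
    bact W m (n + 1) (join_id m n \<alpha> \<circ> coface (m + 1)) j k (\<beta> \<circ> id) s"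
    by (rule bact_bact) (use s * join_id_ord_maps[OF *(1)] coface_ord_maps[of _ m] id_ord_maps in auto)
  also have "\<dots> = bact W m (n + 1) (coface (n + 1) \<circ> \<alpha>) j k (id \<circ> \<beta>) s"
    by (rule bact_cong)
      (use s * ord_maps_comp[OF coface_ord_maps join_id_ord_maps[OF *(1)]] ord_maps_comp[OF *(1) coface_ord_maps] in
        \<open>auto simp: coface_def join_id_def ord_maps_def\<close>)
  also have "\<dots> = bact W m n \<alpha> j k \<beta> (bact W n (n + 1) (coface (n + 1)) k k id s)"
    by (rule bact_bact[symmetric]) (use s * coface_ord_maps[of _ n] id_ord_maps in auto)
  finally show "css_forget W m j (bact (css_slice W v) m n \<alpha> j k \<beta> s) = bact W m n \<alpha> j k \<beta> (css_forget W n k s)"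
    by (simp add: css_forget_def hface_def hact_def css_slice_def)
qed

lemma simp_space_slice:
  assumes v: "v \<in> bsimp W 0 0" shows "simp_space (css_slice W v)"
proof
  have o: "join_id m n \<alpha> \<in> ord_maps (m + 1) (n + 1)" if "\<alpha> \<in> ord_maps m n" for m n \<alpha>
    using join_id_ord_maps[OF that] by simp
  show "simplicial_space (css_slice W v)"
    unfolding simplicial_space_def
  proof (intro conjI allI ballI impI)
    fix m n j k \<alpha> \<beta> s assume *: "\<alpha> \<in> ord_maps m n" "\<beta> \<in> ord_maps j k" "s \<in> bsimp (css_slice W v) n k"
    then have s: "s \<in> bsimp W (n + 1) k" "hvertex W (n + 1) (n + 1) k s = vconst W 0 k v"
      by (simp_all add: css_slice_def)
    let ?b = "bact W (m + 1) (n + 1) (join_id m n \<alpha>) j k \<beta> s"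
    have "hvertex W (m + 1) (m + 1) j ?b =
        bact W 0 (n + 1) (join_id m n \<alpha> \<circ> (\<lambda>_. m + 1)) j k (\<beta> \<circ> id) s"
      unfolding hvertex_def hact_def
      by (rule bact_bact) (use s * o in \<open>auto simp: const_ord_maps id_ord_maps\<close>)
    also have "\<dots> = bact W 0 (n + 1) ((\<lambda>_. n + 1) \<circ> id) j k (id \<circ> \<beta>) s"
    proof -
      have "join_id m n \<alpha> \<circ> (\<lambda>_. m + 1) = (\<lambda>_::nat. n + 1) \<circ> id" by (simp add: join_id_def fun_eq_iff)
      then show ?thesis by (simp only: id_comp comp_id)
    qed
    also have "\<dots> = bact W 0 0 id j k \<beta> (hvertex W (n + 1) (n + 1) k s)"
      unfolding hvertex_def hact_def
      by (rule bact_bact[symmetric]) (use s * in \<open>auto simp: const_ord_maps id_ord_maps\<close>)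
    also have "\<dots> = vconst W 0 j v"
      using sset.act_const_simp[OF sset_space_at *(2), of v 0] v s(2) by (simp add: vconst_def space_at_simps)
    finally show "bact (css_slice W v) m n \<alpha> j k \<beta> s \<in> bsimp (css_slice W v) m j"
      using bact_in[OF o[OF *(1)] *(2) s(1)] by (simp add: css_slice_def)
  next
    fix m n j k \<alpha> \<alpha>' \<beta> \<beta>' s
    assume *: "\<alpha> \<in> ord_maps m n" "\<alpha>' \<in> ord_maps m n" "\<beta> \<in> ord_maps j k" "\<beta>' \<in> ord_maps j k"
      "s \<in> bsimp (css_slice W v) n k" "(\<forall>i\<le>m. \<alpha> i = \<alpha>' i) \<and> (\<forall>i\<le>j. \<beta> i = \<beta>' i)"
    then show "bact (css_slice W v) m n \<alpha> j k \<beta> s = bact (css_slice W v) m n \<alpha>' j k \<beta>' s"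
      unfolding css_slice_def bsset.select_convs
      by (intro bact_cong[OF o[OF *(1)] o[OF *(2)] *(3,4)]) (simp_all add: join_id_def)
  next
    fix n k s assume "s \<in> bsimp (css_slice W v) n k"
    then have s: "s \<in> bsimp W (n + 1) k" by (simp add: css_slice_def)
    have "bact W (n + 1) (n + 1) (join_id n n id) k k id s = bact W (n + 1) (n + 1) id k k id s"
      by (rule bact_cong[OF o[OF id_ord_maps] id_ord_maps id_ord_maps id_ord_maps s]) (auto simp: join_id_def)
    then show "bact (css_slice W v) n n id k k id s = s" using bact_id[OF s] by (simp add: css_slice_def)
  next
    fix l m n i j k \<alpha>' \<alpha> \<beta>' \<beta> s
    assume *: "\<alpha>' \<in> ord_maps l m" "\<alpha> \<in> ord_maps m n" "\<beta>' \<in> ord_maps i j" "\<beta> \<in> ord_maps j k"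
      "s \<in> bsimp (css_slice W v) n k"
    then have s: "s \<in> bsimp W (n + 1) k" by (simp add: css_slice_def)
    have "bact W (l + 1) (n + 1) (join_id m n \<alpha> \<circ> join_id l m \<alpha>') i k (\<beta> \<circ> \<beta>') s =
        bact W (l + 1) (n + 1) (join_id l n (\<alpha> \<circ> \<alpha>')) i k (\<beta> \<circ> \<beta>') s"
      by (rule bact_cong[OF ord_maps_comp[OF o[OF *(1)] o[OF *(2)]] o[OF ord_maps_comp[OF *(1,2)]]
          ord_maps_comp[OF *(3,4)] ord_maps_comp[OF *(3,4)] s])
        (use *(1) in \<open>auto simp: join_id_def ord_maps_def\<close>)
    then show "bact (css_slice W v) l m \<alpha>' i j \<beta>' (bact (css_slice W v) m n \<alpha> j k \<beta> s) =
        bact (css_slice W v) l n (\<alpha> \<circ> \<alpha>') i k (\<beta> \<circ> \<beta>') s"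
      by (simp add: css_slice_def bact_bact[OF o[OF *(1), simplified] o[OF *(2), simplified] *(3,4) s[simplified]])
  qed
qed

lemma simp_space_slice_pair:
  assumes uv: "u \<in> bsimp W 0 0" "v \<in> bsimp W 0 0" shows "simp_space (css_slice_pair W u v)"
proof
  let ?P = "css_slice_pair W u v"
  interpret U: simp_space "css_slice W u" by (rule simp_space_slice[OF uv(1)])
  interpret V: simp_space "css_slice W v" by (rule simp_space_slice[OF uv(2)])
  show "simplicial_space ?P"
    unfolding simplicial_space_def
  proof (intro conjI allI ballI impI)
    fix m n j k \<alpha> \<beta> p assume *: "\<alpha> \<in> ord_maps m n" "\<beta> \<in> ord_maps j k" "p \<in> bsimp ?P n k"
    then show "bact ?P m n \<alpha> j k \<beta> p \<in> bsimp ?P m j"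
      using U.bact_in[OF *(1,2)] V.bact_in[OF *(1,2)] bsset_map_act[OF forget_bsset_map[of u] *(1,2)]
        bsset_map_act[OF forget_bsset_map[of v] *(1,2)]
      by (auto simp: css_slice_pair_def)
  next
    fix m n j k \<alpha> \<alpha>' \<beta> \<beta>' p
    assume *: "\<alpha> \<in> ord_maps m n" "\<alpha>' \<in> ord_maps m n" "\<beta> \<in> ord_maps j k" "\<beta>' \<in> ord_maps j k"
      "p \<in> bsimp ?P n k" "(\<forall>i\<le>m. \<alpha> i = \<alpha>' i) \<and> (\<forall>i\<le>j. \<beta> i = \<beta>' i)"
    then show "bact ?P m n \<alpha> j k \<beta> p = bact ?P m n \<alpha>' j k \<beta>' p"
      using U.bact_cong[OF *(1-4), of "fst p"] V.bact_cong[OF *(1-4), of "snd p"]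
      by (auto simp: css_slice_pair_def)
  next
    fix n k p assume "p \<in> bsimp ?P n k"
    then show "bact ?P n n id k k id p = p" by (auto simp: css_slice_pair_def U.bact_id V.bact_id)
  next
    fix l m n i j k \<alpha>' \<alpha> \<beta>' \<beta> p
    assume "\<alpha>' \<in> ord_maps l m" "\<alpha> \<in> ord_maps m n" "\<beta>' \<in> ord_maps i j" "\<beta> \<in> ord_maps j k" "p \<in> bsimp ?P n k"
    then show "bact ?P l m \<alpha>' i j \<beta>' (bact ?P m n \<alpha> j k \<beta> p) = bact ?P l n (\<alpha> \<circ> \<alpha>') i k (\<beta> \<circ> \<beta>') p"
      by (auto simp: css_slice_pair_def U.bact_bact V.bact_bact)
  qed
qed

text \<open>At spatial dimension 0 the constant simplex at \<open>v\<close> is \<open>v\<close>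
  itself, so slicing commutes with taking the zeroth row. This is what makes
  \<open>power_stage\<close> applicable to the row.\<close>

lemma row_slice:
  assumes "v \<in> bsimp W 0 0" shows "row (css_slice W v) 0 = qc_slice (row W 0) v"
proof -
  have "hvertex W n n 0 w = act (row W 0) 0 n (\<lambda>_. n) w" for n w by (simp add: row_simps hvertex_def)
  then show ?thesis
    using vconst_0[OF assms] by (simp add: row_def css_slice_def qc_slice_def vertex_def)
qed

lemma row_slice_pair:
  assumes "u \<in> bsimp W 0 0" "v \<in> bsimp W 0 0"
  shows "row (css_slice_pair W u v) 0 = qc_slice_pair (row W 0) u v"
proof -
  have "css_forget W n 0 = qc_forget (row W 0) n" for n
    by (simp add: css_forget_def qc_forget_def row_simps fun_eq_iff)
  moreover have "bsimp (css_slice W x) n 0 = simp (qc_slice (row W 0) x) n"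
    "bact (css_slice W x) m n \<alpha> 0 0 id = act (qc_slice (row W 0) x) m n \<alpha>" if "x \<in> bsimp W 0 0" for x m n \<alpha>
    using arg_cong[OF row_slice[OF that], of "\<lambda>r. simp r n"] arg_cong[OF row_slice[OF that], of "\<lambda>r. act r m n \<alpha>"]
    by (simp_all add: row_def)
  ultimately show ?thesis
    unfolding row_def[of "css_slice_pair W u v"] using assms by (simp add: css_slice_pair_def qc_slice_pair_def)
qed

end

lemma row_prod_interval: "row (css_prod_interval S) 0 = sset_prod (row S 0) (std_simplex 1)"
  by (simp add: row_def css_prod_interval_def sset_prod_def)

lemma row_power: "row (css_power I C) k = qc_power I (row C k)"
  by (simp add: row_def css_power_def qc_power_def sset_Pi_def)

lemma power_proj_map: "i \<in> I \<Longrightarrow> bsset_map (css_power I C) C (\<lambda>n k x. x i)"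
  by (auto simp: bsset_map_def css_power_def)

lemma (in simp_space) simp_space_power: "simp_space (css_power I W)"
proof
  show "simplicial_space (css_power I W)"
    unfolding simplicial_space_def css_power_def bsset.select_convs
  proof (intro conjI allI ballI impI)
    fix m n j k \<alpha> \<beta> x assume "\<alpha> \<in> ord_maps m n" "\<beta> \<in> ord_maps j k" "x \<in> I \<rightarrow>\<^sub>E bsimp W n k"
    then show "(\<lambda>i\<in>I. bact W m n \<alpha> j k \<beta> (x i)) \<in> I \<rightarrow>\<^sub>E bsimp W m j"
      by (auto intro: bact_in)
  next
    fix m n j k \<alpha> \<alpha>' \<beta> \<beta>' x
    assume *: "\<alpha> \<in> ord_maps m n" "\<alpha>' \<in> ord_maps m n" "\<beta> \<in> ord_maps j k" "\<beta>' \<in> ord_maps j k"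
      "x \<in> I \<rightarrow>\<^sub>E bsimp W n k" "(\<forall>i\<le>m. \<alpha> i = \<alpha>' i) \<and> (\<forall>i\<le>j. \<beta> i = \<beta>' i)"
    show "(\<lambda>i\<in>I. bact W m n \<alpha> j k \<beta> (x i)) = (\<lambda>i\<in>I. bact W m n \<alpha>' j k \<beta>' (x i))"
      by (rule restrict_ext, rule bact_cong[OF *(1-4)]) (use * in auto)
  next
    fix n k x assume "x \<in> I \<rightarrow>\<^sub>E bsimp W n k"
    then show "(\<lambda>i\<in>I. bact W n n id k k id (x i)) = x"
      by (auto simp: fun_eq_iff PiE_iff extensional_def bact_id)
  next
    fix l m n i j k \<alpha>' \<alpha> \<beta>' \<beta> x
    assume *: "\<alpha>' \<in> ord_maps l m" "\<alpha> \<in> ord_maps m n" "\<beta>' \<in> ord_maps i j" "\<beta> \<in> ord_maps j k" "x \<in> I \<rightarrow>\<^sub>E bsimp W n k"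
    show "(\<lambda>a\<in>I. bact W l m \<alpha>' i j \<beta>' ((\<lambda>a\<in>I. bact W m n \<alpha> j k \<beta> (x a)) a)) =
        (\<lambda>a\<in>I. bact W l n (\<alpha> \<circ> \<alpha>') i k (\<beta> \<circ> \<beta>') (x a))"
      by (rule restrict_ext) (use * bact_bact[OF *(1-4)] in auto)
  qed
qed

section \<open>Level-wise filtered colimits of simplicial spaces\<close>

definition bsset_colim ::
  "'v set \<Rightarrow> ('v \<Rightarrow> 'v \<Rightarrow> bool) \<Rightarrow> ('v \<Rightarrow> 'a bsset) \<Rightarrow> ('v \<Rightarrow> 'v \<Rightarrow> nat \<Rightarrow> nat \<Rightarrow> 'a \<Rightarrow> 'a) \<Rightarrow> ('v \<times> 'a) set bsset"
  where
  "bsset_colim J le E t =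
     \<lparr>bsimp = \<lambda>n k. Sigma J (\<lambda>V. bsimp (E V) n k) // colim_rel J le (\<lambda>V. bsimp (E V) n k) (\<lambda>V W. t V W n k),
      bact = \<lambda>m n \<alpha> j k \<beta> c. colim_rel J le (\<lambda>V. bsimp (E V) m j) (\<lambda>V W. t V W m j) ``
               ((\<lambda>(V, x). (V, bact (E V) m n \<alpha> j k \<beta> x)) ` c)\<rparr>"

definition bcolim_class ::
  "'v set \<Rightarrow> ('v \<Rightarrow> 'v \<Rightarrow> bool) \<Rightarrow> ('v \<Rightarrow> 'a bsset) \<Rightarrow> ('v \<Rightarrow> 'v \<Rightarrow> nat \<Rightarrow> nat \<Rightarrow> 'a \<Rightarrow> 'a) \<Rightarrow>
     'v \<Rightarrow> nat \<Rightarrow> nat \<Rightarrow> 'a \<Rightarrow> ('v \<times> 'a) set" where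
  "bcolim_class J le E t V n k x =
     colim_rel J le (\<lambda>V. bsimp (E V) n k) (\<lambda>V W. t V W n k) `` {(V, x)}"

locale bsset_system = directed_index +
  fixes E :: "'v \<Rightarrow> 'a bsset" and t :: "'v \<Rightarrow> 'v \<Rightarrow> nat \<Rightarrow> nat \<Rightarrow> 'a \<Rightarrow> 'a"
  assumes simp_space_E: "V \<in> J \<Longrightarrow> simp_space (E V)"
    and t_map: "V \<in> J \<Longrightarrow> W \<in> J \<Longrightarrow> le W V \<Longrightarrow> bsset_map (E V) (E W) (t V W)"
    and t_refl: "V \<in> J \<Longrightarrow> x \<in> bsimp (E V) n k \<Longrightarrow> t V V n k x = x"
    and t_trans: "U \<in> J \<Longrightarrow> V \<in> J \<Longrightarrow> W \<in> J \<Longrightarrow> le V U \<Longrightarrow> le W V \<Longrightarrow> x \<in> bsimp (E U) n k \<Longrightarrow>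
      t V W n k (t U V n k x) = t U W n k x"
begin

lemma level: "directed_system J le (\<lambda>V. bsimp (E V) n k) (\<lambda>V W. t V W n k)"
  by unfold_locales (simp_all add: bsset_map_in[OF t_map] t_refl t_trans)

lemma class_cls: "bcolim_class J le E t V n k x =
    directed_system.cls J le (\<lambda>V. bsimp (E V) n k) (\<lambda>V W. t V W n k) V x"
  by (simp add: bcolim_class_def directed_system.cls_def[OF level])

lemma class_map: "V \<in> J \<Longrightarrow> bsset_map (E V) (bsset_colim J le E t) (bcolim_class J le E t V)"
  unfolding bsset_map_def
proof (intro conjI allI ballI)
  fix n k x assume V: "V \<in> J" and x: "x \<in> bsimp (E V) n k"
  show "bcolim_class J le E t V n k x \<in> bsimp (bsset_colim J le E t) n k"
    using directed_system.cls_in[OF level V x] by (simp add: class_cls bsset_colim_def)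
  fix m j \<alpha> \<beta> assume *: "\<alpha> \<in> ord_maps m n" "\<beta> \<in> ord_maps j k"
  show "bcolim_class J le E t V m j (bact (E V) m n \<alpha> j k \<beta> x) =
    bact (bsset_colim J le E t) m n \<alpha> j k \<beta> (bcolim_class J le E t V n k x)"
    unfolding class_cls bsset_colim_def bsset.select_convs
    by (rule directed_system.cls_image[OF level level, where h="\<lambda>V. bact (E V) m n \<alpha> j k \<beta>", symmetric])
      (simp_all add: V x * simp_space.bact_in[OF simp_space_E] bsset_map_act[OF t_map])
qed

lemma bsimp_colim_iff:
  "x \<in> bsimp (bsset_colim J le E t) n k \<longleftrightarrow> (\<exists>V\<in>J. \<exists>y\<in>bsimp (E V) n k. x = bcolim_class J le E t V n k y)"
  by (auto simp: bsset_colim_def class_cls directed_system.quotient_cls[OF level])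

lemma class_t:
  "V \<in> J \<Longrightarrow> W \<in> J \<Longrightarrow> le W V \<Longrightarrow> x \<in> bsimp (E V) n k \<Longrightarrow>
    bcolim_class J le E t W n k (t V W n k x) = bcolim_class J le E t V n k x"
  by (simp add: class_cls directed_system.cls_t[OF level])

text \<open>As for quasi-categories an edge of the mapping space lifts to a stage, where its source
  and target are the constant ones only up to the colimit relation. Both equations concern simplices
  of bidegree (0, 1) and hold from some later stage on.\<close>

lemma same_path_component_Map_colim:
  assumes V: "V \<in> J" "\<And>W. W \<in> J \<Longrightarrow> le W V" and xy: "x \<in> bsimp (E V) 0 0" "y \<in> bsimp (E V) 0 0"
    and fg: "f \<in> edges (row (E V) 0) x y" "g \<in> edges (row (E V) 0) x y"
  defines "Q \<equiv> bsset_colim J le E t" and "c \<equiv> bcolim_class J le E t"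
  shows "same_path_component (css_Map Q (c V 0 0 x) (c V 0 0 y)) (c V 1 0 f) (c V 1 0 g) \<longleftrightarrow>
    (\<exists>W\<in>J. same_path_component (css_Map (E W) (t V W 0 0 x) (t V W 0 0 y)) (t V W 1 0 f) (t V W 1 0 g))"
    (is "?L \<longleftrightarrow> ?R")
proof
  interpret S: directed_system J le "\<lambda>V. bsimp (E V) 1 0" "\<lambda>V W. t V W 1 0" by (rule level)
  interpret S0: directed_system J le "\<lambda>V. bsimp (E V) 0 1" "\<lambda>V W. t V W 0 1" by (rule level)
  have c_map: "W \<in> J \<Longrightarrow> bsset_map (E W) Q (c W)" for W unfolding Q_def c_def by (rule class_map)
  have c_cls: "c W 1 0 z = S.cls W z" "c W 0 1 z = S0.cls W z" for W z unfolding c_def by (rule class_cls)+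
  have c_t: "c W n k (t V W n k z) = c V n k z" if "W \<in> J" "z \<in> bsimp (E V) n k" for W n k z
    unfolding c_def using that V by (intro class_t)
  let ?M = "\<lambda>W. css_Map (E W) (t V W 0 0 x) (t V W 0 0 y)" and ?QM = "css_Map Q (c V 0 0 x) (c V 0 0 y)"
  have tx: "t V W 0 0 x \<in> bsimp (E W) 0 0" "t V W 0 0 y \<in> bsimp (E W) 0 0" if "W \<in> J" for W
    using that V xy by (auto intro: bsset_map_in[OF t_map])
  have c_Map: "sset_map (?M W) ?QM (c W 1)" if "W \<in> J" for W
    using css_Map_map[OF c_map[OF that] tx[OF that]] c_t[OF that] xy by simp
  have fg1: "f \<in> bsimp (E V) 1 0" "g \<in> bsimp (E V) 1 0" using fg by (simp_all add: edges_def row_simps)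
  {
    assume L: ?L
    have "\<exists>W\<in>J. le W V \<and> (t V W 1 0 f, t V W 1 0 g) \<in> (path_edges (?M W) \<union> (path_edges (?M W))\<inverse>)\<^sup>*"
    proof (rule S.zigzag_stage[where G="\<lambda>W. path_edges (?M W)", OF _ _ V(1) fg1])
      show "(S.cls V f, S.cls V g) \<in> (path_edges ?QM \<union> (path_edges ?QM)\<inverse>)\<^sup>*"
        using L unfolding c_cls(1)[symmetric] same_path_component_iff by blast
    next
      fix a b assume "(a, b) \<in> path_edges ?QM"
      then obtain e where e: "e \<in> simp ?QM 1" "a = vertex ?QM 1 0 e" "b = vertex ?QM 1 1 e"
        by (auto simp: path_edges_def)
      then have eQ: "e \<in> bsimp Q 1 1" "hvertex Q 1 0 1 e = vconst Q 0 1 (c V 0 0 x)"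
        "hvertex Q 1 1 1 e = vconst Q 0 1 (c V 0 0 y)"
        by (simp_all add: css_Map_def)
      then obtain U e' where U: "U \<in> J" "e' \<in> bsimp (E U) 1 1" "e = c U 1 1 e'"
        unfolding Q_def c_def using bsimp_colim_iff by blast
      interpret U: simp_space "E U" by (rule simp_space_E[OF U(1)])
      interpret V: simp_space "E V" by (rule simp_space_E[OF V(1)])
      have stage: "\<exists>W\<in>J. le W U \<and> (\<forall>Z\<in>J. le Z W \<longrightarrow>
          t U Z 0 1 (hvertex (E U) 1 i 1 e') = vconst (E Z) 0 1 (t V Z 0 0 z))"
        if "i \<le> 1" "z \<in> bsimp (E V) 0 0" "hvertex Q 1 i 1 e = vconst Q 0 1 (c V 0 0 z)" for i z
      proof -
        have "S0.cls U (hvertex (E U) 1 i 1 e') = S0.cls V (vconst (E V) 0 1 z)"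
          using that(3) U(3) bsset_map_hvertex[OF c_map[OF U(1)] U(2) that(1)]
            bsset_map_vconst[OF c_map[OF V(1)] that(2), of 1]
          unfolding c_cls(2)[symmetric] by simp
        from S0.common_stage[OF U(1) U.hvertex_in[OF U(2) that(1)] V(1) V.vconst_in[OF that(2)] this]
        obtain W where W: "W \<in> J" "le W U"
          "\<And>Z. Z \<in> J \<Longrightarrow> le Z W \<Longrightarrow> t U Z 0 1 (hvertex (E U) 1 i 1 e') = t V Z 0 1 (vconst (E V) 0 1 z)" by blast
        moreover have "t V Z 0 1 (vconst (E V) 0 1 z) = vconst (E Z) 0 1 (t V Z 0 0 z)" if "Z \<in> J" for Z
          by (rule bsset_map_vconst[OF t_map[OF V(1) that V(2)[OF that]] \<open>z \<in> bsimp (E V) 0 0\<close>])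
        ultimately show ?thesis by (intro bexI[of _ W]) auto
      qed
      obtain W1 where W1: "W1 \<in> J" "le W1 U"
        "\<forall>Z\<in>J. le Z W1 \<longrightarrow> t U Z 0 1 (hvertex (E U) 1 0 1 e') = vconst (E Z) 0 1 (t V Z 0 0 x)"
        using stage[OF _ xy(1) eQ(2)] by auto
      obtain W2 where W2: "W2 \<in> J" "le W2 U"
        "\<forall>Z\<in>J. le Z W2 \<longrightarrow> t U Z 0 1 (hvertex (E U) 1 1 1 e') = vconst (E Z) 0 1 (t V Z 0 0 y)"
        using stage[OF _ xy(2) eQ(3)] by auto
      obtain W where W: "W \<in> J" "le W W1" "le W W2" using directed W1(1) W2(1) by blast
      have WU: "le W U" using le_trans W W1 U(1) by blast
      let ?e = "t U W 1 1 e'"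
      note tUW = t_map[OF U(1) W(1) WU]
      have "?e \<in> bsimp (E W) 1 1" by (rule bsset_map_in[OF tUW U(2)])
      moreover have "hvertex (E W) 1 0 1 ?e = vconst (E W) 0 1 (t V W 0 0 x)"
        using bsset_map_hvertex[OF tUW U(2), of 0] W1(3) W by simp
      moreover have "hvertex (E W) 1 1 1 ?e = vconst (E W) 0 1 (t V W 0 0 y)"
        using bsset_map_hvertex[OF tUW U(2), of 1] W2(3) W by simp
      ultimately have em: "?e \<in> simp (?M W) 1" by (simp add: css_Map_def)
      have "c W 1 1 ?e = e" unfolding U(3) c_def by (rule class_t[OF U(1) W(1) WU U(2)])
      then have "c W 1 0 (vertex (?M W) 1 i ?e) = vertex ?QM 1 i e" if "i \<le> 1" for i
        using sset_map_vertex[OF c_Map[OF W(1)] em that] by simp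
      then have "a = S.cls W (vertex (?M W) 1 0 ?e)" "b = S.cls W (vertex (?M W) 1 1 ?e)"
        unfolding e c_cls[symmetric] by simp_all
      moreover have "vertex (?M W) 1 i ?e \<in> bsimp (E W) 1 0" if "i \<le> 1" for i
        using sset.vertex_in[OF simp_space.sset_css_Map[OF simp_space_E[OF W(1)] tx[OF W(1)]] em that]
        by (simp add: css_Map_def)
      ultimately show "\<exists>V\<in>J. \<exists>x\<in>bsimp (E V) 1 0. \<exists>y\<in>bsimp (E V) 1 0. a = S.cls V x \<and> b = S.cls V y \<and> (x, y) \<in> path_edges (?M V)"
        using W(1) em
        by (intro bexI[of _ W] bexI[of _ "vertex (?M W) 1 0 ?e"] bexI[of _ "vertex (?M W) 1 1 ?e"])
          (auto simp: path_edges_def)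
    next
      fix U W a b assume UW: "U \<in> J" "W \<in> J" "le W U" and "(a, b) \<in> path_edges (?M U)"
      then obtain e where e: "e \<in> edges (?M U) a b" by (auto simp: path_edges_def edges_def)
      have "t U W 0 0 (t V U 0 0 z) = t V W 0 0 z" if "z \<in> bsimp (E V) 0 0" for z
        by (rule t_trans[OF V(1) UW(1,2) V(2)[OF UW(1)] UW(3) that])
      with sset_map_edges[OF css_Map_map[OF t_map[OF UW] tx[OF UW(1)]] e] xy
      show "(t U W 1 0 a, t U W 1 0 b) \<in> path_edges (?M W)"
        by (force simp: path_edges_def edges_def)
    qed
    then obtain W where W: "W \<in> J"
      "(t V W 1 0 f, t V W 1 0 g) \<in> (path_edges (?M W) \<union> (path_edges (?M W))\<inverse>)\<^sup>*" by blast
    have "t V W 1 0 h \<in> simp (?M W) 0" if "h \<in> edges (row (E V) 0) x y" for h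
      using sset_map_edges[OF row_map[OF t_map[OF V(1) W(1) V(2)[OF W(1)]]] that]
      by (simp add: simp_space.simp_css_Map_0[OF simp_space_E[OF W(1)] tx[OF W(1)]])
    then show ?R using W fg by (auto simp: same_path_component_iff)
  next
    assume ?R
    then obtain W where W: "W \<in> J" "same_path_component (?M W) (t V W 1 0 f) (t V W 1 0 g)" by blast
    from same_path_component_map[OF c_Map[OF W(1)] W(2)] show ?L
      using c_t[OF W(1)] fg1 by simp
  }
qed

end

section \<open>Complete Segal spaces\<close>

lemma bsset_map_snd: "bsset_map (css_slice_pair W u v) (css_slice W v) (\<lambda>n k. snd)"
  by (auto simp: bsset_map_def css_slice_pair_def)

theorem css_filter_quotient_eq_iff:
  fixes C :: "'a bsset" and I :: "'i set"
  assumes filter: "product_closed_filter I \<Phi>" and C: "complete_segal_space C"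
    and final: "css_final C one" and initial: "css_strict_initial C zero"
    and sys: "css_product_system (css_power I C) (subset_filter I zero one \<Phi>) T"
    and sec: "css_section (css_power I C) (subset_object I zero one I) \<sigma>"
    and XY: "X \<in> bsimp (css_power I C) 0 0" "Y \<in> bsimp (css_power I C) 0 0"
    and fg: "f \<in> simp (css_Map (css_power I C) X Y) 0" "g \<in> simp (css_Map (css_power I C) X Y) 0"
  defines "P \<equiv> css_quotient_functor (css_power I C) (subset_filter I zero one \<Phi>) T (subset_object I zero one I) \<sigma>"
  shows "same_path_component
      (css_Map (css_filter_quotient (css_power I C) (subset_filter I zero one \<Phi>) T) (P 0 0 X) (P 0 0 Y)) (P 1 0 f) (P 1 0 g)
    \<longleftrightarrow> {i \<in> I. same_path_component (css_Map C (X i) (Y i)) (f i) (g i)} \<in> \<Phi>"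
proof -
  let ?D = "css_power I C" and ?F = "subset_filter I zero one \<Phi>" and ?V = "subset_object I zero one"
  let ?R = "qc_power I (row C 0)"
  interpret C: segal_space C
    by unfold_locales (use C in \<open>simp_all add: complete_segal_space_def\<close>)
  interpret R: tri_calculus "row C 0" by (rule C.tri_calculus_row)
  interpret D: simp_space ?D by (rule C.simp_space_power)
  have RD: "row ?D 0 = ?R" by (rule row_power)
  have obj: "zero \<in> bsimp C 0 0" "one \<in> bsimp C 0 0"
    using final initial by (auto simp: css_final_def css_strict_initial_def)
  have D0: "bsimp ?D 0 0 = PiE I (\<lambda>_. bsimp C 0 0)" and R0: "simp ?R 0 = bsimp ?D 0 0"
    by (simp_all add: css_power_def row_simps(1) flip: RD)
  have final': "edges (row C 0) z one \<noteq> {}" if "z \<in> bsimp C 0 0" for z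
    using that final contractible_path(1)[OF C.sset_css_Map[OF that obj(2)]]
    by (simp add: css_final_def C.simp_css_Map_0[OF that obj(2)])
  have le_C: "css_le C z w \<longleftrightarrow> edges (row C 0) z w \<noteq> {}" if "z \<in> bsimp C 0 0" "w \<in> bsimp C 0 0" for z w
    by (simp add: css_le_def C.simp_css_Map_0[OF that])
  have V0: "?V B \<in> bsimp ?D 0 0" for B using obj by (auto simp: D0 subset_object_def)
  have FV: "V \<in> bsimp ?D 0 0" if "V \<in> ?F" for V using that V0 by (auto simp: subset_filter_def)
  have le: "css_le ?D U V \<longleftrightarrow> (\<forall>i\<in>I. css_le C (U i) (V i))" if "U \<in> ?F" "V \<in> ?F" for U V
  proof -
    have UV: "U i \<in> bsimp C 0 0" "V i \<in> bsimp C 0 0" if "i \<in> I" for i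
      using FV[OF \<open>U \<in> ?F\<close>] FV[OF \<open>V \<in> ?F\<close>] that by (auto simp: D0)
    have "edges ?R U V = PiE I (\<lambda>i. edges (row C 0) (U i) (V i))"
      using edges_Pi_iff[of U I "\<lambda>_. row C 0" V] FV[OF that(1)] FV[OF that(2)]
      by (intro set_eqI) (auto simp: qc_power_def PiE_iff R0[unfolded qc_power_def])
    then show ?thesis
      using le_C[OF UV]
      by (simp add: css_le_def D.simp_css_Map_0[OF FV[OF that(1)] FV[OF that(2)]] RD PiE_eq_empty_iff)
  qed
  have le00: "css_le C zero zero" using le_C[OF obj(1,1)] R.const_simp_edge[of zero] obj by (auto simp: row_simps(1))
  note dir = subset_filter_directed[of I \<Phi> "css_le C", OF filter le00
      le_C[THEN iffD2, OF obj final'[OF obj(1)]] le_C[THEN iffD2, OF obj(2,2) final'[OF obj(2)]] le]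
  interpret F: directed_index ?F "css_le ?D" by (rule dir(1))
  interpret S: bsset_system ?F "css_le ?D" "css_slice ?D" T
  proof
    show "simplicial_space (css_slice ?D V)" if "V \<in> ?F" for V
      by (rule simp_space.simplicial_space[OF D.simp_space_slice[OF FV[OF that]]])
    show "T V V n k x = x" if "V \<in> ?F" "x \<in> bsimp (css_slice ?D V) n k" for V n k x
      using sys that unfolding css_product_system_def by blast
    show "bsset_map (css_slice ?D V) (css_slice ?D W) (T V W)" if "V \<in> ?F" "W \<in> ?F" "css_le ?D W V" for V W
      using sys that unfolding css_product_system_def css_times_functor_def by blast
    show "T V W n k (T U V n k x) = T U W n k x"
      if "U \<in> ?F" "V \<in> ?F" "W \<in> ?F" "css_le ?D V U" "css_le ?D W V" "x \<in> bsimp (css_slice ?D U) n k" for U V W n k x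
      using sys that unfolding css_product_system_def by blast
  qed
  let ?one = "?V I"
  have one: "?one \<in> ?F" by (rule dir(2))
  \<comment> \<open>The categorical data are read in \<open>?R\<close>, the zeroth row of the power,
    where slices and forgetful maps are those of simplicial sets.\<close>
  have row_sl: "row (css_slice ?D V) 0 = qc_slice ?R V" if "V \<in> bsimp ?D 0 0" for V
    using D.row_slice[OF that] by (simp only: RD)
  have sl: "bsimp (css_slice ?D V) n 0 = simp (qc_slice ?R V) n" if "V \<in> bsimp ?D 0 0" for V n
    by (simp add: row_simps(1) flip: row_sl[OF that])
  have fo: "css_forget ?D n 0 = qc_forget ?R n" for n
    by (simp add: css_forget_def qc_forget_def row_simps flip: RD)
  have \<sigma>b: "bsset_map ?D (css_slice ?D ?one) \<sigma>" using sec by (simp add: css_section_def)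
  have \<sigma>: "sset_map ?R (qc_slice ?R ?one) (\<lambda>n. \<sigma> n 0)"
    using row_map[OF \<sigma>b, of 0] by (simp only: RD row_sl[OF V0])
  have \<sigma>f: "qc_forget ?R n (\<sigma> n 0 x) = x" if "x \<in> simp ?R n" for n x
  proof -
    have "x \<in> bsimp ?D n 0" using that by (simp add: row_simps(1) flip: RD)
    then have "css_forget ?D n 0 (\<sigma> n 0 x) = x" using sec by (simp add: css_section_def)
    then show ?thesis by (simp only: fo)
  qed
  have fg': "f \<in> edges ?R X Y" "g \<in> edges ?R X Y"
    using fg by (simp_all add: D.simp_css_Map_0[OF XY] RD)
  have \<sigma>0: "\<sigma> 0 0 x \<in> bsimp (css_slice ?D ?one) 0 0" if "x \<in> bsimp ?D 0 0" for x
    by (rule bsset_map_in[OF \<sigma>b that])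
  have \<sigma>1: "\<sigma> 1 0 h \<in> edges (row (css_slice ?D ?one) 0) (\<sigma> 0 0 X) (\<sigma> 0 0 Y)" if "h \<in> edges ?R X Y" for h
    using sset_map_edges[OF \<sigma> that] by (simp only: row_sl[OF V0])
  let ?M = "\<lambda>W. css_Map (css_slice ?D W) (T ?one W 0 0 (\<sigma> 0 0 X)) (T ?one W 0 0 (\<sigma> 0 0 Y))"
  let ?path = "\<lambda>W. same_path_component (?M W) (T ?one W 1 0 (\<sigma> 1 0 f)) (T ?one W 1 0 (\<sigma> 1 0 g))"
  have stage: "same_path_component (css_Map (css_filter_quotient ?D ?F T) (P 0 0 X) (P 0 0 Y)) (P 1 0 f) (P 1 0 g)
    \<longleftrightarrow> (\<exists>W\<in>?F. ?path W)"
    unfolding P_def css_quotient_functor_def css_filter_quotient_def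
      bsset_colim_def[symmetric] bcolim_class_def[symmetric]
    by (rule S.same_path_component_Map_colim[OF one dir(3) \<sigma>0[OF XY(1)] \<sigma>0[OF XY(2)] \<sigma>1[OF fg'(1)] \<sigma>1[OF fg'(2)]])
  let ?\<sigma> = "\<lambda>n. \<sigma> n 0" and ?T = "\<lambda>B n. T ?one (?V B) n 0"
  \<comment> \<open>Restriction to spatial dimension 0 turns the functor, the section and the
    natural transformation into data for \<open>power_stage\<close>. Finality is kept in its
    original form, since it speaks of whole mapping spaces.\<close>
  have stage_data: "\<exists>\<eta>. power_stage (row C 0) I zero one B ?\<sigma> (?T B) \<eta> \<and>
    (\<forall>x\<in>bsimp ?D 0 0. css_final (css_slice_pair ?D x (?V B))
      (times_stage.proj_at ?R ?one ?\<sigma> \<eta> x, T ?one (?V B) 0 0 (\<sigma> 0 0 x)))"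
    if "B \<in> \<Phi>" for B
  proof -
    have "?V B \<in> ?F" using that by (auto simp: subset_filter_def)
    then have "css_times_functor ?D ?one (?V B) (T ?one (?V B))"
      using sys one dir(3) unfolding css_product_system_def by blast
    then obtain \<eta> where T: "bsset_map (css_slice ?D ?one) (css_slice ?D (?V B)) (T ?one (?V B))"
      and \<eta>0: "bsset_map (css_prod_interval (css_slice ?D ?one)) ?D \<eta>"
        "\<And>n k s. s \<in> bsimp (css_slice ?D ?one) n k \<Longrightarrow> \<eta> n k (s, std_const 0 n) = css_forget ?D n k (T ?one (?V B) n k s)"
        "\<And>n k s. s \<in> bsimp (css_slice ?D ?one) n k \<Longrightarrow> \<eta> n k (s, std_const 1 n) = css_forget ?D n k s"
        "\<And>a. a \<in> bsimp (css_slice ?D ?one) 0 0 \<Longrightarrow> css_final (css_slice_pair ?D (css_forget ?D 0 0 a) (?V B))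
             (\<eta> 1 0 (hdeg (css_slice ?D ?one) 0 a, iota), T ?one (?V B) 0 0 a)"
      unfolding css_times_functor_def iota_def by blast
    let ?\<eta> = "\<lambda>n. \<eta> n 0"
    have "sset_map (qc_slice ?R ?one) (qc_slice ?R (?V B)) (?T B)"
      using row_map[OF T, of 0] by (simp only: row_sl[OF V0])
    moreover have "sset_map (sset_prod (qc_slice ?R ?one) (std_simplex 1)) ?R ?\<eta>"
      using row_map[OF \<eta>0(1), of 0] by (simp only: row_prod_interval row_sl[OF V0] RD)
    moreover have "one \<in> simp (row C 0) 0" using obj by (simp add: row_simps)
    moreover have "sset ?R" using D.sset_row[of 0] by (simp only: RD)
    ultimately interpret power_stage "row C 0" I zero one B ?\<sigma> "?T B" ?\<eta>
      by unfold_locales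
        (use \<sigma> \<sigma>f \<eta>0(2,3)[of _ _ 0] that filter in
          \<open>auto simp: product_closed_filter_def sset_def sl[OF V0] fo\<close>)
    have "css_final (css_slice_pair ?D x (?V B)) (proj_at x, T ?one (?V B) 0 0 (\<sigma> 0 0 x))" if x: "x \<in> bsimp ?D 0 0" for x
    proof -
      have "css_forget ?D 0 0 (\<sigma> 0 0 x) = x" using \<sigma>f[of x 0] x by (simp add: R0 fo)
      moreover have "hdeg (css_slice ?D ?one) 0 (\<sigma> 0 0 x) = const_simp (qc_slice ?R ?one) 1 (\<sigma> 0 0 x)"
        by (simp only: row_simps(5)[symmetric] row_sl[OF V0])
      ultimately show ?thesis using \<eta>0(4)[OF \<sigma>0[OF x]] by (simp add: proj_at_def)
    qed
    then show ?thesis using power_stage_axioms by blast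
  qed
  \<comment> \<open>Vertices of the mapping spaces between cones are edges of the row, which
    connects finality of the product cone with the lemmas about \<open>?R\<close>.\<close>
  have pair: "sset (css_Map (css_slice_pair ?D u v) p q)"
    "simp (css_Map (css_slice_pair ?D u v) p q) 0 = edges (qc_slice_pair ?R u v) p q"
    if "u \<in> bsimp ?D 0 0" "v \<in> bsimp ?D 0 0" "p \<in> simp (qc_slice_pair ?R u v) 0" "q \<in> simp (qc_slice_pair ?R u v) 0" for u v p q
  proof -
    interpret S: simp_space "css_slice_pair ?D u v" by (rule D.simp_space_slice_pair[OF that(1,2)])
    have r: "row (css_slice_pair ?D u v) 0 = qc_slice_pair ?R u v"
      using D.row_slice_pair[OF that(1,2)] by (simp only: RD)
    then have "p \<in> bsimp (css_slice_pair ?D u v) 0 0" "q \<in> bsimp (css_slice_pair ?D u v) 0 0"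
      using that(3,4) by (simp_all add: row_simps(1) flip: r)
    from S.sset_css_Map[OF this] S.simp_css_Map_0[OF this]
    show "sset (css_Map (css_slice_pair ?D u v) p q)"
      "simp (css_Map (css_slice_pair ?D u v) p q) 0 = edges (qc_slice_pair ?R u v) p q" by (simp_all only: r)
  qed
  have pair0: "bsimp (css_slice_pair ?D u v) 0 0 = simp (qc_slice_pair ?R u v) 0"
    if "u \<in> bsimp ?D 0 0" "v \<in> bsimp ?D 0 0" for u v
    using D.row_slice_pair[OF that] by (simp add: RD row_simps(1)[symmetric])
  let ?A = "{i \<in> I. same_path_component (css_Map C (X i) (Y i)) (f i) (g i)}"
  have coord: "X i \<in> bsimp C 0 0" "Y i \<in> bsimp C 0 0" "f i \<in> edges (row C 0) (X i) (Y i)" "g i \<in> edges (row C 0) (X i) (Y i)"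
    if "i \<in> I" for i
    using XY that sset_map_edges[OF proj_map[OF that, of "\<lambda>_. row C 0"] fg'(1)[unfolded qc_power_def]]
      sset_map_edges[OF proj_map[OF that, of "\<lambda>_. row C 0"] fg'(2)[unfolded qc_power_def]]
    by (auto simp: D0)
  have A: "i \<in> ?A \<longleftrightarrow> i \<in> I \<and> R.eqv (f i) (g i)" for i
    using C.same_path_component_css_Map_iff[OF coord(1,2)] coord(3,4) by blast
  show ?thesis unfolding stage
  proof
    assume "\<exists>W\<in>?F. ?path W"
    then obtain B where B\<Phi>: "B \<in> \<Phi>" and path: "?path (?V B)" by (auto simp: subset_filter_def)
    obtain \<eta> where "power_stage (row C 0) I zero one B ?\<sigma> (?T B) \<eta>"
      and fin: "\<And>x. x \<in> bsimp ?D 0 0 \<Longrightarrow> css_final (css_slice_pair ?D x (?V B))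
        (times_stage.proj_at ?R ?one ?\<sigma> \<eta> x, T ?one (?V B) 0 0 (\<sigma> 0 0 x))"
      using stage_data[OF B\<Phi>] by blast
    then interpret power_stage "row C 0" I zero one B ?\<sigma> "?T B" \<eta> by simp
    have finX: "css_final (css_slice_pair ?D X (?V B)) (proj_at X, obj_at X)"
      using fin[OF XY(1)] by (simp add: obj_at_def)
    have ex: "edges (qc_slice_pair ?R X (?V B)) p (proj_at X, obj_at X) \<noteq> {}"
      if p: "p \<in> simp (qc_slice_pair ?R X (?V B)) 0" for p
    proof -
      have q: "(proj_at X, obj_at X) \<in> simp (qc_slice_pair ?R X (?V B)) 0"
        using finX by (simp add: css_final_def pair0[OF XY(1) V0])
      show ?thesis
        using contractible_path(1)[OF pair(1)[OF XY(1) V0 p q]] finX p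
        by (simp add: css_final_def pair0[OF XY(1) V0] pair(2)[OF XY(1) V0 p q])
    qed
    have ob: "obj_at X \<in> bsimp (css_slice ?D (?V B)) 0 0" "obj_at Y \<in> bsimp (css_slice ?D (?V B)) 0 0"
      using obj_at_in XY by (simp_all add: R0 sl[OF V0])
    let ?x = "css_forget ?D 0 0 (obj_at X)" and ?y = "css_forget ?D 0 0 (obj_at Y)"
    have xy: "?x \<in> bsimp ?D 0 0" "?y \<in> bsimp ?D 0 0"
      using bsset_map_in[OF D.forget_bsset_map] ob by blast+
    \<comment> \<open>Forgetting the slice, and below projecting to an index, yields a path of
      product maps in \<open>C\<close>, which is then traded for a triangle of the row.\<close>
    have p: "same_path_component (css_Map ?D ?x ?y) (css_forget ?D 1 0 (map_at f)) (css_forget ?D 1 0 (map_at g))"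
      using same_path_component_css_Map[OF D.forget_bsset_map ob] path by (simp add: obj_at_def map_at_def)
    have fo1: "css_forget ?D 1 0 h = face ?R 2 2 h" for h
      by (simp add: fo qc_forget_def numeral_2_eq_2)
    have "i \<in> ?A" if i: "i \<in> B" for i
    proof -
      have iI: "i \<in> I" using i B by blast
      have "same_path_component (css_Map C (?x i) (?y i)) (face ?R 2 2 (map_at f) i) (face ?R 2 2 (map_at g) i)"
        using same_path_component_css_Map[OF power_proj_map[OF iI, of C] xy p] by (simp only: fo1)
      moreover have "?x i \<in> bsimp C 0 0" "?y i \<in> bsimp C 0 0" using xy iI by (auto simp: D0)
      ultimately have "R.eqv (face ?R 2 2 (map_at f) i) (face ?R 2 2 (map_at g) i)"
        using C.same_path_component_css_Map_iff by blast
      from eqv_if_eqv_at[OF ex _ _ i fg' this] show ?thesis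
        using A iI final' XY(1) by (simp add: R0 row_simps(1))
    qed
    then have "B \<subseteq> ?A" by blast
    then show "?A \<in> \<Phi>" using upward_closed_filter_iff[OF filter, of ?A] B\<Phi> by auto
  next
    assume A\<Phi>: "?A \<in> \<Phi>"
    obtain \<eta> where "power_stage (row C 0) I zero one ?A ?\<sigma> (?T ?A) \<eta>"
      and fin: "\<And>x. x \<in> bsimp ?D 0 0 \<Longrightarrow> css_final (css_slice_pair ?D x (?V ?A))
        (times_stage.proj_at ?R ?one ?\<sigma> \<eta> x, T ?one (?V ?A) 0 0 (\<sigma> 0 0 x))"
      using stage_data[OF A\<Phi>] by blast
    then interpret power_stage "row C 0" I zero one ?A ?\<sigma> "?T ?A" \<eta> by simp
    let ?S = "qc_slice_pair ?R Y (?V ?A)" and ?p = "(diag_at f, obj_at X)" and ?q = "(proj_at Y, obj_at Y)"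
    have "\<exists>w w'. ?p \<in> simp ?S 0 \<and> (w, map_at f) \<in> edges ?S ?p ?q \<and> (w', map_at g) \<in> edges ?S ?p ?q"
    proof (rule common_cone[OF _ _ fg'])
      fix i assume "i \<in> ?A" then show "R.eqv (f i) (g i)" using A by blast
    next
      fix i h h'
      let ?x = "vertex (row C 0) 1 0 (obj_at X i)"
      assume i: "i \<in> I - ?A" and h: "h \<in> edges (row C 0) ?x (Y i)" "h' \<in> edges (row C 0) ?x (Y i)"
      have "obj_at X i \<in> edges (row C 0) ?x zero"
        using obj_at_edge[of X i] i XY(1) by (simp add: R0 subset_object_def)
      moreover have x: "?x \<in> bsimp C 0 0" using R.edges_vertices[OF h(1)] by (simp add: row_simps(1))
      ultimately have "css_initial C ?x" using initial le_C[OF x obj(1)] by (auto simp: css_strict_initial_def)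
      then have "contractible (css_Map C ?x (Y i))" using coord i by (simp add: css_initial_def)
      moreover have y: "Y i \<in> bsimp C 0 0" using coord i by blast
      ultimately have "same_path_component (css_Map C ?x (Y i)) h h'"
        using contractible_path(2)[OF C.sset_css_Map[OF x y]] h C.simp_css_Map_0[OF x y] by blast
      then show "R.eqv h h'" using C.same_path_component_css_Map_iff[OF x y] by blast
    qed
    then obtain w w' where p: "?p \<in> simp ?S 0" and w: "(w, map_at f) \<in> edges ?S ?p ?q" "(w', map_at g) \<in> edges ?S ?p ?q"
      by blast
    have finY: "css_final (css_slice_pair ?D Y (?V ?A)) ?q" using fin[OF XY(2)] by (simp add: obj_at_def)
    have q: "?q \<in> simp ?S 0" using finY by (simp add: css_final_def pair0[OF XY(2) V0])
    \<comment> \<open>The path obtained from contractibility joins the two maps of cones found in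
      the row; its second component is the path over the stage.\<close>
    have "contractible (css_Map (css_slice_pair ?D Y (?V ?A)) ?p ?q)"
      using finY p by (simp add: css_final_def pair0[OF XY(2) V0])
    from contractible_path(2)[OF pair(1)[OF XY(2) V0 p q] this] w
    have "same_path_component (css_Map (css_slice_pair ?D Y (?V ?A)) ?p ?q) (w, map_at f) (w', map_at g)"
      by (simp add: pair(2)[OF XY(2) V0 p q])
    from same_path_component_css_Map[OF bsset_map_snd _ _ this] p q have "?path (?V ?A)"
      by (simp add: obj_at_def map_at_def pair0[OF XY(2) V0])
    moreover have "?V ?A \<in> ?F" using A\<Phi> by (auto simp: subset_filter_def)
    ultimately show "\<exists>W\<in>?F. ?path W" by blast
  qed
qed

theorem corollary4p5:
  fixes I :: "'i set" and \<Phi> :: "'i set set"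
  assumes filter: "product_closed_filter I \<Phi>"
  shows
    "(\<forall>(C :: ('o, 'm) enriched) zero one pr p tr X Y f g.
        kan_enriched_category C \<and> kan_finitely_complete C \<and> kan_final C one \<and>
        only_two_subobjects (kan_sub C one) (kan_le C) zero one \<and> kan_strict_initial C zero \<and>
        kan_product_system (kan_power I C) (subset_filter I zero one \<Phi>) pr p tr \<and>
        X \<in> obj (kan_power I C) \<and> Y \<in> obj (kan_power I C) \<and>
        f \<in> simp (Map (kan_power I C) X Y) 0 \<and> g \<in> simp (Map (kan_power I C) X Y) 0
        \<longrightarrow>
        (let P = kan_quotient_functor (kan_power I C) (subset_filter I zero one \<Phi>) pr p tr
                   (subset_object I zero one I)
         in same_path_component
              (kan_quotient_Map (kan_power I C) (subset_filter I zero one \<Phi>) pr tr X Y)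
              (P X Y 0 f) (P X Y 0 g))
        \<longleftrightarrow> {i \<in> I. same_path_component (Map C (X i) (Y i)) (f i) (g i)} \<in> \<Phi>)
     \<and>
     (\<forall>(C :: 'a sset) zero one T \<sigma> X Y f g.
        quasi_category C \<and> qc_finitely_complete C \<and> qc_final C one \<and>
        only_two_subobjects (qc_sub C one) (qc_le C) zero one \<and> qc_strict_initial C zero \<and>
        qc_product_system (qc_power I C) (subset_filter I zero one \<Phi>) T \<and>
        qc_section (qc_power I C) (subset_object I zero one I) \<sigma> \<and>
        X \<in> simp (qc_power I C) 0 \<and> Y \<in> simp (qc_power I C) 0 \<and>
        f \<in> simp (qc_Map (qc_power I C) X Y) 0 \<and> g \<in> simp (qc_Map (qc_power I C) X Y) 0
        \<longrightarrow>
        (let P = qc_quotient_functor (qc_power I C) (subset_filter I zero one \<Phi>) T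
                   (subset_object I zero one I) \<sigma>
         in same_path_component
              (qc_Map (qc_filter_quotient (qc_power I C) (subset_filter I zero one \<Phi>) T)
                 (P 0 X) (P 0 Y))
              (P 1 f) (P 1 g))
        \<longleftrightarrow> {i \<in> I. same_path_component (qc_Map C (X i) (Y i)) (f i) (g i)} \<in> \<Phi>)
     \<and>
     (\<forall>(C :: 'b bsset) zero one T \<sigma> X Y f g.
        complete_segal_space C \<and> css_finitely_complete C \<and> css_final C one \<and>
        only_two_subobjects (css_sub C one) (css_le C) zero one \<and> css_strict_initial C zero \<and>
        css_product_system (css_power I C) (subset_filter I zero one \<Phi>) T \<and>
        css_section (css_power I C) (subset_object I zero one I) \<sigma> \<and>
        X \<in> bsimp (css_power I C) 0 0 \<and> Y \<in> bsimp (css_power I C) 0 0 \<and>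
        f \<in> simp (css_Map (css_power I C) X Y) 0 \<and> g \<in> simp (css_Map (css_power I C) X Y) 0
        \<longrightarrow>
        (let P = css_quotient_functor (css_power I C) (subset_filter I zero one \<Phi>) T
                   (subset_object I zero one I) \<sigma>
         in same_path_component
              (css_Map (css_filter_quotient (css_power I C) (subset_filter I zero one \<Phi>) T)
                 (P 0 0 X) (P 0 0 Y))
              (P 1 0 f) (P 1 0 g))
        \<longleftrightarrow> {i \<in> I. same_path_component (css_Map C (X i) (Y i)) (f i) (g i)} \<in> \<Phi>)"
proof (intro conjI allI impI; elim conjE; unfold Let_def)
  fix C :: "('o, 'm) enriched" and zero one pr p tr X Y f g
  assume "kan_enriched_category C" "kan_final C one" "kan_strict_initial C zero"
    "kan_product_system (kan_power I C) (subset_filter I zero one \<Phi>) pr p tr"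
    "X \<in> obj (kan_power I C)" "Y \<in> obj (kan_power I C)"
    "f \<in> simp (Map (kan_power I C) X Y) 0" "g \<in> simp (Map (kan_power I C) X Y) 0"
  from kan_filter_quotient_eq_iff[OF filter this]
  show "same_path_component (kan_quotient_Map (kan_power I C) (subset_filter I zero one \<Phi>) pr tr X Y)
      (kan_quotient_functor (kan_power I C) (subset_filter I zero one \<Phi>) pr p tr (subset_object I zero one I) X Y 0 f)
      (kan_quotient_functor (kan_power I C) (subset_filter I zero one \<Phi>) pr p tr (subset_object I zero one I) X Y 0 g)
    \<longleftrightarrow> {i \<in> I. same_path_component (Map C (X i) (Y i)) (f i) (g i)} \<in> \<Phi>" .
next
  fix C :: "'a sset" and zero one T \<sigma> X Y f g
  let ?P = "qc_quotient_functor (qc_power I C) (subset_filter I zero one \<Phi>) T (subset_object I zero one I) \<sigma>"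
  assume "quasi_category C" "qc_final C one" "qc_strict_initial C zero"
    "qc_product_system (qc_power I C) (subset_filter I zero one \<Phi>) T"
    "qc_section (qc_power I C) (subset_object I zero one I) \<sigma>"
    "X \<in> simp (qc_power I C) 0" "Y \<in> simp (qc_power I C) 0"
    "f \<in> simp (qc_Map (qc_power I C) X Y) 0" "g \<in> simp (qc_Map (qc_power I C) X Y) 0"
  from qc_filter_quotient_eq_iff[OF filter this]
  show "same_path_component
      (qc_Map (qc_filter_quotient (qc_power I C) (subset_filter I zero one \<Phi>) T) (?P 0 X) (?P 0 Y)) (?P 1 f) (?P 1 g)
    \<longleftrightarrow> {i \<in> I. same_path_component (qc_Map C (X i) (Y i)) (f i) (g i)} \<in> \<Phi>" .
next
  fix C :: "'b bsset" and zero one T \<sigma> X Y f g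
  let ?P = "css_quotient_functor (css_power I C) (subset_filter I zero one \<Phi>) T (subset_object I zero one I) \<sigma>"
  assume "complete_segal_space C" "css_final C one" "css_strict_initial C zero"
    "css_product_system (css_power I C) (subset_filter I zero one \<Phi>) T"
    "css_section (css_power I C) (subset_object I zero one I) \<sigma>"
    "X \<in> bsimp (css_power I C) 0 0" "Y \<in> bsimp (css_power I C) 0 0"
    "f \<in> simp (css_Map (css_power I C) X Y) 0" "g \<in> simp (css_Map (css_power I C) X Y) 0"
  from css_filter_quotient_eq_iff[OF filter this]
  show "same_path_component
      (css_Map (css_filter_quotient (css_power I C) (subset_filter I zero one \<Phi>) T) (?P 0 0 X) (?P 0 0 Y)) (?P 1 0 f) (?P 1 0 g)
    \<longleftrightarrow> {i \<in> I. same_path_component (css_Map C (X i) (Y i)) (f i) (g i)} \<in> \<Phi>" .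
qed

end
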